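(* Let $u'''=f(x,u,p,q)$ (with $p=u'$, $q=u''$) be a third-order ODE. It is equivalent under a point transformation to one of the canonical forms (each having four point symmetries) (i) $u'''=\alpha\frac{(u'')^2}{u'}$ for some $\alpha\neq 0,\tfrac32,3$, (ii) $u'''=(u'')^2$, if and only if $I_4\ne0$, $I_5\neq 0$, $I_6=0$, $J_{4_q}\neq 0$ and, for appropriate choices of the roots $J_4$ and $J_5$ (defined by $J_4^3=I_4$, $-J_5^2=I_5$), the coframe $$ \begin{pmatrix}\theta^{1}\\ \theta^{2}\\ \theta^{3}\\ \theta^4\end{pmatrix}= \begin{pmatrix} J_4J_5 & 0 & 0&0 \\ \frac{J_4J_5^2I_7}{J_{4_q}} &J_5& 0 &0 \\ \frac{J_5(J_4^2J_5^2I_7^2+I_2J_{4_q}^2)}{2J_{4_q}^2J_4}&\frac{J_5(3J_4J_5I_7+I_1J_{4_q})}{3J_{4_q}J_4} &\frac{J_5}{J_4}&0\\ I_3J_4&0&0&J_4 \end{pmatrix} \begin{pmatrix}\omega^{1}\\ \omega^{2}\\ \omega^{3}\\ \omega^{4}\end{pmatrix} $$ has constant structure functions identical to those of the coframe constructed by the same formulas from the canonical form (i) for some admissible $\alpha$, respectively from the canonical form (ii). Furthermore, in case (i), the parameter $\alpha$ can be evaluated by the invariant relation $\frac{J_{4_q}}{J_5}=\frac{\beta}{\gamma}$, where $\beta^3=2\alpha^3-9\alpha^2+9\alpha$ and $\gamma^2=\alpha^2-3\alpha$ (for appropriate choices of the roots).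
   Context: Everything is local and over the complex numbers. $(x,u,p,q)$, with $p=u'$, $q=u''$, are local coordinates on the second-order jet space. Two third-order ODEs $u'''=f(x,u,u',u'')$ and $\bar u'''=\bar f(\bar x,\bar u,\bar u',\bar u'')$ are equivalent under a point transformation if there is a transformation $\bar x=\varphi(x,u)$, $\bar u=\psi(x,u)$ with $\varphi_x\psi_u-\varphi_u\psi_x\ne0$ mapping one to the other. For an ODE with right-hand side $f(x,u,p,q)$ put $\hat D_x=\partial_x+p\,\partial_u+q\,\partial_p+f\,\partial_q$; letter subscripts denote partial derivatives (e.g. $J_{4_q}=\partial J_4/\partial q$). The base coframe is $\omega^1=du-p\,dx$, $\omega^2=dp-q\,dx$, $\omega^3=dq-f\,dx$, $\omega^4=dx$. Define $$I_1=-f_q,\qquad I_2=-\tfrac29 I_1^2-f_p-\tfrac13\hat D_xI_1,\qquad I_3=-\tfrac16 I_{1_q},$$ $$I_4=-\tfrac13I_1I_2-f_u-\tfrac12\hat D_xI_2,\qquad I_6=-I_{3_q},\qquad I_5=-I_3^2-I_{3_p},$$ $$I_4=J_4^3,\qquad I_5=-J_5^2,\qquad I_7=-\frac{1}{3J_4J_5^2}\left(3I_3J_4J_5+I_1J_{4_q}J_5-3J_{4_p}J_5\right),$$ so $J_4$ is a cube root of $I_4$ and $J_5$ a square root of $-I_5$. The structure functions $T^i_{jk}$ of a coframe $\theta^1,\dots,\theta^4$ are defined by $d\theta^i=\sum_{j<k}T^i_{jk}\,\theta^j\wedge\theta^k$. *)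

theory Defs
  imports "HOL-Analysis.Analysis"
begin

text \<open>
  Points of the second-order jet space are vectors (x, u, p, q) in \<open>complex^4\<close>; points of the
  (x, u)-plane are vectors in \<open>complex^2\<close>. In the index type \<open>4\<close> the numeral 4 coincides with 0,
  so the order of that type is not the order 1 < 2 < 3 < 4 of the coordinates; it is never used
  below.

  Everything is local. A third-order ODE is given by the germ of its right-hand side f at a jet a,
  and identities between functions are required on a neighbourhood of the base point.
\<close>

definition partial :: "'n::finite \<Rightarrow> (complex^'n \<Rightarrow> complex) \<Rightarrow> complex^'n \<Rightarrow> complex" where
  "partial i F z = deriv (\<lambda>t. F (z + axis i t)) 0"

text \<open>Complex-linear Frechet differentiability on a neighbourhood of the point:\<close>

definition holomorphic_at :: "(complex^'n::finite \<Rightarrow> complex) \<Rightarrow> complex^'n \<Rightarrow> bool" where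
  "holomorphic_at F a \<longleftrightarrow>
     (\<forall>\<^sub>F z in nhds a. \<exists>L::complex^'n. (F has_derivative (\<lambda>h. \<Sum>i\<in>UNIV. L $ i * h $ i)) (at z))"

definition base :: "complex^4 \<Rightarrow> complex^2" where
  "base z = vector [z $ 1, z $ 2]"

definition total_deriv :: "(complex^4 \<Rightarrow> complex) \<Rightarrow> (complex^4 \<Rightarrow> complex) \<Rightarrow> complex^4 \<Rightarrow> complex" where
  "total_deriv f F z =
     partial 1 F z + z $ 3 * partial 2 F z + z $ 4 * partial 3 F z + f z * partial 4 F z"


subsection \<open>Point transformations and point symmetries\<close>

text \<open>
  The transformation (\<open>\<phi>\<close>, \<open>\<psi>\<close>) acts on jets by prolongation: along solutions of u''' = f the
  transformed derivatives are \<open>P = D \<psi> / D \<phi>\<close>, \<open>Q = D P / D \<phi>\<close>, \<open>R = D Q / D \<phi>\<close>, where D is the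
  total derivative of the source equation. It maps u''' = f to u''' = g if R = g (X, U, P, Q).
  The base jet a is mapped to the base jet b, both being finite (\<open>D \<phi> \<noteq> 0\<close> at a).
\<close>

definition point_equivalent ::
  "(complex^4 \<Rightarrow> complex) \<Rightarrow> complex^4 \<Rightarrow> (complex^4 \<Rightarrow> complex) \<Rightarrow> complex^4 \<Rightarrow> bool" where
  "point_equivalent f a g b \<longleftrightarrow>
     (\<exists>\<phi> \<psi> :: complex^2 \<Rightarrow> complex.
        holomorphic_at \<phi> (base a) \<and> holomorphic_at \<psi> (base a) \<and>
        partial 1 \<phi> (base a) * partial 2 \<psi> (base a)
          - partial 2 \<phi> (base a) * partial 1 \<psi> (base a) \<noteq> 0 \<and>
        (let X = (\<lambda>z. \<phi> (base z));
             U = (\<lambda>z. \<psi> (base z));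
             P = (\<lambda>z. total_deriv f U z / total_deriv f X z);
             Q = (\<lambda>z. total_deriv f P z / total_deriv f X z);
             R = (\<lambda>z. total_deriv f Q z / total_deriv f X z)
         in total_deriv f X a \<noteq> 0 \<and>
            vector [X a, U a, P a, Q a] = b \<and>
            (\<forall>\<^sub>F z in nhds a. R z = g (vector [X z, U z, P z, Q z]))))"

text \<open>
  The vector field \<open>\<xi> \<partial>\<^sub>x + \<eta> \<partial>\<^sub>u\<close> with \<open>\<xi> = V $ 1\<close>, \<open>\<eta> = V $ 2\<close> is an infinitesimal point symmetry of
  u''' = f if its third prolongation annihilates u''' - f on the equation. \<open>\<eta>1\<close>, \<open>\<eta>2\<close>, \<open>\<eta>3\<close> are the
  prolongation coefficients restricted to the equation.
\<close>

definition point_symmetry ::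
  "(complex^4 \<Rightarrow> complex) \<Rightarrow> complex^4 \<Rightarrow> (complex^2 \<Rightarrow> complex^2) \<Rightarrow> bool" where
  "point_symmetry f a V \<longleftrightarrow>
     holomorphic_at (\<lambda>w. V w $ 1) (base a) \<and> holomorphic_at (\<lambda>w. V w $ 2) (base a) \<and>
     (let \<xi> = (\<lambda>z. V (base z) $ 1);
          \<eta> = (\<lambda>z. V (base z) $ 2);
          \<eta>1 = (\<lambda>z. total_deriv f \<eta> z - z $ 3 * total_deriv f \<xi> z);
          \<eta>2 = (\<lambda>z. total_deriv f \<eta>1 z - z $ 4 * total_deriv f \<xi> z);
          \<eta>3 = (\<lambda>z. total_deriv f \<eta>2 z - f z * total_deriv f \<xi> z)
      in \<forall>\<^sub>F z in nhds a.
           \<eta>3 z = \<xi> z * partial 1 f z + \<eta> z * partial 2 f z + \<eta>1 z * partial 3 f z + \<eta>2 z * partial 4 f z)"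

text \<open>The germs of infinitesimal point symmetries form a complex vector space with a basis of four
  elements:\<close>

definition four_point_symmetries :: "(complex^4 \<Rightarrow> complex) \<Rightarrow> complex^4 \<Rightarrow> bool" where
  "four_point_symmetries f a \<longleftrightarrow>
     (\<exists>B :: 4 \<Rightarrow> complex^2 \<Rightarrow> complex^2.
        (\<forall>i. point_symmetry f a (B i)) \<and>
        (\<forall>V. point_symmetry f a V \<longrightarrow>
           (\<exists>!c::complex^4. \<forall>\<^sub>F w in nhds (base a). V w = (\<Sum>i\<in>UNIV. c $ i *s B i w))))"


subsection \<open>Relative invariants and the coframe\<close>

definition I1 :: "(complex^4 \<Rightarrow> complex) \<Rightarrow> complex^4 \<Rightarrow> complex" where
  "I1 f z = - partial 4 f z"

definition I2 :: "(complex^4 \<Rightarrow> complex) \<Rightarrow> complex^4 \<Rightarrow> complex" where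
  "I2 f z = - (2/9) * (I1 f z)\<^sup>2 - partial 3 f z - (1/3) * total_deriv f (I1 f) z"

definition I3 :: "(complex^4 \<Rightarrow> complex) \<Rightarrow> complex^4 \<Rightarrow> complex" where
  "I3 f z = - (1/6) * partial 4 (I1 f) z"

definition I4 :: "(complex^4 \<Rightarrow> complex) \<Rightarrow> complex^4 \<Rightarrow> complex" where
  "I4 f z = - (1/3) * I1 f z * I2 f z - partial 2 f z - (1/2) * total_deriv f (I2 f) z"

definition I5 :: "(complex^4 \<Rightarrow> complex) \<Rightarrow> complex^4 \<Rightarrow> complex" where
  "I5 f z = - (I3 f z)\<^sup>2 - partial 3 (I3 f) z"

definition I6 :: "(complex^4 \<Rightarrow> complex) \<Rightarrow> complex^4 \<Rightarrow> complex" where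
  "I6 f z = - partial 4 (I3 f) z"

definition invariant_roots ::
  "(complex^4 \<Rightarrow> complex) \<Rightarrow> complex^4 \<Rightarrow> (complex^4 \<Rightarrow> complex) \<Rightarrow> (complex^4 \<Rightarrow> complex) \<Rightarrow> bool" where
  "invariant_roots f a J4 J5 \<longleftrightarrow>
     holomorphic_at J4 a \<and> holomorphic_at J5 a \<and>
     (\<forall>\<^sub>F z in nhds a. J4 z ^ 3 = I4 f z \<and> - (J5 z)\<^sup>2 = I5 f z)"

definition I7 ::
  "(complex^4 \<Rightarrow> complex) \<Rightarrow> (complex^4 \<Rightarrow> complex) \<Rightarrow> (complex^4 \<Rightarrow> complex) \<Rightarrow> complex^4 \<Rightarrow> complex" where
  "I7 f J4 J5 z =
     - (1 / (3 * J4 z * (J5 z)\<^sup>2))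
       * (3 * I3 f z * J4 z * J5 z + I1 f z * partial 4 J4 z * J5 z - 3 * partial 3 J4 z * J5 z)"

text \<open>One-forms are given by their components with respect to dx, du, dp, dq; row i of a coframe
  matrix contains the components of the i-th form.\<close>

definition base_coframe :: "(complex^4 \<Rightarrow> complex) \<Rightarrow> complex^4 \<Rightarrow> complex^4^4" where
  "base_coframe f z = vector
     [vector [- z $ 3, 1, 0, 0],
      vector [- z $ 4, 0, 1, 0],
      vector [- f z, 0, 0, 1],
      vector [1, 0, 0, 0]]"

definition invariant_coframe ::
  "(complex^4 \<Rightarrow> complex) \<Rightarrow> (complex^4 \<Rightarrow> complex) \<Rightarrow> (complex^4 \<Rightarrow> complex) \<Rightarrow> complex^4 \<Rightarrow> complex^4^4" where
  "invariant_coframe f J4 J5 z =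
     (let j4 = J4 z; j5 = J5 z; j4q = partial 4 J4 z;
          i1 = I1 f z; i2 = I2 f z; i3 = I3 f z; i7 = I7 f J4 J5 z;
          S = (vector
            [vector [j4 * j5, 0, 0, 0],
             vector [j4 * j5\<^sup>2 * i7 / j4q, j5, 0, 0],
             vector [j5 * (j4\<^sup>2 * j5\<^sup>2 * i7\<^sup>2 + i2 * j4q\<^sup>2) / (2 * j4q\<^sup>2 * j4),
                     j5 * (3 * j4 * j5 * i7 + i1 * j4q) / (3 * j4q * j4),
                     j5 / j4, 0],
             vector [i3 * j4, 0, 0, j4]] :: complex^4^4)
      in S ** base_coframe f z)"

definition ext_deriv :: "(complex^4 \<Rightarrow> complex^4) \<Rightarrow> complex^4 \<Rightarrow> 4 \<Rightarrow> 4 \<Rightarrow> complex" where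
  "ext_deriv \<eta> z r s = partial r (\<lambda>w. \<eta> w $ s) z - partial s (\<lambda>w. \<eta> w $ r) z"

definition wedge :: "complex^4 \<Rightarrow> complex^4 \<Rightarrow> 4 \<Rightarrow> 4 \<Rightarrow> complex" where
  "wedge \<eta> \<zeta> r s = \<eta> $ r * \<zeta> $ s - \<eta> $ s * \<zeta> $ r"

definition increasing_pairs :: "(4 \<times> 4) set" where
  "increasing_pairs = {(1, 2), (1, 3), (1, 4), (2, 3), (2, 4), (3, 4)}"

text \<open>The structure functions of the coframe \<open>\<theta>\<close> are constant near a with values \<open>T i j k\<close>; only
  the entries with (j, k) in \<open>increasing_pairs\<close> are relevant.\<close>

definition constant_structure_functions ::
  "(complex^4 \<Rightarrow> complex^4^4) \<Rightarrow> complex^4 \<Rightarrow> (4 \<Rightarrow> 4 \<Rightarrow> 4 \<Rightarrow> complex) \<Rightarrow> bool" where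
  "constant_structure_functions \<theta> a T \<longleftrightarrow>
     (\<forall>\<^sub>F z in nhds a. \<forall>i r s.
        ext_deriv (\<lambda>w. \<theta> w $ i) z r s =
          (\<Sum>(j, k)\<in>increasing_pairs. T i j k * wedge (\<theta> z $ j) (\<theta> z $ k) r s))"

definition same_constant_structure ::
  "(complex^4 \<Rightarrow> complex^4^4) \<Rightarrow> complex^4 \<Rightarrow> (complex^4 \<Rightarrow> complex^4^4) \<Rightarrow> complex^4 \<Rightarrow> bool" where
  "same_constant_structure \<theta> a \<theta>' b \<longleftrightarrow>
     (\<exists>T. constant_structure_functions \<theta> a T \<and> constant_structure_functions \<theta>' b T)"


subsection \<open>Canonical forms\<close>

definition canonical_i :: "complex \<Rightarrow> complex^4 \<Rightarrow> complex" where
  "canonical_i \<alpha> z = \<alpha> * (z $ 4)\<^sup>2 / z $ 3"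

definition canonical_ii :: "complex^4 \<Rightarrow> complex" where
  "canonical_ii z = (z $ 4)\<^sup>2"

definition admissible :: "complex \<Rightarrow> bool" where
  "admissible \<alpha> \<longleftrightarrow> \<alpha> \<noteq> 0 \<and> \<alpha> \<noteq> 3/2 \<and> \<alpha> \<noteq> 3"

text \<open>
  The jets at which the coframe of a canonical form is defined. For form (i) one has
  \<open>I4 = (2\<alpha>^3 - 9\<alpha>^2 + 9\<alpha>) / 27 * (q/p)^3\<close>, and for form (ii) \<open>I4 = 2/27 * q^3\<close>, so the relative
  invariant I4 vanishes exactly on q = 0. The local equivalences with a canonical form are
  understood at these jets.
\<close>

definition generic_i :: "complex^4 \<Rightarrow> bool" where
  "generic_i b \<longleftrightarrow> b $ 3 \<noteq> 0 \<and> b $ 4 \<noteq> 0"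

definition generic_ii :: "complex^4 \<Rightarrow> bool" where
  "generic_ii b \<longleftrightarrow> b $ 4 \<noteq> 0"

end

theory Submission
  imports Defs "HOL-Complex_Analysis.Cauchy_Integral_Formula"
begin

text \<open>
  Let a point transformation carry \<open>u''' = f\<close> to \<open>u''' = g\<close>, and regard the new coordinates X, U and
  their derivatives P, Q as functions of the jet. Then \<open>D X = lam\<close>, \<open>D U = lam P\<close>, \<open>D P = lam Q\<close> and
  \<open>D Q = lam g\<close>, where D is the total derivative of f. Differentiating these equations in u, p, q and
  commuting with D yields the Jacobian of the prolonged map and the derivatives of f in terms of those
  of g (\<open>partial_P\<close>, \<open>partial_Q\<close>, \<open>f_derivatives\<close>). Besides lam there enter only the factor
  \<open>mu = U_u - P X_u\<close>, the logarithmic total derivatives of lam and mu with their own total derivatives, and \<open>X_u\<close>. It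
  follows that I4 has
  weight \<open>lam^3\<close>, that I5 has weight \<open>(mu / lam)^2\<close> when I6 vanishes, and that the remaining coefficients
  of the coframe transform in such a way that the coframe of f is the pullback of the coframe of g
  (\<open>invariant_coframe_pullback\<close>). The exterior derivative commutes with pullback, so equivalent equations
  have the same structure functions.

  For each of the two canonical forms the invariant coframe is a constant combination of an explicit
  frame with monomial coefficients that is invariant under the symmetries of the form. Hence
  its structure functions are constant, and the necessity of the conditions follows.

  For sufficiency, suppose that the coframe of f has the structure functions of a canonical form. The
  products of the rows of a coframe are linearly independent, so the same constant combination of the
  rows of the coframe of f satisfies the structure equations of the monomial frame
  (\<open>structure_equations_transfer\<close>). These are integrated by primitives of closed forms: some rows are
  closed, and the others become closed after adjustments by the primitives already found. This
  yields X, U and P, Q or their logarithms. Evaluating the rows on D shows that X and U depend on x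
  and u only, that P and Q are the prolongation, and that the new equation is the canonical form
  (\<open>integrate_form_i\<close>, \<open>integrate_form_ii\<close>).

  The ratio \<open>J4_q / J5\<close> is preserved by transformations and is constant for form (i). Because
  \<open>3 J4^2 J4_q = I4_q\<close>, its sixth power does not depend on the choice of the roots; it equals
  \<open>4 + 9 / (\<alpha>^2 - 3 \<alpha>)\<close> and thus determines \<open>\<alpha>\<close> up to the exchange of \<open>\<alpha>\<close> and \<open>3 - \<alpha>\<close>. These two
  values belong to equivalent equations, by exchange of x and u (\<open>form_i_swap\<close>).

  The point symmetries are found by comparing the coefficients of the powers of q and p in the
  determining equation, which leaves affine vector fields with four parameters.

  The underlying calculus of holomorphic functions of several variables rests on Cauchy's integral
  formula in one coordinate and differentiation under the integral sign: they show that partial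
  derivatives are holomorphic and commute.
\<close>

section \<open>Holomorphic functions of several complex variables\<close>

text \<open>The version of \<open>holomorphic_at\<close> on an open set; with the set kept explicit, derivatives can be
  differentiated again without shrinking neighbourhoods at every step.\<close>

definition holo_on :: "(complex^'n::finite \<Rightarrow> complex) \<Rightarrow> (complex^'n) set \<Rightarrow> bool" where
  "holo_on F S \<longleftrightarrow> open S \<and>
     (\<forall>z\<in>S. \<exists>L::complex^'n. (F has_derivative (\<lambda>h. \<Sum>i\<in>UNIV. L $ i * h $ i)) (at z))"

lemma holo_on_open: "holo_on F S \<Longrightarrow> open S"
  by (simp add: holo_on_def)

lemma holomorphic_at_iff: "holomorphic_at F a \<longleftrightarrow> (\<exists>S. a \<in> S \<and> holo_on F S)"
  unfolding holomorphic_at_def eventually_nhds holo_on_def by blast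

lemma holo_on_subset: "holo_on F S \<Longrightarrow> open T \<Longrightarrow> T \<subseteq> S \<Longrightarrow> holo_on F T"
  unfolding holo_on_def by blast

lemma norm_axis [simp]: "norm (axis i t :: complex^'n::finite) = norm t"
proof -
  have "(\<Sum>j\<in>UNIV. (norm ((axis i t :: complex^'n) $ j))\<^sup>2) = (\<Sum>j\<in>UNIV. if j = i then (norm t)\<^sup>2 else 0)"
    by (intro sum.cong) (auto simp: axis_def)
  then show ?thesis by (simp add: norm_vec_def L2_set_def)
qed

lemma bounded_linear_axis: "bounded_linear (axis i :: complex \<Rightarrow> complex^'n::finite)"
  by (rule bounded_linear_intro[where K=1]) (auto simp: vec_eq_iff axis_def norm_axis[unfolded axis_def])

lemma has_derivative_vec_lambda:
  fixes f :: "'n::finite \<Rightarrow> complex^'m::finite \<Rightarrow> complex"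
  assumes "\<And>i. (f i has_derivative f' i) (at z)"
  shows "((\<lambda>z. \<chi> i. f i z) has_derivative (\<lambda>h. \<chi> i. f' i h)) (at z)"
  unfolding has_derivative_def
proof
  have "linear (f' i)" for i
    using assms has_derivative_linear by blast
  then have "linear (\<lambda>h. \<chi> i. f' i h)"
    by (auto intro!: linearI simp: vec_eq_iff linear_add linear_scale)
  then show "bounded_linear (\<lambda>h. \<chi> i. f' i h)"
    by (simp add: linear_conv_bounded_linear)
  have "((\<lambda>y. ((f i y - f i (Lim (at z) (\<lambda>x. x))) - f' i (y - Lim (at z) (\<lambda>x. x))) /\<^sub>R
       norm (y - Lim (at z) (\<lambda>x. x))) \<longlongrightarrow> 0) (at z)" for i
    using assms unfolding has_derivative_def by auto
  then show "((\<lambda>y. (((\<chi> i. f i y) - (\<chi> i. f i (Lim (at z) (\<lambda>x. x)))) - (\<chi> i. f' i (y - Lim (at z) (\<lambda>x. x)))) /\<^sub>R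
       norm (y - Lim (at z) (\<lambda>x. x))) \<longlongrightarrow> 0) (at z)"
    by (intro vec_tendstoI) simp
qed

lemma has_derivative_line:
  fixes F :: "complex^'n::finite \<Rightarrow> complex"
  assumes "(F has_derivative (\<lambda>h. \<Sum>i\<in>UNIV. L $ i * h $ i)) (at (z + axis j s))"
  shows "((\<lambda>t. F (z + axis j t)) has_field_derivative L $ j) (at s)"
proof -
  have "((\<lambda>t. z + axis j t) has_derivative (\<lambda>t. axis j t)) (at s)"
    using has_derivative_add[OF has_derivative_const[of z] bounded_linear_imp_has_derivative[OF bounded_linear_axis]]
    by simp
  from has_derivative_compose[OF this assms]
  have "((\<lambda>t. F (z + axis j t)) has_derivative (\<lambda>h. \<Sum>i\<in>UNIV. L $ i * axis j h $ i)) (at s)"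
    by simp
  moreover have "(\<lambda>h. \<Sum>i\<in>UNIV. L $ i * axis j h $ i) = (*) (L $ j)"
    by (auto simp: axis_def if_distrib cong: if_cong)
  ultimately show ?thesis
    by (simp add: has_field_derivative_def)
qed

lemma partial_eqI:
  assumes "(F has_derivative (\<lambda>h. \<Sum>i\<in>UNIV. L i * h $ i)) (at z)"
  shows "partial j F z = L j"
proof -
  have "((\<lambda>t. F (z + axis j t)) has_field_derivative (\<chi> i. L i) $ j) (at 0)"
    by (rule has_derivative_line) (use assms in \<open>simp add: axis_def zero_vec_def[symmetric]\<close>)
  then show ?thesis
    unfolding partial_def by (simp add: DERIV_imp_deriv)
qed

lemma holo_has_derivative:
  assumes "holo_on F S" "z \<in> S"
  shows "(F has_derivative (\<lambda>h. \<Sum>i\<in>UNIV. partial i F z * h $ i)) (at z)"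
proof -
  obtain L where L: "(F has_derivative (\<lambda>h. \<Sum>i\<in>UNIV. L $ i * h $ i)) (at z)"
    using assms unfolding holo_on_def by blast
  have "partial i F z = L $ i" for i
    using partial_eqI[where L="\<lambda>i. L $ i"] L by blast
  with L show ?thesis by simp
qed

lemma holo_onI:
  assumes "open S" "\<And>z. z \<in> S \<Longrightarrow> (F has_derivative (\<lambda>h. \<Sum>i\<in>UNIV. L z i * h $ i)) (at z)"
  shows "holo_on F S"
  unfolding holo_on_def
proof (intro conjI ballI exI)
  fix z assume "z \<in> S"
  then show "(F has_derivative (\<lambda>h. \<Sum>i\<in>UNIV. (\<chi> i. L z i) $ i * h $ i)) (at z)"
    using assms by simp
qed (rule assms)

lemma holo_on_imp_continuous_on: "holo_on F S \<Longrightarrow> continuous_on S F"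
  by (meson continuous_at_imp_continuous_on has_derivative_continuous holo_has_derivative)

lemma partial_cong:
  assumes "open S" "\<And>w. w \<in> S \<Longrightarrow> F w = G w" "z \<in> S"
  shows "partial i F z = partial i G z"
proof -
  have "isCont (\<lambda>t::complex. z + axis i t) 0"
    by (intro continuous_intros linear_continuous_at bounded_linear_axis)
  then have "((\<lambda>t::complex. z + axis i t) \<longlongrightarrow> z + axis i 0) (nhds 0)"
    using tendsto_at_iff_tendsto_nhds[of "\<lambda>t. z + axis i t" 0] unfolding isCont_def by blast
  then have "((\<lambda>t::complex. z + axis i t) \<longlongrightarrow> z) (nhds 0)"
    by (simp add: axis_def zero_vec_def[symmetric])
  then have "\<forall>\<^sub>F t in nhds (0::complex). z + axis i t \<in> S"
    using assms(1,3) topological_tendstoD by blast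
  then have "\<forall>\<^sub>F t in nhds (0::complex). F (z + axis i t) = G (z + axis i t)"
    by eventually_elim (rule assms(2))
  then show ?thesis unfolding partial_def by (intro deriv_cong_ev) auto
qed

lemma holo_on_cong:
  assumes "holo_on F S" "\<And>w. w \<in> S \<Longrightarrow> F w = G w"
  shows "holo_on G S"
proof (rule holo_onI[OF holo_on_open[OF assms(1)]])
  fix z assume "z \<in> S"
  with assms show "(G has_derivative (\<lambda>h. \<Sum>i\<in>UNIV. partial i F z * h $ i)) (at z)"
    by (intro has_derivative_transform_within_open[OF holo_has_derivative holo_on_open])
qed

subsection \<open>Rules of differentiation\<close>

named_theorems holo_intros

lemma partial_const [simp]: "partial i (\<lambda>z. c) z = 0"
  by (simp add: partial_def)

lemma holo_const [holo_intros]: "open S \<Longrightarrow> holo_on (\<lambda>z. c) S"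
  by (rule holo_onI[where L="\<lambda>_ _. 0"]) auto

lemma has_derivative_nth:
  "((\<lambda>z::complex^'n::finite. z $ j) has_derivative (\<lambda>h. \<Sum>i\<in>UNIV. (if i = j then 1 else 0) * h $ i)) (at z)"
  using bounded_linear_imp_has_derivative[OF bounded_linear_vec_nth]
  by (simp add: if_distrib[of "\<lambda>x. x * _"] cong: if_cong)

lemma partial_nth [simp]: "partial i (\<lambda>z. z $ j) z = (if i = j then 1 else 0)"
  by (rule partial_eqI[OF has_derivative_nth])

lemma holo_nth [holo_intros]: "open S \<Longrightarrow> holo_on (\<lambda>z. z $ j) S"
  by (rule holo_onI[OF _ has_derivative_nth])

context
  fixes F G :: "complex^'n::finite \<Rightarrow> complex" and S
  assumes F: "holo_on F S" and G: "holo_on G S"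
begin

lemma has_derivative_add':
  "z \<in> S \<Longrightarrow> ((\<lambda>z. F z + G z) has_derivative
     (\<lambda>h. \<Sum>i\<in>UNIV. (partial i F z + partial i G z) * h $ i)) (at z)"
  using has_derivative_add[OF holo_has_derivative[OF F] holo_has_derivative[OF G]]
  by (simp add: sum.distrib algebra_simps)

lemma has_derivative_diff':
  "z \<in> S \<Longrightarrow> ((\<lambda>z. F z - G z) has_derivative
     (\<lambda>h. \<Sum>i\<in>UNIV. (partial i F z - partial i G z) * h $ i)) (at z)"
  using has_derivative_diff[OF holo_has_derivative[OF F] holo_has_derivative[OF G]]
  by (simp add: sum_subtractf algebra_simps)

lemma has_derivative_mult':
  "z \<in> S \<Longrightarrow> ((\<lambda>z. F z * G z) has_derivative
     (\<lambda>h. \<Sum>i\<in>UNIV. (partial i F z * G z + F z * partial i G z) * h $ i)) (at z)"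
  using has_derivative_mult[OF holo_has_derivative[OF F] holo_has_derivative[OF G]]
  by (simp add: sum.distrib algebra_simps sum_distrib_left)

lemma partial_add: "z \<in> S \<Longrightarrow> partial i (\<lambda>z. F z + G z) z = partial i F z + partial i G z"
  by (rule partial_eqI[OF has_derivative_add'])

lemma partial_diff: "z \<in> S \<Longrightarrow> partial i (\<lambda>z. F z - G z) z = partial i F z - partial i G z"
  by (rule partial_eqI[OF has_derivative_diff'])

lemma partial_mult:
  "z \<in> S \<Longrightarrow> partial i (\<lambda>z. F z * G z) z = partial i F z * G z + F z * partial i G z"
  by (rule partial_eqI[OF has_derivative_mult'])

lemma holo_add [holo_intros]: "holo_on (\<lambda>z. F z + G z) S"
  by (rule holo_onI[OF holo_on_open[OF F] has_derivative_add'])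

lemma holo_diff [holo_intros]: "holo_on (\<lambda>z. F z - G z) S"
  by (rule holo_onI[OF holo_on_open[OF F] has_derivative_diff'])

lemma holo_mult [holo_intros]: "holo_on (\<lambda>z. F z * G z) S"
  by (rule holo_onI[OF holo_on_open[OF F] has_derivative_mult'])

end

lemma has_derivative_outer:
  assumes "holo_on F S" "z \<in> S" "(g has_field_derivative g') (at (F z))"
  shows "((\<lambda>z. g (F z)) has_derivative (\<lambda>h. \<Sum>i\<in>UNIV. (g' * partial i F z) * h $ i)) (at z)"
  using has_derivative_compose[OF holo_has_derivative[OF assms(1,2)]
      assms(3)[unfolded has_field_derivative_def]]
  by (simp add: sum_distrib_left algebra_simps)

lemma partial_outer:
  assumes "holo_on F S" "z \<in> S" "(g has_field_derivative g') (at (F z))"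
  shows "partial i (\<lambda>z. g (F z)) z = g' * partial i F z"
  by (rule partial_eqI[OF has_derivative_outer[OF assms]])

lemma holo_outer:
  assumes "holo_on F S" "\<And>z. z \<in> S \<Longrightarrow> (g has_field_derivative g' z) (at (F z))"
  shows "holo_on (\<lambda>z. g (F z)) S"
  by (rule holo_onI[OF holo_on_open[OF assms(1)] has_derivative_outer[OF assms(1)]])
     (use assms in auto)

lemma partial_minus: "holo_on F S \<Longrightarrow> z \<in> S \<Longrightarrow> partial i (\<lambda>z. - F z) z = - partial i F z"
  using partial_outer[where g="\<lambda>x. -x" and g'="-1" and F=F] by (simp add: DERIV_minus DERIV_ident)

lemma holo_minus [holo_intros]: "holo_on F S \<Longrightarrow> holo_on (\<lambda>z. - F z) S"
  by (rule holo_outer[where g="\<lambda>x. -x" and g'="\<lambda>_. -1"]) (auto simp: DERIV_minus DERIV_ident)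

lemma partial_power:
  "holo_on F S \<Longrightarrow> z \<in> S \<Longrightarrow> partial i (\<lambda>z. F z ^ n) z = of_nat n * F z ^ (n - 1) * partial i F z"
  by (rule partial_outer[where g="\<lambda>x. x ^ n"]) (auto intro!: derivative_eq_intros)

lemma holo_power [holo_intros]: "holo_on F S \<Longrightarrow> holo_on (\<lambda>z. F z ^ n) S"
  by (rule holo_outer[where g="\<lambda>x. x ^ n"]) (auto intro!: derivative_eq_intros)

lemma partial_exp:
  "holo_on F S \<Longrightarrow> z \<in> S \<Longrightarrow> partial i (\<lambda>z. exp (F z)) z = exp (F z) * partial i F z"
  by (rule partial_outer[where g=exp]) (auto intro!: derivative_eq_intros)

lemma holo_exp [holo_intros]: "holo_on F S \<Longrightarrow> holo_on (\<lambda>z. exp (F z)) S"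
  by (rule holo_outer[where g=exp]) (auto intro!: derivative_eq_intros)

lemma holo_inverse:
  "holo_on G S \<Longrightarrow> (\<And>z. z \<in> S \<Longrightarrow> G z \<noteq> 0) \<Longrightarrow> holo_on (\<lambda>z. inverse (G z)) S"
  by (rule holo_outer[where g=inverse]) (auto intro!: DERIV_inverse)

lemma holo_divide [holo_intros]:
  assumes "holo_on F S" "holo_on G S" "\<And>z. z \<in> S \<Longrightarrow> G z \<noteq> 0"
  shows "holo_on (\<lambda>z. F z / G z) S"
  unfolding divide_inverse using assms by (intro holo_mult holo_inverse)

lemma partial_divide:
  assumes "holo_on F S" "holo_on G S" "\<And>z. z \<in> S \<Longrightarrow> G z \<noteq> 0" "z \<in> S"
  shows "partial i (\<lambda>z. F z / G z) z = (partial i F z * G z - F z * partial i G z) / (G z)\<^sup>2"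
proof -
  have "partial i (\<lambda>z. inverse (G z)) z = - (inverse (G z) ^ Suc (Suc 0)) * partial i G z"
    by (rule partial_outer[where g=inverse, OF assms(2,4) DERIV_inverse[OF assms(3)[OF assms(4)]]])
  then show ?thesis
    unfolding divide_inverse
    by (subst partial_mult[OF assms(1) holo_inverse[OF assms(2,3)] assms(4)])
       (use assms in \<open>auto simp: field_simps power2_eq_square\<close>)
qed

lemma has_derivative_chain:
  fixes \<phi> :: "'m::finite \<Rightarrow> complex^'n::finite \<Rightarrow> complex" and G :: "complex^'m \<Rightarrow> complex"
  assumes \<phi>: "\<And>j. holo_on (\<phi> j) S" and G: "holo_on G T" and z: "z \<in> S" and T: "(\<chi> j. \<phi> j z) \<in> T"
  shows "((\<lambda>z. G (\<chi> j. \<phi> j z)) has_derivative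
    (\<lambda>h. \<Sum>i\<in>UNIV. (\<Sum>j\<in>UNIV. partial j G (\<chi> j. \<phi> j z) * partial i (\<phi> j) z) * h $ i)) (at z)"
proof -
  have "((\<lambda>z. \<chi> j. \<phi> j z) has_derivative (\<lambda>h. \<chi> j. \<Sum>i\<in>UNIV. partial i (\<phi> j) z * h $ i)) (at z)"
    using holo_has_derivative[OF \<phi> z] by (intro has_derivative_vec_lambda) auto
  from has_derivative_compose[OF this holo_has_derivative[OF G T]]
  have "((\<lambda>z. G (\<chi> j. \<phi> j z)) has_derivative
    (\<lambda>h. \<Sum>j\<in>UNIV. partial j G (\<chi> j. \<phi> j z) * (\<Sum>i\<in>UNIV. partial i (\<phi> j) z * h $ i))) (at z)"
    by simp
  moreover have "(\<Sum>j\<in>UNIV. partial j G (\<chi> j. \<phi> j z) * (\<Sum>i\<in>UNIV. partial i (\<phi> j) z * h $ i)) =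
     (\<Sum>i\<in>UNIV. (\<Sum>j\<in>UNIV. partial j G (\<chi> j. \<phi> j z) * partial i (\<phi> j) z) * h $ i)" for h :: "complex^'n"
    by (simp add: sum_distrib_left sum_distrib_right mult.assoc) (rule sum.swap)
  ultimately show ?thesis by simp
qed

lemma partial_chain:
  fixes \<phi> :: "'m::finite \<Rightarrow> complex^'n::finite \<Rightarrow> complex" and G :: "complex^'m \<Rightarrow> complex"
  assumes "\<And>j. holo_on (\<phi> j) S" "holo_on G T" "z \<in> S" "(\<chi> j. \<phi> j z) \<in> T"
  shows "partial i (\<lambda>z. G (\<chi> j. \<phi> j z)) z =
    (\<Sum>j\<in>UNIV. partial j G (\<chi> j. \<phi> j z) * partial i (\<phi> j) z)"
  by (rule partial_eqI[OF has_derivative_chain[OF assms]])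

lemma holo_chain:
  fixes \<phi> :: "'m::finite \<Rightarrow> complex^'n::finite \<Rightarrow> complex" and G :: "complex^'m \<Rightarrow> complex"
  assumes "\<And>j. holo_on (\<phi> j) S" "holo_on G T" "\<And>z. z \<in> S \<Longrightarrow> (\<chi> j. \<phi> j z) \<in> T"
  shows "holo_on (\<lambda>z. G (\<chi> j. \<phi> j z)) S"
  by (rule holo_onI[OF holo_on_open[OF assms(1)] has_derivative_chain[OF assms(1,2)]])
     (use assms in auto)

subsection \<open>Partial derivatives are holomorphic\<close>

text \<open>Differentiation under the integral sign, in the form needed both for Cauchy's formula along
  a circle and for primitives along segments.\<close>

lemma has_derivative_integral:
  fixes F :: "complex^'n::finite \<Rightarrow> real \<Rightarrow> complex"
  assumes U: "open U" "convex U" "z \<in> U"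
    and d: "\<And>w t. w \<in> U \<Longrightarrow> t \<in> {0..1} \<Longrightarrow>
      ((\<lambda>w. F w t) has_derivative (\<lambda>h. \<Sum>i\<in>UNIV. G i w t * h $ i)) (at w)"
    and cG: "\<And>i. continuous_on (U \<times> {0..1}) (\<lambda>(w, t). G i w t)"
    and cF: "\<And>w. w \<in> U \<Longrightarrow> continuous_on {0..1} (F w)"
  shows "((\<lambda>w. integral {0..1} (F w)) has_derivative
    (\<lambda>h. \<Sum>i\<in>UNIV. integral {0..1} (G i z) * h $ i)) (at z)"
proof -
  define proj :: "'n \<Rightarrow> (complex^'n) \<Rightarrow>\<^sub>L complex" where "proj i = Blinfun (\<lambda>h. h $ i)" for i
  have proj: "blinfun_apply (proj i) h = h $ i" for i h
    unfolding proj_def by (simp add: bounded_linear_Blinfun_apply bounded_linear_vec_nth)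
  define fx where "fx w t = (\<Sum>i\<in>UNIV. blinfun_mult_right (G i w t) o\<^sub>L proj i)" for w t
  have fx: "blinfun_apply (fx w t) h = (\<Sum>i\<in>UNIV. G i w t * h $ i)" for w t h
    unfolding fx_def by (simp add: blinfun.sum_left proj)
  have cfx: "continuous_on (U \<times> cbox 0 1) (\<lambda>(w, t). fx w t)"
    unfolding fx_def split_beta
    by (intro continuous_intros bounded_linear.continuous_on[OF bounded_linear_blinfun_mult_right])
       (use cG in \<open>auto simp: split_beta cbox_interval\<close>)
  have *: "((\<lambda>w. integral (cbox 0 1) (F w)) has_derivative integral (cbox 0 1) (fx z)) (at z within U)"
  proof (rule leibniz_rule[OF _ _ cfx U(3,2)])
    fix w t assume "w \<in> U" "t \<in> cbox (0::real) 1"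
    then show "((\<lambda>w. F w t) has_derivative blinfun_apply (fx w t)) (at w within U)"
      using d[of w t] by (auto simp: fx[abs_def] cbox_interval intro: has_derivative_at_withinI)
  qed (use cF in \<open>auto intro!: integrable_continuous_real simp: cbox_interval\<close>)
  have Pair_z: "continuous_on {0..1::real} (\<lambda>t. (z, t))"
    by (intro continuous_intros)
  have cGz: "continuous_on {0..1} (G i z)" for i
    using continuous_on_compose2[OF cG[of i] Pair_z] U by auto
  have cfz: "continuous_on {0..1} (fx z)"
    using continuous_on_compose2[OF cfx Pair_z] U by (auto simp: cbox_interval)
  have "blinfun_apply (integral (cbox 0 1) (fx z)) h = (\<Sum>i\<in>UNIV. integral {0..1} (G i z) * h $ i)" for h
  proof -
    have "blinfun_apply (integral {0..1} (fx z)) h = integral {0..1} (\<lambda>t. blinfun_apply (fx z t) h)"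
      by (intro blinfun_apply_integral integrable_continuous_real cfz)
    also have "\<dots> = (\<Sum>i\<in>UNIV. integral {0..1} (\<lambda>t. G i z t * h $ i))"
      unfolding fx by (intro integral_sum integrable_continuous_real continuous_intros cGz) auto
    finally show ?thesis by (simp add: cbox_interval)
  qed
  then have "blinfun_apply (integral (cbox 0 1) (fx z)) = (\<lambda>h. \<Sum>i\<in>UNIV. integral {0..1} (G i z) * h $ i)"
    by blast
  then show ?thesis
    using * by (simp add: at_within_open[OF U(3,1)] cbox_interval)
qed

text \<open>Cauchy's formula on the circle of radius r in the direction of the i-th axis, written as an
  integral over the unit interval.\<close>

definition circle_point :: "real \<Rightarrow> real \<Rightarrow> complex" where
  "circle_point r t = of_real r * exp (2 * of_real pi * \<i> * of_real t)"

lemma norm_circle_point: "0 \<le> r \<Longrightarrow> norm (circle_point r t) = r"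
  by (simp add: circle_point_def norm_mult norm_exp_eq_Re)

lemma continuous_circle_point [continuous_intros]:
  "continuous_on A f \<Longrightarrow> continuous_on A (\<lambda>x. circle_point r (f x))"
  unfolding circle_point_def by (intro continuous_intros)

lemma continuous_axis [continuous_intros]:
  "continuous_on A f \<Longrightarrow> continuous_on A (\<lambda>x. axis i (f x) :: complex^'n::finite)"
  by (rule bounded_linear.continuous_on[OF bounded_linear_axis])

text \<open>The circle is parametrized by a fixed interval and does not move with z, so the right-hand side
  can be differentiated in z under the integral sign.\<close>

lemma partial_Cauchy:
  fixes F :: "complex^'n::finite \<Rightarrow> complex"
  assumes F: "holo_on F S" and r: "0 < r" and S: "\<And>t. norm t \<le> r \<Longrightarrow> z + axis i t \<in> S"
  shows "partial i F z = integral {0..1} (\<lambda>t. F (z + axis i (circle_point r t)) / circle_point r t)"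
proof -
  define g where "g t = F (z + axis i t)" for t
  have der: "(g has_field_derivative partial i F (z + axis i t)) (at t)" if "norm t \<le> r" for t
    unfolding g_def
    using has_derivative_line[of F "\<chi> j. partial j F (z + axis i t)" z i t]
      holo_has_derivative[OF F S[OF that]] by simp
  have "continuous_on (cball 0 r) g"
    using der by (intro continuous_at_imp_continuous_on ballI DERIV_isCont) (auto simp: dist_norm)
  moreover have "g holomorphic_on ball 0 r"
    unfolding holomorphic_on_open[OF open_ball]
    by (intro ballI exI, rule der) (auto simp: dist_norm)
  ultimately have "(g has_field_derivative
      (1 / (2 * of_real pi * \<i>) * contour_integral (circlepath 0 r) (\<lambda>u. g u / (u - 0)\<^sup>2))) (at 0)"
    by (rule Cauchy_derivative_integral_circlepath(2)) (use r in auto)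
  then have "partial i F z = 1 / (2 * of_real pi * \<i>) * contour_integral (circlepath 0 r) (\<lambda>u. g u / u\<^sup>2)"
    unfolding partial_def g_def by (simp add: DERIV_imp_deriv)
  also have "\<dots> = integral {0..1} (\<lambda>t. 1 / (2 * of_real pi * \<i>) *
      (g (circlepath 0 r t) / (circlepath 0 r t)\<^sup>2 * vector_derivative (circlepath 0 r) (at t)))"
    by (simp only: contour_integral_integral integral_mult_right)
  also have "\<dots> = integral {0..1} (\<lambda>t. F (z + axis i (circle_point r t)) / circle_point r t)"
  proof (rule integral_cong)
    fix t :: real
    have "vector_derivative (circlepath 0 r) (at t) = 2 * of_real pi * \<i> * circle_point r t"
      by (simp only: vector_derivative_circlepath circle_point_def) simp
    moreover have "circlepath 0 r t = circle_point r t"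
      by (simp add: circlepath circle_point_def)
    moreover have "circle_point r t \<noteq> 0"
      using r by (auto simp: circle_point_def)
    ultimately show "1 / (2 * of_real pi * \<i>) *
        (g (circlepath 0 r t) / (circlepath 0 r t)\<^sup>2 * vector_derivative (circlepath 0 r) (at t)) =
        F (z + axis i (circle_point r t)) / circle_point r t"
      by (simp add: g_def power2_eq_square)
  qed
  finally show ?thesis .
qed

lemma axis_disc_in_open:
  fixes S :: "(complex^'n::finite) set"
  assumes "open S" "a \<in> S"
  obtains r where "r > 0" "\<And>w t. w \<in> ball a r \<Longrightarrow> norm t \<le> r \<Longrightarrow> w + axis i t \<in> S"
proof -
  obtain e where e: "e > 0" "cball a e \<subseteq> S"
    using assms open_contains_cball by blast
  have "w + axis i t \<in> S" if "w \<in> ball a (e / 2)" "norm t \<le> e / 2" for w t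
  proof -
    have "dist a (w + axis i t) \<le> dist a w + norm (axis i t :: complex^'n)"
      by (metis dist_norm dist_triangle2 add_diff_cancel_left' dist_commute)
    then show ?thesis using e that by auto
  qed
  with e show thesis using that[of "e / 2"] by simp
qed

lemma continuous_on_partial:
  fixes F :: "complex^'n::finite \<Rightarrow> complex"
  assumes F: "holo_on F S"
  shows "continuous_on S (partial i F)"
proof (rule continuous_at_imp_continuous_on, rule ballI)
  fix a assume "a \<in> S"
  then obtain r where r: "r > 0" and in_S: "\<And>w t. w \<in> ball a r \<Longrightarrow> norm t \<le> r \<Longrightarrow> w + axis i t \<in> S"
    using axis_disc_in_open[OF holo_on_open[OF F]] by metis
  have "continuous_on (ball a r) (\<lambda>w. integral (cbox 0 1)
      (\<lambda>t. F (w + axis i (circle_point r t)) / circle_point r t))"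
    unfolding cbox_interval[symmetric]
  proof (rule integral_continuous_on_param)
    have nz: "circle_point r t \<noteq> 0" for t
      using r by (auto simp: circle_point_def)
    show "continuous_on (ball a r \<times> cbox 0 1)
        (\<lambda>(w, t). F (w + axis i (circle_point r t)) / circle_point r t)"
      unfolding split_beta
      by (intro continuous_intros continuous_on_compose2[OF holo_on_imp_continuous_on[OF F]])
         (use r nz in \<open>auto simp: norm_circle_point in_S\<close>)
  qed
  then have "continuous_on (ball a r) (partial i F)"
    by (rule continuous_on_eq) (use partial_Cauchy[OF F r in_S] in \<open>auto simp: cbox_interval\<close>)
  then show "isCont (partial i F) a"
    using r by (simp add: continuous_on_eq_continuous_at)
qed

text \<open>The derivatives of Cauchy's integral are the Cauchy integrals of the partial derivatives of F. So
  the partial derivatives are holomorphic again, and mixed partial derivatives commute.\<close>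

lemma has_derivative_partial:
  fixes F :: "complex^'n::finite \<Rightarrow> complex"
  assumes F: "holo_on F S" and a: "a \<in> S"
  obtains r where "r > 0" "\<And>t. norm t \<le> r \<Longrightarrow> a + axis i t \<in> S"
    "(partial i F has_derivative (\<lambda>h. \<Sum>j\<in>UNIV. integral {0..1}
        (\<lambda>t. partial j F (a + axis i (circle_point r t)) / circle_point r t) * h $ j)) (at a)"
proof -
  obtain r where r: "r > 0" and in_S: "\<And>w t. w \<in> ball a r \<Longrightarrow> norm t \<le> r \<Longrightarrow> w + axis i t \<in> S"
    using axis_disc_in_open[OF holo_on_open[OF F] a] by metis
  have nz: "circle_point r t \<noteq> 0" for t
    using r by (auto simp: circle_point_def)
  have int: "((\<lambda>w. integral {0..1} (\<lambda>t. F (w + axis i (circle_point r t)) / circle_point r t))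
      has_derivative (\<lambda>h. \<Sum>j\<in>UNIV. integral {0..1}
        (\<lambda>t. partial j F (a + axis i (circle_point r t)) / circle_point r t) * h $ j)) (at a)"
  proof (rule has_derivative_integral[where U="ball a r"])
    fix w t assume w: "w \<in> ball a r" and t: "t \<in> {0..1::real}"
    have "((\<lambda>w. F (w + axis i (circle_point r t))) has_derivative
        (\<lambda>h. \<Sum>j\<in>UNIV. partial j F (w + axis i (circle_point r t)) * h $ j)) (at w)"
      using has_derivative_compose[of "\<lambda>w. w + axis i (circle_point r t)" "\<lambda>h. h" w UNIV F,
          OF has_derivative_add[OF has_derivative_ident has_derivative_const, simplified]
             holo_has_derivative[OF F in_S[OF w]]] r
      by (auto simp: norm_circle_point)
    from has_derivative_mult_left[OF this, of "1 / circle_point r t"]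
    show "((\<lambda>w. F (w + axis i (circle_point r t)) / circle_point r t) has_derivative
        (\<lambda>h. \<Sum>j\<in>UNIV. partial j F (w + axis i (circle_point r t)) / circle_point r t * h $ j)) (at w)"
      by (simp add: sum_distrib_right sum_divide_distrib)
  next
    fix j
    show "continuous_on (ball a r \<times> {0..1})
        (\<lambda>(w, t). partial j F (w + axis i (circle_point r t)) / circle_point r t)"
      unfolding split_beta
      by (intro continuous_intros continuous_on_compose2[OF continuous_on_partial[OF F]])
         (use r nz in \<open>auto simp: norm_circle_point in_S\<close>)
  next
    fix w assume w: "w \<in> ball a r"
    show "continuous_on {0..1} (\<lambda>t. F (w + axis i (circle_point r t)) / circle_point r t)"
      by (intro continuous_intros continuous_on_compose2[OF holo_on_imp_continuous_on[OF F]])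
         (use r nz w in \<open>auto simp: norm_circle_point in_S\<close>)
  qed (use r in auto)
  have lim: "(partial i F has_derivative (\<lambda>h. \<Sum>j\<in>UNIV. integral {0..1}
        (\<lambda>t. partial j F (a + axis i (circle_point r t)) / circle_point r t) * h $ j)) (at a)"
    by (rule has_derivative_transform_within_open[OF int open_ball[of a r]])
       (use r partial_Cauchy[OF F r in_S] in auto)
  show thesis
    by (rule that[OF r _ lim]) (use r in_S in auto)
qed

lemma holo_partial [holo_intros]: "holo_on F S \<Longrightarrow> holo_on (partial i F) S"
  unfolding holo_on_def[of "partial i F"]
proof (intro conjI ballI)
  fix a assume F: "holo_on F S" and "a \<in> S"
  then obtain r where "(partial i F has_derivative (\<lambda>h. \<Sum>j\<in>UNIV. integral {0..1}
        (\<lambda>t. partial j F (a + axis i (circle_point r t)) / circle_point r t) * h $ j)) (at a)"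
    using has_derivative_partial by blast
  then show "\<exists>L::complex^'a. (partial i F has_derivative (\<lambda>h. \<Sum>j\<in>UNIV. L $ j * h $ j)) (at a)"
    by (intro exI[of _ "\<chi> j. integral {0..1}
        (\<lambda>t. partial j F (a + axis i (circle_point r t)) / circle_point r t)"]) simp
qed (rule holo_on_open)

lemma partial_commute:
  assumes F: "holo_on F S" and a: "a \<in> S"
  shows "partial j (partial i F) a = partial i (partial j F) a"
proof -
  obtain r where r: "r > 0" "\<And>t. norm t \<le> r \<Longrightarrow> a + axis i t \<in> S"
    "(partial i F has_derivative (\<lambda>h. \<Sum>j\<in>UNIV. integral {0..1}
        (\<lambda>t. partial j F (a + axis i (circle_point r t)) / circle_point r t) * h $ j)) (at a)"
    using has_derivative_partial[OF F a] by blast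
  show ?thesis
    unfolding partial_eqI[OF r(3)] using partial_Cauchy[OF holo_partial[OF F] r(1,2)] by simp
qed

subsection \<open>Primitives of closed one-forms\<close>

text \<open>The Poincare lemma: on a ball the integrals of a closed form over the segments from the centre
  are a primitive.\<close>

lemma closed_form_has_primitive:
  fixes \<eta> :: "complex^'n::finite \<Rightarrow> complex^'n"
  assumes hol: "\<And>i. holo_on (\<lambda>z. \<eta> z $ i) (ball a r)"
    and closed: "\<And>z i j. z \<in> ball a r \<Longrightarrow> partial i (\<lambda>z. \<eta> z $ j) z = partial j (\<lambda>z. \<eta> z $ i) z"
  obtains F where "holo_on F (ball a r)" "\<And>z i. z \<in> ball a r \<Longrightarrow> partial i F z = \<eta> z $ i"
proof -
  define c where "c t z = a + t *\<^sub>R (z - a)" for t :: real and z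
  define F where "F z = integral {0..1} (\<lambda>t. \<Sum>i\<in>UNIV. \<eta> (c t z) $ i * (z $ i - a $ i))" for z
  have c: "c t z \<in> ball a r" if "z \<in> ball a r" "t \<in> {0..1}" for t z
  proof -
    have "dist a (c t z) = \<bar>t\<bar> * dist a z"
      by (simp add: c_def dist_norm norm_minus_commute)
    also have "\<dots> \<le> 1 * dist a z"
      using that by (intro mult_right_mono) auto
    finally show ?thesis using that by simp
  qed
  define d where "d i z t = (\<Sum>j\<in>UNIV. partial i (\<lambda>z. \<eta> z $ j) (c t z) * of_real t * (z $ j - a $ j)) + \<eta> (c t z) $ i" for i z t
  have der: "(F has_derivative (\<lambda>h. \<Sum>i\<in>UNIV. integral {0..1} (d i z) * h $ i)) (at z)"
    if z: "z \<in> ball a r" for z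
    unfolding F_def
  proof (rule has_derivative_integral[where U="ball a r"])
    fix w t assume w: "w \<in> ball a r" and t: "t \<in> {0..1::real}"
    have "((\<lambda>w. \<eta> (c t w) $ j) has_derivative
        (\<lambda>h. \<Sum>i\<in>UNIV. partial i (\<lambda>z. \<eta> z $ j) (c t w) * (t *\<^sub>R h) $ i)) (at w)" for j
      by (rule has_derivative_compose[of "c t" _ w UNIV "\<lambda>z. \<eta> z $ j",
            OF _ holo_has_derivative[OF hol c[OF w t]]])
         (auto simp: c_def[abs_def] intro!: derivative_eq_intros)
    moreover have "((\<lambda>w. w $ j - a $ j) has_derivative (\<lambda>h. h $ j)) (at w)" for j
      using bounded_linear_imp_has_derivative[OF bounded_linear_vec_nth]
      by (auto intro!: derivative_eq_intros)
    ultimately have "((\<lambda>w. \<Sum>j\<in>UNIV. \<eta> (c t w) $ j * (w $ j - a $ j)) has_derivative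
       (\<lambda>h. \<Sum>j\<in>UNIV. \<eta> (c t w) $ j * h $ j +
          (\<Sum>i\<in>UNIV. partial i (\<lambda>z. \<eta> z $ j) (c t w) * (t *\<^sub>R h) $ i) * (w $ j - a $ j))) (at w)"
      by (intro has_derivative_sum has_derivative_mult) auto
    moreover have "(\<Sum>j\<in>UNIV. \<eta> (c t w) $ j * h $ j +
          (\<Sum>i\<in>UNIV. partial i (\<lambda>z. \<eta> z $ j) (c t w) * (t *\<^sub>R h) $ i) * (w $ j - a $ j)) =
       (\<Sum>i\<in>UNIV. d i w t * h $ i)" for h
    proof -
      have "(\<Sum>j\<in>UNIV. (\<Sum>i\<in>UNIV. partial i (\<lambda>z. \<eta> z $ j) (c t w) * (t *\<^sub>R h) $ i) * (w $ j - a $ j))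
        = (\<Sum>i\<in>UNIV. (\<Sum>j\<in>UNIV. partial i (\<lambda>z. \<eta> z $ j) (c t w) * of_real t * (w $ j - a $ j)) * h $ i)"
        unfolding sum_distrib_right
        by (subst sum.swap) (simp add: scaleR_conv_of_real[symmetric] mult_ac scaleR_left_distrib)
      then show ?thesis
        by (simp add: d_def sum.distrib distrib_right)
    qed
    ultimately show "((\<lambda>w. \<Sum>j\<in>UNIV. \<eta> (c t w) $ j * (w $ j - a $ j)) has_derivative
       (\<lambda>h. \<Sum>i\<in>UNIV. d i w t * h $ i)) (at w)" by simp
  next
    have cc: "continuous_on A (\<lambda>x. c (f x) (g x))" if "continuous_on A f" "continuous_on A g"
      for A :: "('b::topological_space) set" and f g
      unfolding c_def by (intro continuous_intros that)
    fix i
    have "continuous_on (ball a r \<times> {0..1}) (\<lambda>p. \<eta> (c (snd p) (fst p)) $ j)" for j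
      by (rule continuous_on_compose2[OF holo_on_imp_continuous_on[OF hol] cc])
         (use c in \<open>auto intro!: continuous_intros simp del: mem_ball\<close>)
    moreover have "continuous_on (ball a r \<times> {0..1}) (\<lambda>p. partial i (\<lambda>z. \<eta> z $ j) (c (snd p) (fst p)))" for j
      by (rule continuous_on_compose2[OF continuous_on_partial[OF hol] cc])
         (use c in \<open>auto intro!: continuous_intros simp del: mem_ball\<close>)
    moreover have "continuous_on (ball a r \<times> {0..1}) (\<lambda>p. fst p $ j - a $ j)" for j
      by (intro continuous_intros)
    moreover have "continuous_on (ball a r \<times> {0..1}) (\<lambda>p. of_real (snd p) :: complex)"
      by (intro continuous_intros)
    ultimately show "continuous_on (ball a r \<times> {0..1}) (\<lambda>(w, t). d i w t)"
      unfolding d_def split_beta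
      by (intro continuous_on_add continuous_on_sum continuous_on_mult)
    fix w assume w: "w \<in> ball a r"
    have "continuous_on {0..1} (\<lambda>t. \<eta> (c t w) $ i)" for i
      by (rule continuous_on_compose2[OF holo_on_imp_continuous_on[OF hol] cc])
         (use c w in \<open>auto intro!: continuous_intros simp del: mem_ball\<close>)
    then show "continuous_on {0..1} (\<lambda>t. \<Sum>i\<in>UNIV. \<eta> (c t w) $ i * (w $ i - a $ i))"
      by (intro continuous_on_sum continuous_on_mult continuous_on_const)
  qed (use z in auto)
  have int: "integral {0..1} (d i z) = \<eta> z $ i" if z: "z \<in> ball a r" for z i
  proof -
    \<comment> \<open>Closedness turns the integrand into the derivative of \<open>t * \<eta> (c t z)\<close> along the segment.\<close>
    have "((\<lambda>t. t *\<^sub>R \<eta> (c t z) $ i) has_vector_derivative d i z t) (at t within {0..1})"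
      if t: "t \<in> {0..1}" for t
    proof -
      have "(c s z) = a + s *\<^sub>R (z - a)" for s by (simp add: c_def)
      then have "((\<lambda>t. c t z) has_derivative (\<lambda>s. s *\<^sub>R (z - a))) (at t)"
        by (auto intro!: derivative_eq_intros)
      from has_derivative_compose[OF this holo_has_derivative[OF hol c[OF z t]]]
      have "((\<lambda>t. \<eta> (c t z) $ i) has_derivative
          (\<lambda>s. \<Sum>j\<in>UNIV. partial j (\<lambda>z. \<eta> z $ i) (c t z) * (s *\<^sub>R (z - a)) $ j)) (at t)" .
      also have "(\<lambda>s. \<Sum>j\<in>UNIV. partial j (\<lambda>z. \<eta> z $ i) (c t z) * (s *\<^sub>R (z - a)) $ j) =
         (\<lambda>s. s *\<^sub>R (\<Sum>j\<in>UNIV. partial i (\<lambda>z. \<eta> z $ j) (c t z) * (z $ j - a $ j)))"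
        using closed[OF c[OF z t]] by (simp add: scaleR_sum_right)
      finally have "((\<lambda>t. \<eta> (c t z) $ i) has_vector_derivative
         (\<Sum>j\<in>UNIV. partial i (\<lambda>z. \<eta> z $ j) (c t z) * (z $ j - a $ j))) (at t)"
        by (simp add: has_vector_derivative_def)
      then have "((\<lambda>t. t *\<^sub>R \<eta> (c t z) $ i) has_vector_derivative
         (t *\<^sub>R (\<Sum>j\<in>UNIV. partial i (\<lambda>z. \<eta> z $ j) (c t z) * (z $ j - a $ j)) + 1 *\<^sub>R \<eta> (c t z) $ i)) (at t)"
        by (intro has_vector_derivative_scaleR) (auto intro!: derivative_eq_intros)
      moreover have "t *\<^sub>R (\<Sum>j\<in>UNIV. partial i (\<lambda>z. \<eta> z $ j) (c t z) * (z $ j - a $ j)) + 1 *\<^sub>R \<eta> (c t z) $ i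
          = d i z t"
        unfolding d_def scaleR_conv_of_real sum_distrib_left
        by (intro arg_cong2[where f="(+)"] sum.cong) (auto simp: mult_ac)
      ultimately show ?thesis
        by (metis has_vector_derivative_at_within)
    qed
    then have "(d i z has_integral (1 *\<^sub>R \<eta> (c 1 z) $ i - 0 *\<^sub>R \<eta> (c 0 z) $ i)) {0..1}"
      by (intro fundamental_theorem_of_calculus) auto
    then show ?thesis by (simp add: integral_unique c_def)
  qed
  show thesis
  proof (rule that)
    show "holo_on F (ball a r)"
      by (rule holo_onI[OF _ der]) auto
    show "partial i F z = \<eta> z $ i" if "z \<in> ball a r" for z i
      using partial_eqI[OF der[OF that]] int[OF that] by simp
  qed
qed

lemma constant_if_partials_vanish:
  assumes "holo_on F (ball a r)" "\<And>z i. z \<in> ball a r \<Longrightarrow> partial i F z = 0" "z \<in> ball a r"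
  shows "F z = F a"
proof -
  have "\<exists>c. \<forall>x\<in>ball a r. F x = c"
    by (rule has_derivative_zero_constant)
       (use assms holo_has_derivative[OF assms(1)] in \<open>auto intro: has_derivative_at_withinI\<close>)
  moreover have "a \<in> ball a r" using assms(3) by (auto intro: le_less_trans[OF zero_le_dist])
  ultimately show ?thesis using assms(3) by metis
qed

section \<open>Coframes with constant structure functions\<close>

lemma vector4_nth [simp]:
  "(vector [x1, x2, x3, x4] :: ('a::zero)^4) $ 1 = x1"
  "(vector [x1, x2, x3, x4] :: ('a::zero)^4) $ 2 = x2"
  "(vector [x1, x2, x3, x4] :: ('a::zero)^4) $ 3 = x3"
  "(vector [x1, x2, x3, x4] :: ('a::zero)^4) $ 4 = x4"
  unfolding vector_def by simp_all

lemma vec4_eq_iff: "(x::'a^4) = y \<longleftrightarrow> x $ 1 = y $ 1 \<and> x $ 2 = y $ 2 \<and> x $ 3 = y $ 3 \<and> x $ 4 = y $ 4"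
  by (simp add: vec_eq_iff forall_4)

lemma vector4_eta: "vector [z $ 1, z $ 2, z $ 3, z $ 4] = (z :: ('a::zero)^4)"
  by (simp add: vec4_eq_iff)

lemma partial_sum_UNIV:
  assumes "\<And>k::'k::finite. holo_on (F k) S" "z \<in> S"
  shows "partial i (\<lambda>z. \<Sum>k\<in>UNIV. F k z) z = (\<Sum>k\<in>UNIV. partial i (F k) z)"
    and "((\<lambda>z. \<Sum>k\<in>UNIV. F k z) has_derivative (\<lambda>h. \<Sum>i\<in>UNIV. (\<Sum>k\<in>UNIV. partial i (F k) z) * h $ i)) (at z)"
proof -
  have "((\<lambda>z. \<Sum>k\<in>UNIV. F k z) has_derivative (\<lambda>h. \<Sum>k\<in>UNIV. \<Sum>i\<in>UNIV. partial i (F k) z * h $ i)) (at z)"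
    using holo_has_derivative[OF assms] by (intro has_derivative_sum)
  then show *: "((\<lambda>z. \<Sum>k\<in>UNIV. F k z) has_derivative (\<lambda>h. \<Sum>i\<in>UNIV. (\<Sum>k\<in>UNIV. partial i (F k) z) * h $ i)) (at z)"
    unfolding sum_distrib_right by (subst sum.swap)
  show "partial i (\<lambda>z. \<Sum>k\<in>UNIV. F k z) z = (\<Sum>k\<in>UNIV. partial i (F k) z)"
    by (rule partial_eqI[OF *])
qed

lemma holo_sum_UNIV [holo_intros]:
  "(\<And>k::'k::finite. holo_on (F k) S) \<Longrightarrow> holo_on (\<lambda>z. \<Sum>k\<in>UNIV. F k z) S"
  by (rule holo_onI[OF holo_on_open partial_sum_UNIV(2)])

text \<open>A two-form is handled as the antisymmetric matrix of its values on pairs of coordinate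
  vectors. A linear combination of the products of the rows of a coframe \<open>\<theta>\<close> then becomes a
  congruence \<open>transpose \<theta> ** B ** \<theta>\<close>, and both pullback and constant changes of coframe
  are matrix algebra.\<close>

definition form_d :: "(complex^4 \<Rightarrow> complex^4) \<Rightarrow> complex^4 \<Rightarrow> complex^4^4" where
  "form_d \<eta> z = (\<chi> r s. ext_deriv \<eta> z r s)"

definition structure_matrix :: "(4 \<Rightarrow> 4 \<Rightarrow> 4 \<Rightarrow> complex) \<Rightarrow> 4 \<Rightarrow> complex^4^4" where
  "structure_matrix T i = (\<chi> j k. if (j, k) \<in> increasing_pairs then T i j k
     else if (k, j) \<in> increasing_pairs then - T i k j else 0)"

definition mat_comb :: "complex^4 \<Rightarrow> (4 \<Rightarrow> complex^4^4) \<Rightarrow> complex^4^4" where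
  "mat_comb c B = (\<chi> r s. \<Sum>l\<in>UNIV. c $ l * B l $ r $ s)"

definition structure_equations ::
  "(complex^4 \<Rightarrow> complex^4^4) \<Rightarrow> (4 \<Rightarrow> complex^4^4) \<Rightarrow> complex^4 \<Rightarrow> bool" where
  "structure_equations H C z \<longleftrightarrow> (\<forall>i. form_d (\<lambda>w. H w $ i) z = transpose (H z) ** C i ** H z)"

definition holo_coframe :: "(complex^4 \<Rightarrow> complex^4^4) \<Rightarrow> (complex^4) set \<Rightarrow> bool" where
  "holo_coframe \<theta> S \<longleftrightarrow> (\<forall>i j. holo_on (\<lambda>z. \<theta> z $ i $ j) S)"

lemma congruence_nth:
  "(transpose A ** B ** A) $ r $ s = (\<Sum>k\<in>UNIV. \<Sum>j\<in>UNIV. A $ j $ r * B $ j $ k * A $ k $ s)"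
  for A B :: "'a::comm_semiring_1^'n::finite^'n"
  by (simp add: matrix_matrix_mult_def transpose_def sum_distrib_right mult.assoc)

lemma structure_matrix_congruence:
  "(\<Sum>(j, k)\<in>increasing_pairs. T i j k * wedge (\<theta> $ j) (\<theta> $ k) r s) =
     (transpose \<theta> ** structure_matrix T i ** \<theta>) $ r $ s"
  unfolding congruence_nth structure_matrix_def
  by (simp add: sum_4 increasing_pairs_def wedge_def algebra_simps)

lemma constant_structure_functions_iff:
  "constant_structure_functions \<theta> a T \<longleftrightarrow>
     (\<forall>\<^sub>F z in nhds a. structure_equations \<theta> (structure_matrix T) z)"
  unfolding constant_structure_functions_def structure_matrix_congruence
  by (simp add: structure_equations_def form_d_def vec_eq_iff)

lemma form_d_cong:
  assumes "open S" "\<And>w. w \<in> S \<Longrightarrow> \<eta> w = \<zeta> w" "z \<in> S"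
  shows "form_d \<eta> z = form_d \<zeta> z"
  unfolding form_d_def ext_deriv_def
  using partial_cong[OF assms(1) _ assms(3), of "\<lambda>w. \<eta> w $ k" "\<lambda>w. \<zeta> w $ k" for k] assms(2)
  by simp

text \<open>The exterior derivative commutes with pullback because the second derivatives of the map are
  symmetric.\<close>

lemma form_d_pullback:
  assumes \<phi>: "\<And>k. holo_on (\<phi> k) S" and \<eta>: "\<And>k. holo_on (\<lambda>w. \<eta> w $ k) T"
    and z: "z \<in> S" and T: "\<And>w. w \<in> S \<Longrightarrow> (\<chi> k. \<phi> k w) \<in> T"
  shows "form_d (\<lambda>w. \<chi> s. \<Sum>k\<in>UNIV. \<eta> (\<chi> k. \<phi> k w) $ k * partial s (\<phi> k) w) z =
    transpose (\<chi> i j. partial j (\<phi> i) z) ** form_d \<eta> (\<chi> k. \<phi> k z) ** (\<chi> i j. partial j (\<phi> i) z)"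
proof -
  let ?\<Phi> = "\<lambda>w. \<chi> k. \<phi> k w"
  have holo\<eta>: "holo_on (\<lambda>w. \<eta> (?\<Phi> w) $ k) S" for k
    using holo_chain[OF \<phi> \<eta> T] .
  define A where "A r s = (\<Sum>k\<in>UNIV. \<Sum>j\<in>UNIV.
      partial r (\<phi> j) z * partial j (\<lambda>w. \<eta> w $ k) (?\<Phi> z) * partial s (\<phi> k) z)" for r s
  define B where "B r s = (\<Sum>k\<in>UNIV. \<eta> (?\<Phi> z) $ k * partial r (partial s (\<phi> k)) z)" for r s
  have d: "partial r (\<lambda>w. \<Sum>k\<in>UNIV. \<eta> (?\<Phi> w) $ k * partial s (\<phi> k) w) z = A r s + B r s" for r s
  proof -
    have "partial r (\<lambda>w. \<eta> (?\<Phi> w) $ k * partial s (\<phi> k) w) z =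
        (\<Sum>j\<in>UNIV. partial r (\<phi> j) z * partial j (\<lambda>w. \<eta> w $ k) (?\<Phi> z) * partial s (\<phi> k) z)
        + \<eta> (?\<Phi> z) $ k * partial r (partial s (\<phi> k)) z" for k
      unfolding partial_mult[OF holo\<eta> holo_partial[OF \<phi>] z] partial_chain[OF \<phi> \<eta> z T[OF z]] sum_distrib_right
      by (simp add: mult.commute[of "partial r (\<phi> j) z" for j])
    moreover have "partial r (\<lambda>w. \<Sum>k\<in>UNIV. \<eta> (?\<Phi> w) $ k * partial s (\<phi> k) w) z =
        (\<Sum>k\<in>UNIV. partial r (\<lambda>w. \<eta> (?\<Phi> w) $ k * partial s (\<phi> k) w) z)"
      by (rule partial_sum_UNIV[OF holo_mult[OF holo\<eta> holo_partial[OF \<phi>]] z])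
    ultimately show ?thesis
      unfolding A_def B_def sum.distrib[symmetric] by simp
  qed
  have B: "B r s = B s r" for r s
    unfolding B_def using partial_commute[OF \<phi> z] by simp
  have A: "A s r = (\<Sum>k\<in>UNIV. \<Sum>j\<in>UNIV.
      partial r (\<phi> j) z * partial k (\<lambda>w. \<eta> w $ j) (?\<Phi> z) * partial s (\<phi> k) z)" for r s
    unfolding A_def by (subst sum.swap) (simp add: mult_ac)
  have "ext_deriv (\<lambda>w. \<chi> s. \<Sum>k\<in>UNIV. \<eta> (?\<Phi> w) $ k * partial s (\<phi> k) w) z r s =
    (\<Sum>k\<in>UNIV. \<Sum>j\<in>UNIV. partial r (\<phi> j) z * ext_deriv \<eta> (?\<Phi> z) j k * partial s (\<phi> k) z)" for r s
  proof -
    have "ext_deriv (\<lambda>w. \<chi> s. \<Sum>k\<in>UNIV. \<eta> (?\<Phi> w) $ k * partial s (\<phi> k) w) z r s = A r s - A s r"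
      unfolding ext_deriv_def using B[of r s] by (simp add: d)
    also have "\<dots> = (\<Sum>k\<in>UNIV. \<Sum>j\<in>UNIV. partial r (\<phi> j) z * ext_deriv \<eta> (?\<Phi> z) j k * partial s (\<phi> k) z)"
      unfolding A[where r=r and s=s] unfolding A_def ext_deriv_def sum_subtractf[symmetric]
      by (simp add: left_diff_distrib right_diff_distrib)
    finally show ?thesis .
  qed
  then show ?thesis
    by (simp add: vec_eq_iff congruence_nth form_d_def)
qed

lemma form_d_combination:
  assumes "holo_coframe \<theta> S" "z \<in> S"
  shows "form_d (\<lambda>w. (M ** \<theta> w) $ i) z = mat_comb (M $ i) (\<lambda>l. form_d (\<lambda>w. \<theta> w $ l) z)"
proof -
  have h: "holo_on (\<lambda>w. \<theta> w $ l $ s) S" for l s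
    using assms by (simp add: holo_coframe_def)
  have "partial r (\<lambda>w. \<Sum>l\<in>UNIV. M $ i $ l * \<theta> w $ l $ s) z = (\<Sum>l\<in>UNIV. M $ i $ l * partial r (\<lambda>w. \<theta> w $ l $ s) z)" for r s
    by (subst partial_sum_UNIV[where S=S])
       (auto intro!: holo_intros h assms simp: holo_on_open[OF h]
         partial_mult[OF holo_const[OF holo_on_open[OF h]] h assms(2)])
  then show ?thesis
    by (simp add: vec_eq_iff form_d_def ext_deriv_def matrix_matrix_mult_def mat_comb_def sum_subtractf algebra_simps)
qed

lemma congruence_combination:
  fixes A :: "complex^4^4"
  shows "mat_comb c (\<lambda>l. transpose A ** B l ** A) = transpose A ** mat_comb c B ** A"
  by (simp add: vec4_eq_iff congruence_nth mat_comb_def sum_4 algebra_simps)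

lemma congruence_mult:
  fixes A M :: "complex^4^4"
  shows "transpose (M ** A) ** C ** (M ** A) = transpose A ** (transpose M ** C ** M) ** A"
  by (simp add: matrix_transpose_mul matrix_mul_assoc)

lemma congruence_cancel:
  fixes A :: "complex^4^4"
  assumes "invertible A" "transpose A ** B ** A = transpose A ** C ** A"
  shows "B = C"
proof -
  obtain A' where A': "A ** A' = mat 1"
    using assms(1) invertible_def by blast
  have t: "transpose A' ** transpose A = mat 1"
    by (metis A' matrix_transpose_mul transpose_mat)
  have "X = transpose A' ** (transpose A ** X ** A) ** A'" for X
  proof -
    have "transpose A' ** (transpose A ** X ** A) ** A' = (transpose A' ** transpose A) ** X ** (A ** A')"
      by (simp only: matrix_mul_assoc)
    then show ?thesis by (simp add: t A')
  qed
  with assms(2) show ?thesis by metis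
qed

lemma structure_equations_cong:
  assumes "open S" "\<And>w. w \<in> S \<Longrightarrow> H w = H' w" "z \<in> S"
  shows "structure_equations H C z \<longleftrightarrow> structure_equations H' C z"
  using form_d_cong[OF assms(1) _ assms(3), of "\<lambda>w. H w $ i" "\<lambda>w. H' w $ i" for i] assms(2,3)
  by (simp add: structure_equations_def)

text \<open>The products of the rows of an invertible coframe are linearly independent, so structure
  equations of constant combinations of the rows carry over from one coframe to every other coframe
  with the same constant structure functions.\<close>

lemma structure_equations_transfer:
  fixes M :: "complex^4^4"
  assumes same: "same_constant_structure \<theta> a \<theta>' b"
    and \<theta>: "holo_coframe \<theta> S" "a \<in> S" and \<theta>': "holo_coframe \<theta>' S'" "b \<in> S'"
    and inv: "invertible (\<theta>' b)" and eq: "structure_equations (\<lambda>w. M ** \<theta>' w) C b"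
  shows "\<forall>\<^sub>F z in nhds a. structure_equations (\<lambda>w. M ** \<theta> w) C z"
proof -
  from same obtain T where T: "constant_structure_functions \<theta> a T" "constant_structure_functions \<theta>' b T"
    unfolding same_constant_structure_def by blast
  have C: "mat_comb (M $ i) (structure_matrix T) = transpose M ** C i ** M" for i
  proof (rule congruence_cancel[OF inv])
    have "structure_equations \<theta>' (structure_matrix T) b"
      using eventually_nhds_x_imp_x[OF T(2)[unfolded constant_structure_functions_iff]] .
    then have "transpose (\<theta>' b) ** mat_comb (M $ i) (structure_matrix T) ** \<theta>' b =
        form_d (\<lambda>w. (M ** \<theta>' w) $ i) b"
      by (simp add: structure_equations_def form_d_combination[OF \<theta>'] congruence_combination)
    also have "\<dots> = transpose (M ** \<theta>' b) ** C i ** (M ** \<theta>' b)"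
      using eq by (simp add: structure_equations_def)
    also have "\<dots> = transpose (\<theta>' b) ** (transpose M ** C i ** M) ** \<theta>' b" by (rule congruence_mult)
    finally show "transpose (\<theta>' b) ** mat_comb (M $ i) (structure_matrix T) ** \<theta>' b =
        transpose (\<theta>' b) ** (transpose M ** C i ** M) ** \<theta>' b" .
  qed
  have "\<forall>\<^sub>F z in nhds a. z \<in> S"
    using \<theta> by (auto simp: holo_coframe_def eventually_nhds dest: holo_on_open)
  with T(1)[unfolded constant_structure_functions_iff] show ?thesis
    by eventually_elim
       (simp add: structure_equations_def form_d_combination[OF \<theta>(1)] congruence_combination congruence_mult C)
qed

text \<open>The structure functions of a constant combination of a frame with constant structure matrices
  are read off from the congruence that turns the structure matrices of the frame into those of the
  combination; antisymmetry is what allows them to be recorded on the increasing pairs only.\<close>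

lemma constant_structure_functions_exists:
  fixes M N :: "complex^4^4"
  assumes H: "holo_coframe H S" "b \<in> S"
    and eq: "\<And>z. z \<in> S \<Longrightarrow> structure_equations H C z"
    and anti: "\<And>i. transpose (C i) = - C i"
    and \<theta>: "\<And>z. z \<in> S \<Longrightarrow> \<theta> z = N ** H z" and H\<theta>: "\<And>z. z \<in> S \<Longrightarrow> H z = M ** \<theta> z"
  shows "\<exists>T. constant_structure_functions \<theta> b T"
proof -
  define B where "B i = transpose M ** mat_comb (N $ i) C ** M" for i
  define T where "T i j k = B i $ j $ k" for i j k
  have antiC: "mat_comb (N $ i) C $ j $ k = - (mat_comb (N $ i) C $ k $ j)" for i j k
  proof -
    have "C l $ j $ k = - (C l $ k $ j)" for l
      using arg_cong[OF anti[of l], of "\<lambda>X. X $ k $ j"] by (simp add: transpose_def)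
    then have "(\<Sum>l\<in>UNIV. N $ i $ l * C l $ j $ k) = (\<Sum>l\<in>UNIV. - (N $ i $ l * C l $ k $ j))"
      by (intro sum.cong refl) (metis mult_minus_right)
    then show ?thesis by (simp add: mat_comb_def sum_negf)
  qed
  have antiB: "B i $ j $ k = - (B i $ k $ j)" for i j k
  proof -
    have "B i $ j $ k = (\<Sum>q\<in>UNIV. \<Sum>p\<in>UNIV. M $ q $ j * mat_comb (N $ i) C $ q $ p * M $ p $ k)"
      unfolding B_def congruence_nth by (rule sum.swap)
    also have "\<dots> = (\<Sum>q\<in>UNIV. \<Sum>p\<in>UNIV. - (M $ p $ k * mat_comb (N $ i) C $ p $ q * M $ q $ j))"
      by (intro sum.cong refl, subst antiC) simp
    finally show ?thesis unfolding B_def congruence_nth sum_negf .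
  qed
  have diag: "B i $ j $ j = 0" for i j
  proof -
    have "x = 0" if "x = - x" for x :: complex
      using that by (simp add: complex_eq_iff)
    then show ?thesis using antiB by blast
  qed
  have SM: "structure_matrix T i = B i" for i
    using antiB[of i 2 1] antiB[of i 3 1] antiB[of i 4 1] antiB[of i 3 2] antiB[of i 4 2] antiB[of i 4 3]
    by (simp add: diag vec4_eq_iff structure_matrix_def T_def increasing_pairs_def)
  have "open S" using H by (auto simp: holo_coframe_def dest: holo_on_open)
  have "structure_equations \<theta> (structure_matrix T) z" if z: "z \<in> S" for z
    unfolding structure_equations_def
  proof
    fix i
    have "form_d (\<lambda>w. \<theta> w $ i) z = form_d (\<lambda>w. (N ** H w) $ i) z"
      by (rule form_d_cong[OF \<open>open S\<close> _ z]) (simp add: \<theta>)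
    also have "\<dots> = transpose (H z) ** mat_comb (N $ i) C ** H z"
      using eq[OF z] by (simp add: structure_equations_def form_d_combination[OF H(1) z] congruence_combination)
    also have "\<dots> = transpose (\<theta> z) ** B i ** \<theta> z"
      unfolding H\<theta>[OF z] B_def congruence_mult ..
    finally show "form_d (\<lambda>w. \<theta> w $ i) z = transpose (\<theta> z) ** structure_matrix T i ** \<theta> z" by (simp add: SM)
  qed
  then show ?thesis
    unfolding constant_structure_functions_iff eventually_nhds using \<open>open S\<close> \<open>b \<in> S\<close> by blast
qed

lemma constant_structure_functions_pullback:
  assumes \<phi>: "\<And>k. holo_on (\<phi> k) S" "a \<in> S" and \<theta>: "holo_coframe \<theta> T" "\<And>w. w \<in> S \<Longrightarrow> (\<chi> k. \<phi> k w) \<in> T"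
    and csf: "constant_structure_functions \<theta> (\<chi> k. \<phi> k a) \<tau>"
    and eq: "\<And>w. w \<in> S \<Longrightarrow> \<theta>' w = \<theta> (\<chi> k. \<phi> k w) ** (\<chi> i j. partial j (\<phi> i) w)"
  shows "constant_structure_functions \<theta>' a \<tau>"
proof -
  let ?\<Phi> = "\<lambda>w. \<chi> k. \<phi> k w"
  have "open S" using \<phi> holo_on_open by blast
  have "continuous_on S ?\<Phi>"
    using holo_on_imp_continuous_on[OF \<phi>(1)] by (intro continuous_on_vec_lambda)
  then have "isCont ?\<Phi> a"
    using \<open>open S\<close> \<phi>(2) by (simp add: continuous_on_eq_continuous_at)
  then have "filterlim ?\<Phi> (nhds (?\<Phi> a)) (nhds a)"
    using tendsto_at_iff_tendsto_nhds[of ?\<Phi> a] unfolding isCont_def by blast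
  then have "\<forall>\<^sub>F z in nhds a. structure_equations \<theta> (structure_matrix \<tau>) (?\<Phi> z)"
    using csf[unfolded constant_structure_functions_iff] filterlim_iff by fast
  moreover have "\<forall>\<^sub>F z in nhds a. z \<in> S"
    using \<open>open S\<close> \<phi>(2) eventually_nhds by blast
  ultimately show ?thesis
    unfolding constant_structure_functions_iff
  proof eventually_elim
    case (elim z)
    show ?case
      unfolding structure_equations_def
    proof
      fix i
      have "form_d (\<lambda>w. \<theta>' w $ i) z =
          form_d (\<lambda>w. \<chi> s. \<Sum>k\<in>UNIV. (\<theta> (?\<Phi> w) $ i) $ k * partial s (\<phi> k) w) z"
        by (rule form_d_cong[OF \<open>open S\<close> _ elim(2)])
           (simp add: eq matrix_matrix_mult_def vec_eq_iff)
      also have "\<dots> = transpose (\<chi> i j. partial j (\<phi> i) z) ** form_d (\<lambda>w. \<theta> w $ i) (?\<Phi> z) ** (\<chi> i j. partial j (\<phi> i) z)"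
        by (rule form_d_pullback[OF \<phi>(1) _ elim(2) \<theta>(2)])
           (use \<theta>(1) in \<open>auto simp: holo_coframe_def\<close>)
      finally show "form_d (\<lambda>w. \<theta>' w $ i) z = transpose (\<theta>' z) ** structure_matrix \<tau> i ** \<theta>' z"
        using elim by (simp add: structure_equations_def eq congruence_mult)
    qed
  qed
qed

section \<open>The total derivative\<close>

context
  fixes f :: "complex^4 \<Rightarrow> complex" and S
  assumes f: "holo_on f S"
begin

lemma holo_total_deriv: "holo_on F S \<Longrightarrow> holo_on (total_deriv f F) S"
  unfolding total_deriv_def[abs_def]
  by (intro holo_intros f holo_on_open[OF f])

text \<open>The total derivative does not commute with the fibre derivatives. The commutators are what
  produces the derivatives of f when the equations of a prolonged transformation are differentiated.\<close>

lemma total_deriv_commutators: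
  assumes F: "holo_on F S" and z: "z \<in> S"
  shows "partial 4 (total_deriv f F) z = total_deriv f (partial 4 F) z + partial 3 F z + partial 4 f z * partial 4 F z" (is ?q)
    and "partial 3 (total_deriv f F) z = total_deriv f (partial 3 F) z + partial 2 F z + partial 3 f z * partial 4 F z" (is ?p)
    and "partial 2 (total_deriv f F) z = total_deriv f (partial 2 F) z + partial 2 f z * partial 4 F z" (is ?u)
proof -
  have nth: "holo_on (\<lambda>z. z $ j) S" for j
    by (intro holo_intros holo_on_open[OF f])
  have d: "partial i (total_deriv f F) z =
    partial i (partial 1 F) z
    + ((if i = 3 then 1 else 0) * partial 2 F z + z $ 3 * partial i (partial 2 F) z)
    + ((if i = 4 then 1 else 0) * partial 3 F z + z $ 4 * partial i (partial 3 F) z)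
    + (partial i f z * partial 4 F z + f z * partial i (partial 4 F) z)" for i
    unfolding total_deriv_def[abs_def]
    by (subst partial_add[OF _ _ z] partial_mult[OF _ _ z]; (intro holo_intros F f nth)?)+ simp
  note c = partial_commute[OF F z]
  show ?q ?p ?u
    unfolding d unfolding total_deriv_def
    using c[of 4 1] c[of 4 2] c[of 4 3] c[of 3 1] c[of 3 2] c[of 2 1] by simp_all
qed

end

lemma total_deriv_const [simp]: "total_deriv f (\<lambda>z. c) z = 0"
  by (simp add: total_deriv_def)

lemma total_deriv_cong:
  "open S \<Longrightarrow> (\<And>w. w \<in> S \<Longrightarrow> F w = G w) \<Longrightarrow> z \<in> S \<Longrightarrow> total_deriv f F z = total_deriv f G z"
  unfolding total_deriv_def using partial_cong[of S F G z] by simp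

lemma total_deriv_eqI:
  "open S \<Longrightarrow> (\<And>w. w \<in> S \<Longrightarrow> F w = G w) \<Longrightarrow> z \<in> S \<Longrightarrow> total_deriv f G z = X \<Longrightarrow> total_deriv f F z = X"
  using total_deriv_cong by blast

lemma partial_congI:
  "open S \<Longrightarrow> (\<And>w. w \<in> S \<Longrightarrow> F w = G w) \<Longrightarrow> z \<in> S \<Longrightarrow> partial i G z = X \<Longrightarrow> partial i F z = X"
  using partial_cong by metis

context
  fixes F G :: "complex^4 \<Rightarrow> complex" and S
  assumes F: "holo_on F S" and G: "holo_on G S"
begin

lemma total_deriv_add: "z \<in> S \<Longrightarrow> total_deriv f (\<lambda>z. F z + G z) z = total_deriv f F z + total_deriv f G z"
  by (simp add: total_deriv_def partial_add[OF F G] algebra_simps)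

lemma total_deriv_diff: "z \<in> S \<Longrightarrow> total_deriv f (\<lambda>z. F z - G z) z = total_deriv f F z - total_deriv f G z"
  by (simp add: total_deriv_def partial_diff[OF F G] algebra_simps)

lemma total_deriv_mult:
  "z \<in> S \<Longrightarrow> total_deriv f (\<lambda>z. F z * G z) z = total_deriv f F z * G z + F z * total_deriv f G z"
  by (simp add: total_deriv_def partial_mult[OF F G] algebra_simps)

lemma total_deriv_divide:
  "(\<And>z. z \<in> S \<Longrightarrow> G z \<noteq> 0) \<Longrightarrow> z \<in> S \<Longrightarrow>
   total_deriv f (\<lambda>z. F z / G z) z = (total_deriv f F z * G z - F z * total_deriv f G z) / (G z)\<^sup>2"
  by (simp add: total_deriv_def partial_divide[OF F G] add_divide_distrib diff_divide_distrib algebra_simps)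

end

lemma total_deriv_power2:
  "holo_on F S \<Longrightarrow> z \<in> S \<Longrightarrow> total_deriv f (\<lambda>z. (F z)\<^sup>2) z = 2 * F z * total_deriv f F z"
  unfolding power2_eq_square by (simp add: total_deriv_mult[where S=S])

lemma total_deriv_cmult:
  "holo_on F S \<Longrightarrow> z \<in> S \<Longrightarrow> total_deriv f (\<lambda>z. c * F z) z = c * total_deriv f F z"
  using total_deriv_mult[OF holo_const[OF holo_on_open]] by fastforce

lemma total_deriv_cdivide: "total_deriv f (\<lambda>z. F z / c) z = total_deriv f F z / c"
  if "holo_on F S" "z \<in> S"
  using total_deriv_cmult[OF that, of f "1 / c"] by simp

lemma partial_cmult:
  "holo_on F S \<Longrightarrow> z \<in> S \<Longrightarrow> partial i (\<lambda>z. c * F z) z = c * partial i F z"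
  using partial_mult[OF holo_const[OF holo_on_open]] by fastforce

lemma holo_I1: "holo_on f S \<Longrightarrow> holo_on (I1 f) S"
  unfolding I1_def[abs_def] by (intro holo_intros)

lemma holo_I2: "holo_on f S \<Longrightarrow> holo_on (I2 f) S"
  unfolding I2_def[abs_def] by (intro holo_intros holo_I1 holo_total_deriv) (auto intro: holo_on_open)

lemma holo_I3: "holo_on f S \<Longrightarrow> holo_on (I3 f) S"
  unfolding I3_def[abs_def] by (intro holo_intros holo_I1) (auto intro: holo_on_open)

section \<open>Point transformations and the invariants\<close>

text \<open>The prolongation \<open>(X, U, P, Q)\<close> of a point transformation of \<open>u''' = f\<close> into \<open>U''' = g\<close>, with
  all its components regarded as functions of the jet.\<close>

locale point_transformation =
  fixes f g X U P Q :: "complex^4 \<Rightarrow> complex" and S T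
  assumes f: "holo_on f S" and g: "holo_on g T" and X: "holo_on X S" and U: "holo_on U S"
    and X_base: "z \<in> S \<Longrightarrow> partial 3 X z = 0" "z \<in> S \<Longrightarrow> partial 4 X z = 0"
    and U_base: "z \<in> S \<Longrightarrow> partial 3 U z = 0" "z \<in> S \<Longrightarrow> partial 4 U z = 0"
    and lam_nz: "z \<in> S \<Longrightarrow> total_deriv f X z \<noteq> 0"
    and jacobian: "z \<in> S \<Longrightarrow> partial 1 X z * partial 2 U z - partial 2 X z * partial 1 U z \<noteq> 0"
    and P_eq: "z \<in> S \<Longrightarrow> P z = total_deriv f U z / total_deriv f X z"
    and Q_eq: "z \<in> S \<Longrightarrow> Q z = total_deriv f P z / total_deriv f X z"
    and R_eq: "z \<in> S \<Longrightarrow> total_deriv f Q z / total_deriv f X z = g (vector [X z, U z, P z, Q z])"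
    and in_T: "z \<in> S \<Longrightarrow> vector [X z, U z, P z, Q z] \<in> T"
begin

abbreviation D :: "(complex^4 \<Rightarrow> complex) \<Rightarrow> complex^4 \<Rightarrow> complex" where "D \<equiv> total_deriv f"

text \<open>The prolonged map pulls \<open>\<omega>1\<close> back to \<open>mu \<omega>1\<close> and dx to \<open>lam dx\<close> modulo \<open>\<omega>1\<close>. The logarithmic total
  derivatives dlm and dll of mu and lam, differentiated further by D, and \<open>X_u\<close> are the only other
  quantities through which the transformation enters I1, I2 and I3.\<close>

definition lam :: "complex^4 \<Rightarrow> complex" where "lam z = D X z"
definition mu :: "complex^4 \<Rightarrow> complex" where "mu z = partial 2 U z - P z * partial 2 X z"
definition dlm :: "complex^4 \<Rightarrow> complex" where "dlm z = D mu z / mu z"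
definition dll :: "complex^4 \<Rightarrow> complex" where "dll z = D lam z / lam z"
definition jet :: "complex^4 \<Rightarrow> complex^4" where "jet z = vector [X z, U z, P z, Q z]"

lemma openS: "open S" using f by (rule holo_on_open)

lemma holo_lam: "holo_on lam S"
  unfolding lam_def[abs_def] by (intro holo_total_deriv f X)

lemma lam_nonzero: "z \<in> S \<Longrightarrow> lam z \<noteq> 0" by (simp add: lam_def lam_nz)

lemma holo_P: "holo_on P S"
  by (rule holo_on_cong[of "\<lambda>z. D U z / D X z"])
     (auto intro!: holo_intros holo_total_deriv f X U simp: lam_nz P_eq)

lemma holo_Q: "holo_on Q S"
  by (rule holo_on_cong[of "\<lambda>z. D P z / D X z"])
     (auto intro!: holo_intros holo_total_deriv f X holo_P simp: lam_nz Q_eq)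

lemma holo_mu: "holo_on mu S"
  unfolding mu_def[abs_def] by (intro holo_intros U X holo_P)

lemma lam_mu: "z \<in> S \<Longrightarrow> lam z * mu z = partial 1 X z * partial 2 U z - partial 2 X z * partial 1 U z"
  using lam_nz[of z] unfolding lam_def mu_def by (simp add: P_eq X_base U_base field_simps total_deriv_def)

lemma mu_nonzero: "z \<in> S \<Longrightarrow> mu z \<noteq> 0"
  using lam_mu jacobian by fastforce

lemma holo_dlm: "holo_on dlm S"
  unfolding dlm_def[abs_def] by (intro holo_intros holo_total_deriv f holo_mu) (rule mu_nonzero)

lemma holo_dll: "holo_on dll S"
  unfolding dll_def[abs_def] by (intro holo_intros holo_total_deriv f holo_lam) (rule lam_nonzero)

lemma D_mu: "z \<in> S \<Longrightarrow> D mu z = mu z * dlm z" by (simp add: dlm_def mu_nonzero)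
lemma D_lam: "z \<in> S \<Longrightarrow> D lam z = lam z * dll z" by (simp add: dll_def lam_nonzero)

lemma D_jet:
  assumes "z \<in> S"
  shows "D X z = lam z" "D U z = lam z * P z" "D P z = lam z * Q z" "D Q z = lam z * g (jet z)"
  using assms lam_nz[OF assms] P_eq[OF assms] Q_eq[OF assms] R_eq[OF assms]
  by (simp_all add: lam_def jet_def field_simps)

lemma holo_pullback: "holo_on G T \<Longrightarrow> holo_on (\<lambda>z. G (jet z)) S"
  and partial_pullback: "holo_on G T \<Longrightarrow> z \<in> S \<Longrightarrow> partial i (\<lambda>z. G (jet z)) z =
    partial 1 G (jet z) * partial i X z + partial 2 G (jet z) * partial i U z
    + partial 3 G (jet z) * partial i P z + partial 4 G (jet z) * partial i Q z"
proof -
  define c where "c j = (if j = 1 then X else if j = 2 then U else if j = 3 then P else Q)" for j :: 4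
  have c: "holo_on (c j) S" for j
    by (simp add: c_def X U holo_P holo_Q)
  have jet: "jet z = (\<chi> j. c j z)" for z
    by (simp add: vec4_eq_iff jet_def c_def)
  have T: "z \<in> S \<Longrightarrow> (\<chi> j. c j z) \<in> T" for z
    using in_T by (simp add: jet[symmetric]) (simp add: jet_def)
  assume G: "holo_on G T"
  show "holo_on (\<lambda>z. G (jet z)) S"
    unfolding jet by (rule holo_chain[OF c G T])
  show "z \<in> S \<Longrightarrow> partial i (\<lambda>z. G (jet z)) z =
    partial 1 G (jet z) * partial i X z + partial 2 G (jet z) * partial i U z
    + partial 3 G (jet z) * partial i P z + partial 4 G (jet z) * partial i Q z"
    unfolding jet by (simp add: partial_chain[OF c G _ T] sum_4) (simp add: c_def)
qed

lemma D_pullback: "holo_on G T \<Longrightarrow> z \<in> S \<Longrightarrow> D (\<lambda>z. G (jet z)) z = lam z * total_deriv g G (jet z)"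
proof -
  assume G: "holo_on G T" and z: "z \<in> S"
  have "D (\<lambda>z. G (jet z)) z = partial 1 G (jet z) * D X z + partial 2 G (jet z) * D U z
     + partial 3 G (jet z) * D P z + partial 4 G (jet z) * D Q z"
    unfolding total_deriv_def[of f] partial_pullback[OF G z] by (simp add: algebra_simps)
  also have "\<dots> = lam z * total_deriv g G (jet z)"
    by (simp add: D_jet[OF z] total_deriv_def[of g]) (simp add: jet_def algebra_simps)
  finally show ?thesis .
qed

lemmas commutators = total_deriv_commutators[OF f]

lemma D_vanishing: "(\<And>w. w \<in> S \<Longrightarrow> F w = 0) \<Longrightarrow> z \<in> S \<Longrightarrow> D F z = 0"
  using total_deriv_cong[OF openS, of F "\<lambda>_. 0"] by simp

lemma partial_lam:
  assumes z: "z \<in> S"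
  shows "partial 4 lam z = 0" "partial 3 lam z = partial 2 X z" "partial 2 lam z = D (partial 2 X) z"
  using commutators[OF X z] X_base z D_vanishing[OF X_base(1) z] D_vanishing[OF X_base(2) z]
  by (simp_all add: lam_def[abs_def])

lemma partial_DU:
  assumes z: "z \<in> S"
  shows "partial 4 (D U) z = 0" "partial 3 (D U) z = partial 2 U z" "partial 2 (D U) z = D (partial 2 U) z"
  using commutators[OF U z] U_base z D_vanishing[OF U_base(1) z] D_vanishing[OF U_base(2) z]
  by simp_all

text \<open>Differentiating \<open>D U = lam P\<close>, \<open>D P = lam Q\<close> and \<open>D Q = lam g\<close> in the fibre
  coordinates and commuting with D gives the Jacobian of the prolonged map and the
  derivatives of f.\<close>

lemma partial_P:
  assumes z: "z \<in> S"
  shows "partial 4 P z = 0" "partial 3 P z = mu z / lam z"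
    "partial 2 P z = mu z * dlm z / lam z + Q z * partial 2 X z" (is "_ = ?u")
proof -
  have e: "partial i (D U) z = partial i lam z * P z + lam z * partial i P z" for i
    by (rule partial_congI[OF openS D_jet(2) z partial_mult[OF holo_lam holo_P z]])
  have "mu z * dlm z = D mu z" using z by (simp add: D_mu)
  also have "\<dots> = D (partial 2 U) z - (D P z * partial 2 X z + P z * D (partial 2 X) z)"
    unfolding mu_def[abs_def]
    by (simp add: total_deriv_diff[where S=S] total_deriv_mult[where S=S] z holo_intros U X holo_P)
  finally have m: "mu z * dlm z = D (partial 2 U) z - (D P z * partial 2 X z + P z * D (partial 2 X) z)" .
  have nz: "lam z \<noteq> 0" by (rule lam_nonzero[OF z])
  have 2: "lam z * partial 2 P z = lam z * ?u"
    using e[of 2] nz unfolding m partial_lam[OF z] partial_DU[OF z] D_jet[OF z]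
    by (simp add: distrib_left)
  show "partial 4 P z = 0" "partial 3 P z = mu z / lam z"
    using e[of 4] e[of 3] nz unfolding partial_lam[OF z] partial_DU[OF z]
    by (simp_all add: mu_def field_simps)
  show "partial 2 P z = ?u"
    using 2 nz by (metis mult_left_cancel)
qed

lemma D_P_coeffs:
  assumes z: "z \<in> S"
  shows "D (partial 4 P) z = 0" "D (partial 3 P) z = mu z / lam z * (dlm z - dll z)"
    "D (partial 2 P) z = mu z / lam z * (D dlm z + dlm z * (dlm z - dll z))
       + lam z * g (jet z) * partial 2 X z + Q z * D (partial 2 X) z" (is "_ = ?u")
proof -
  show "D (partial 4 P) z = 0"
    by (rule D_vanishing[OF partial_P(1) z])
  have 3: "D (\<lambda>z. mu z / lam z) z = mu z / lam z * (dlm z - dll z)"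
    by (simp add: total_deriv_divide[where S=S] holo_mu holo_lam lam_nonzero z D_mu D_lam field_simps power2_eq_square)
  then show "D (partial 3 P) z = mu z / lam z * (dlm z - dll z)"
    by (rule total_deriv_eqI[OF openS _ z, rotated]) (rule partial_P(2))
  define r where "r z = mu z / lam z" for z
  have h: "holo_on r S"
    unfolding r_def[abs_def] by (intro holo_intros holo_mu holo_lam) (rule lam_nonzero)
  have r: "D r z = r z * (dlm z - dll z)"
    using 3 by (simp add: r_def[abs_def])
  have "D (\<lambda>z. r z * dlm z + Q z * partial 2 X z) z = r z * (D dlm z + dlm z * (dlm z - dll z))
       + lam z * g (jet z) * partial 2 X z + Q z * D (partial 2 X) z"
    by (simp add: total_deriv_add[where S=S] total_deriv_mult[where S=S] h z holo_dlm holo_Q X holo_intros r D_jet)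
       (simp add: algebra_simps)
  then show "D (partial 2 P) z = ?u"
    unfolding r_def by (rule total_deriv_eqI[OF openS _ z, rotated]) (simp add: partial_P)
qed

text \<open>Up to a multiple of \<open>X_u\<close>, the derivatives \<open>P_u\<close> and \<open>Q_u\<close> are \<open>mu / lam\<close> times dlm and
  \<open>mu / lam^2\<close> times eps.\<close>

definition eps :: "complex^4 \<Rightarrow> complex" where
  "eps z = D dlm z + dlm z * (dlm z - dll z)"

lemma holo_eps: "holo_on eps S"
  unfolding eps_def[abs_def] by (intro holo_intros holo_total_deriv f holo_dlm holo_dll)

definition nu :: "complex^4 \<Rightarrow> complex" where "nu z = mu z / (lam z)\<^sup>2"

lemma holo_nu: "holo_on nu S"
  unfolding nu_def[abs_def] by (intro holo_intros holo_mu holo_lam) (simp add: lam_nonzero)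

lemma nu_nonzero: "z \<in> S \<Longrightarrow> nu z \<noteq> 0"
  by (simp add: nu_def lam_nonzero mu_nonzero)

lemma D_nu: "z \<in> S \<Longrightarrow> D nu z = nu z * (dlm z - 2 * dll z)"
  unfolding nu_def[abs_def]
  by (simp add: total_deriv_divide[where S=S] total_deriv_power2[where S=S] holo_intros holo_mu holo_lam lam_nonzero D_mu D_lam)
     (simp add: lam_nonzero field_simps power2_eq_square power4_eq_xxxx)

lemma partial_Q:
  assumes z: "z \<in> S"
  shows "partial 4 Q z = nu z" (is ?q) and "partial 3 Q z = nu z * (2 * dlm z - dll z)" (is ?p)
    and "partial 2 Q z = nu z * eps z + g (jet z) * partial 2 X z" (is ?u)
proof -
  have e: "partial i (D P) z = partial i lam z * Q z + lam z * partial i Q z" for i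
    by (rule partial_congI[OF openS D_jet(3) z partial_mult[OF holo_lam holo_Q z]])
  have nz: "lam z \<noteq> 0" by (rule lam_nonzero[OF z])
  have mu: "mu z / lam z = lam z * nu z" "mu z * dlm z / lam z = lam z * nu z * dlm z"
    using nz by (simp_all add: nu_def power2_eq_square)
  have "lam z * partial 4 Q z = lam z * nu z"
    "lam z * partial 3 Q z = lam z * (nu z * (2 * dlm z - dll z))"
    "lam z * partial 2 Q z = lam z * (nu z * eps z + g (jet z) * partial 2 X z)"
    using e[of 4] e[of 3] e[of 2]
    unfolding commutators[OF holo_P z] partial_lam[OF z] partial_P[OF z] D_P_coeffs[OF z] mu
    by (auto simp: eps_def algebra_simps)
  with nz show ?q ?p ?u
    by (metis mult_left_cancel)+
qed

lemma pullback_fibre: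
  assumes G: "holo_on G T" and z: "z \<in> S"
  shows "partial 4 (\<lambda>z. G (jet z)) z = nu z * partial 4 G (jet z)"
    "partial 3 (\<lambda>z. G (jet z)) z = mu z / lam z * partial 3 G (jet z) + nu z * (2 * dlm z - dll z) * partial 4 G (jet z)"
  using X_base U_base z by (simp_all add: partial_pullback[OF G z] partial_P partial_Q)

lemma f_derivatives:
  assumes z: "z \<in> S"
  shows "partial 4 f z = lam z * partial 4 g (jet z) - 3 * dlm z + 3 * dll z" (is "?q = ?q'")
    and "partial 3 f z = (lam z)\<^sup>2 * partial 3 g (jet z) + lam z * (2 * dlm z - dll z) * partial 4 g (jet z)
      - (2 * D dlm z - D dll z + (2 * dlm z - dll z) * (dlm z - 2 * dll z) + eps z)" (is "?p = ?p'")
    and "partial 2 f z = (lam z)^3 * partial 2 g (jet z) + (lam z)\<^sup>2 * dlm z * partial 3 g (jet z)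
      + lam z * eps z * partial 4 g (jet z) - (D eps z + eps z * (dlm z - 2 * dll z))" (is "?u = ?u'")
proof -
  have e: "partial i (D Q) z = partial i lam z * g (jet z) + lam z * partial i (\<lambda>z. g (jet z)) z" for i
    by (rule partial_congI[OF openS D_jet(4) z partial_mult[OF holo_lam holo_pullback[OF g] z]])
  have 4: "D (partial 4 Q) z = nu z * (dlm z - 2 * dll z)"
    by (rule total_deriv_eqI[OF openS partial_Q(1) z D_nu[OF z]])
  have "D (\<lambda>z. nu z * (2 * dlm z - dll z)) z = nu z * (2 * D dlm z - D dll z + (2 * dlm z - dll z) * (dlm z - 2 * dll z))"
    by (simp add: total_deriv_mult[where S=S] total_deriv_diff[where S=S] holo_intros openS holo_nu holo_dlm holo_dll z D_nu)
       (simp add: algebra_simps)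
  then have 3: "D (partial 3 Q) z = nu z * (2 * D dlm z - D dll z + (2 * dlm z - dll z) * (dlm z - 2 * dll z))"
    by (rule total_deriv_eqI[OF openS _ z, rotated]) (rule partial_Q(2))
  have "D (\<lambda>z. nu z * eps z + g (jet z) * partial 2 X z) z =
    nu z * (D eps z + eps z * (dlm z - 2 * dll z)) + lam z * total_deriv g g (jet z) * partial 2 X z + g (jet z) * D (partial 2 X) z"
    by (simp add: total_deriv_add[where S=S] total_deriv_mult[where S=S] holo_intros holo_nu holo_eps X holo_pullback[OF g] z D_nu D_pullback[OF g])
       (simp add: algebra_simps)
  then have 2: "D (partial 2 Q) z = nu z * (D eps z + eps z * (dlm z - 2 * dll z))
      + lam z * total_deriv g g (jet z) * partial 2 X z + g (jet z) * D (partial 2 X) z"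
    by (rule total_deriv_eqI[OF openS _ z, rotated]) (rule partial_Q(3))
  have nz: "lam z \<noteq> 0" "mu z \<noteq> 0" using z lam_nonzero mu_nonzero by auto
  have q: "nu z * ?q = nu z * ?q'"
    using e[of 4] unfolding commutators[OF holo_Q z] 4 partial_lam[OF z] partial_Q[OF z] pullback_fibre[OF g z]
    by (simp add: algebra_simps)
  have mu: "mu z / lam z = nu z * lam z"
    using nz by (simp add: nu_def field_simps power2_eq_square)
  have p: "nu z * ?p = nu z * ?p'"
    using e[of 3] unfolding commutators[OF holo_Q z] 3 partial_lam[OF z] partial_Q[OF z] pullback_fibre[OF g z] mu
    by (simp add: algebra_simps power2_eq_square)
  have P2: "partial 2 P z = nu z * lam z * dlm z + Q z * partial 2 X z"
    using partial_P(3)[OF z] by (simp add: mu[symmetric])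
  have U2: "partial 2 U z = nu z * (lam z)\<^sup>2 + P z * partial 2 X z"
    using nz by (simp add: nu_def mu_def)
  have u: "nu z * ?u = nu z * ?u'"
    using e[of 2] unfolding commutators[OF holo_Q z] 2 partial_lam[OF z] partial_Q[OF z]
      partial_pullback[OF g z] P2 U2 total_deriv_def[of g]
    by (simp add: jet_def algebra_simps power2_eq_square power3_eq_cube)
  show "?q = ?q'" "?p = ?p'" "?u = ?u'"
    using q p u nu_nonzero[OF z] by (metis mult_left_cancel)+
qed

subsection \<open>Transformation of the relative invariants\<close>

text \<open>Substituting the derivatives of f, the terms without derivatives of g are made of dlm, dll, eps
  and their total derivatives. They survive in I1 and I2 and cancel in I4. In the same way \<open>X_u\<close>
  survives in I3 and cancels in I5 and I6, so that I5 is a relative invariant once I6 vanishes.\<close>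

lemma I1_transform: "z \<in> S \<Longrightarrow> I1 f z = lam z * I1 g (jet z) + 3 * (dlm z - dll z)"
  by (simp add: I1_def f_derivatives algebra_simps)

lemma D_I1:
  assumes z: "z \<in> S"
  shows "D (I1 f) z = lam z * dll z * I1 g (jet z) + (lam z)\<^sup>2 * total_deriv g (I1 g) (jet z) + 3 * (D dlm z - D dll z)" (is "_ = ?rhs")
proof (rule total_deriv_eqI[OF openS I1_transform z])
  show "D (\<lambda>z. lam z * I1 g (jet z) + 3 * (dlm z - dll z)) z = ?rhs"
    by (simp add: total_deriv_add[where S=S] total_deriv_mult[where S=S] total_deriv_diff[where S=S]
        holo_intros openS holo_lam holo_dlm holo_dll holo_pullback[OF holo_I1[OF g]] z D_lam D_pullback[OF holo_I1[OF g]])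
      (simp add: power2_eq_square)
qed

lemma I2_transform:
  assumes z: "z \<in> S"
  shows "I2 f z = (lam z)\<^sup>2 * I2 g (jet z) + (2/3) * (lam z * dlm z * I1 g (jet z)) + (2 * eps z - (dlm z)\<^sup>2)"
  unfolding I2_def D_I1[OF z] I1_transform[OF z] f_derivatives[OF z]
  by (simp add: I1_def eps_def field_simps power2_eq_square)

lemma D_I2:
  assumes z: "z \<in> S"
  shows "D (I2 f) z = 2 * (lam z)\<^sup>2 * dll z * I2 g (jet z) + (lam z)^3 * total_deriv g (I2 g) (jet z)
     + (2/3) * (lam z * (dll z * dlm z + D dlm z) * I1 g (jet z) + (lam z)\<^sup>2 * dlm z * total_deriv g (I1 g) (jet z))
     + (2 * D eps z - 2 * dlm z * D dlm z)" (is "_ = ?rhs")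
proof (rule total_deriv_eqI[OF openS I2_transform z])
  show "D (\<lambda>z. (lam z)\<^sup>2 * I2 g (jet z) + (2/3) * (lam z * dlm z * I1 g (jet z)) + (2 * eps z - (dlm z)\<^sup>2)) z = ?rhs"
    unfolding power2_eq_square
    by (simp add: total_deriv_add[where S=S] total_deriv_mult[where S=S] total_deriv_diff[where S=S]
        holo_intros openS holo_lam holo_dlm holo_dll holo_eps holo_pullback[OF holo_I1[OF g]] holo_pullback[OF holo_I2[OF g]]
        total_deriv_cdivide[where S=S] z D_lam D_pullback[OF holo_I1[OF g]] D_pullback[OF holo_I2[OF g]])
      (simp add: algebra_simps power3_eq_cube)
qed

lemma I4_transform:
  assumes z: "z \<in> S"
  shows "I4 f z = (lam z)^3 * I4 g (jet z)"
proof -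
  have p: "partial 3 g (jet z) = - (2/9) * (I1 g (jet z))\<^sup>2 - I2 g (jet z) - (1/3) * total_deriv g (I1 g) (jet z)"
    by (simp add: I2_def)
  have u: "partial 2 g (jet z) = - (1/3) * I1 g (jet z) * I2 g (jet z) - I4 g (jet z) - (1/2) * total_deriv g (I2 g) (jet z)"
    by (simp add: I4_def)
  have q: "partial 4 g (jet z) = - I1 g (jet z)"
    by (simp add: I1_def)
  have e: "D dlm z = eps z - dlm z * (dlm z - dll z)"
    by (simp add: eps_def)
  show ?thesis
    unfolding I4_def[of f] D_I2[OF z] I2_transform[OF z] I1_transform[OF z] f_derivatives[OF z] p q u e
    by (simp add: field_simps power2_eq_square power3_eq_cube)
qed

lemma partial_mu:
  assumes z: "z \<in> S"
  shows "partial 4 mu z = 0" "partial 3 mu z = - (mu z / lam z) * partial 2 X z"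
proof -
  have "partial i mu z = partial i (partial 2 U) z - (partial i P z * partial 2 X z + P z * partial i (partial 2 X) z)" for i
    unfolding mu_def[abs_def]
    by (simp add: partial_diff[where S=S] partial_mult[where S=S] z holo_intros U X holo_P)
  moreover have "partial i (partial 2 U) z = 0" "partial i (partial 2 X) z = 0" if "i = 3 \<or> i = 4" for i
    using that partial_cong[OF openS _ z, of "partial i U" "\<lambda>_. 0" 2] partial_cong[OF openS _ z, of "partial i X" "\<lambda>_. 0" 2]
      partial_commute[OF U z, of i 2] partial_commute[OF X z, of i 2] U_base X_base by auto
  ultimately show "partial 4 mu z = 0" "partial 3 mu z = - (mu z / lam z) * partial 2 X z"
    using partial_P[OF z] by auto
qed

lemma partial4_dlm_dll:
  assumes z: "z \<in> S"
  shows "partial 4 dlm z = - (partial 2 X z / lam z)" "partial 4 dll z = partial 2 X z / lam z"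
proof -
  have nz: "lam z \<noteq> 0" "mu z \<noteq> 0" using z lam_nonzero mu_nonzero by auto
  have "partial 4 (D mu) z = - (mu z / lam z) * partial 2 X z"
    using commutators(1)[OF holo_mu z] partial_mu[OF z] D_vanishing[OF partial_mu(1) z] by simp
  moreover have "partial 4 (D mu) z = partial 4 mu z * dlm z + mu z * partial 4 dlm z"
    by (rule partial_congI[OF openS D_mu z partial_mult[OF holo_mu holo_dlm z]])
  ultimately have "mu z * partial 4 dlm z = mu z * - (partial 2 X z / lam z)"
    using partial_mu[OF z] by simp
  then show "partial 4 dlm z = - (partial 2 X z / lam z)"
    using nz by (metis mult_left_cancel)
  have "partial 4 (D lam) z = partial 2 X z"
    using commutators(1)[OF holo_lam z] partial_lam[OF z] D_vanishing[OF partial_lam(1) z] by simp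
  moreover have "partial 4 (D lam) z = partial 4 lam z * dll z + lam z * partial 4 dll z"
    by (rule partial_congI[OF openS D_lam z partial_mult[OF holo_lam holo_dll z]])
  ultimately show "partial 4 dll z = partial 2 X z / lam z"
    using nz partial_lam[OF z] by (simp add: field_simps)
qed

lemma I3_transform:
  assumes z: "z \<in> S"
  shows "I3 f z = (mu z * I3 g (jet z) + partial 2 X z) / lam z"
proof -
  have "partial 4 (I1 f) z = lam z * (nu z * partial 4 (I1 g) (jet z)) - 6 * (partial 2 X z / lam z)" (is "_ = ?rhs")
  proof (rule partial_congI[OF openS I1_transform z])
    show "partial 4 (\<lambda>z. lam z * I1 g (jet z) + 3 * (dlm z - dll z)) z = ?rhs"
      by (simp add: partial_add[where S=S] partial_mult[where S=S] partial_diff[where S=S]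
        holo_intros openS holo_lam holo_dlm holo_dll holo_pullback[OF holo_I1[OF g]] z
        pullback_fibre[OF holo_I1[OF g]] partial_lam partial4_dlm_dll)
  qed
  then show ?thesis
    using lam_nonzero[OF z] by (simp add: I3_def nu_def field_simps power2_eq_square)
qed

lemma partial_I3:
  assumes z: "z \<in> S" and i: "i = 3 \<or> i = 4"
  shows "partial i (I3 f) z = (partial i mu z * I3 g (jet z) + mu z * partial i (\<lambda>z. I3 g (jet z)) z) / lam z
    - (mu z * I3 g (jet z) + partial 2 X z) * partial i lam z / (lam z)\<^sup>2" (is "_ = ?rhs")
proof (rule partial_congI[OF openS I3_transform z])
  have "partial i (partial 2 X) z = 0"
    using i partial_cong[OF openS _ z, of "partial i X" "\<lambda>_. 0" 2] partial_commute[OF X z, of i 2] X_base by auto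
  then show "partial i (\<lambda>z. (mu z * I3 g (jet z) + partial 2 X z) / lam z) z = ?rhs"
    using lam_nonzero[OF z]
    by (simp add: partial_add[where S=S] partial_mult[where S=S] partial_divide[where S=S]
        holo_intros openS holo_lam holo_mu X holo_pullback[OF holo_I3[OF g]] z lam_nonzero)
       (simp add: diff_divide_distrib power2_eq_square)
qed

lemma I6_transform: "z \<in> S \<Longrightarrow> I6 f z = (mu z)\<^sup>2 / (lam z)^3 * I6 g (jet z)"
  by (simp add: I6_def partial_I3 pullback_fibre[OF holo_I3[OF g]] partial_mu partial_lam nu_def
      lam_nonzero field_simps power2_eq_square power3_eq_cube)

lemma I5_transform:
  "z \<in> S \<Longrightarrow> I5 f z = (mu z / lam z)\<^sup>2 * I5 g (jet z) + (mu z / lam z) * nu z * (2 * dlm z - dll z) * I6 g (jet z)"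
  unfolding I5_def I6_def
  by (simp add: partial_I3 pullback_fibre[OF holo_I3[OF g]] partial_mu partial_lam I3_transform)
     (simp add: lam_nonzero field_simps power2_eq_square)

end

section \<open>Invariance of the coframe\<close>

text \<open>With \<open>r = slope f J4\<close> the coframe reads \<open>J4 J5 \<omega>1\<close>, \<open>J5 (\<omega>2 + r \<omega>1)\<close>,
  \<open>(J5 / J4) (\<omega>3 + (r + I1/3) \<omega>2 + (r^2 + I2)/2 \<omega>1)\<close>, \<open>J4 (dx + I3 \<omega>1)\<close>; the factor J5 in
  the definition of I7 cancels.\<close>

definition slope :: "(complex^4 \<Rightarrow> complex) \<Rightarrow> (complex^4 \<Rightarrow> complex) \<Rightarrow> complex^4 \<Rightarrow> complex" where
  "slope f J4 z = (partial 3 J4 z - I3 f z * J4 z) / partial 4 J4 z - I1 f z / 3"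

definition coframe_matrix :: "complex \<Rightarrow> complex \<Rightarrow> complex \<Rightarrow> complex \<Rightarrow> complex \<Rightarrow> complex \<Rightarrow> complex^4^4" where
  "coframe_matrix j4 j5 r i1 i2 i3 = vector
     [vector [j4 * j5, 0, 0, 0],
      vector [j5 * r, j5, 0, 0],
      vector [j5 / j4 * ((r\<^sup>2 + i2) / 2), j5 / j4 * (r + i1 / 3), j5 / j4, 0],
      vector [i3 * j4, 0, 0, j4]]"

lemma invariant_coframe_eq:
  assumes "J4 z \<noteq> 0" "J5 z \<noteq> 0" "partial 4 J4 z \<noteq> 0"
  shows "invariant_coframe f J4 J5 z =
    coframe_matrix (J4 z) (J5 z) (slope f J4 z) (I1 f z) (I2 f z) (I3 f z) ** base_coframe f z"
proof -
  define r where "r = slope f J4 z"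
  have I7: "I7 f J4 J5 z = r * partial 4 J4 z / (J4 z * J5 z)"
    using assms by (simp add: I7_def r_def slope_def field_simps power2_eq_square)
  show ?thesis
    unfolding invariant_coframe_def Let_def I7 r_def[symmetric]
    by (rule arg_cong2[where f="(**)"])
       (use assms in \<open>simp_all add: coframe_matrix_def vec4_eq_iff field_simps power2_eq_square\<close>)
qed

lemma holo_coframe_invariant:
  assumes f: "holo_on f S" and J4: "holo_on J4 S" and J5: "holo_on J5 S"
    and nz: "\<And>z. z \<in> S \<Longrightarrow> J4 z \<noteq> 0" "\<And>z. z \<in> S \<Longrightarrow> J5 z \<noteq> 0" "\<And>z. z \<in> S \<Longrightarrow> partial 4 J4 z \<noteq> 0"
  shows "holo_coframe (invariant_coframe f J4 J5) S"
proof -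
  have slope: "holo_on (slope f J4) S"
    unfolding slope_def[abs_def]
    by (intro holo_intros J4 holo_I3 holo_I1 f) (auto simp: nz intro: holo_on_open[OF f])
  note h = holo_intros holo_on_open[OF f] J4 J5 slope f holo_I1[OF f] holo_I2[OF f] holo_I3[OF f]
  have "holo_on (\<lambda>z. (coframe_matrix (J4 z) (J5 z) (slope f J4 z) (I1 f z) (I2 f z) (I3 f z) ** base_coframe f z) $ i $ j) S" for i j
    using exhaust_4[of i] exhaust_4[of j]
    by (auto simp: matrix_matrix_mult_def sum_4 coframe_matrix_def base_coframe_def nz intro!: h)
  then show ?thesis
    unfolding holo_coframe_def
    by (intro allI, rule holo_on_cong) (auto simp: invariant_coframe_eq nz)
qed

context point_transformation
begin

text \<open>The rows are the pullbacks of the base coframe of g, expressed in the base coframe of f.\<close>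

definition base_pullback :: "complex^4 \<Rightarrow> complex^4^4" where
  "base_pullback z = vector
     [vector [mu z, 0, 0, 0],
      vector [mu z * dlm z / lam z, mu z / lam z, 0, 0],
      vector [nu z * eps z, nu z * (2 * dlm z - dll z), nu z, 0],
      vector [partial 2 X z, 0, 0, lam z]]"

definition jet_jacobian :: "complex^4 \<Rightarrow> complex^4^4" where
  "jet_jacobian z = (\<chi> i j. partial j (\<lambda>w. jet w $ i) z)"

lemma jet_nth [simp]: "jet z $ 1 = X z" "jet z $ 2 = U z" "jet z $ 3 = P z" "jet z $ 4 = Q z"
  by (simp_all add: jet_def)

lemma base_coframe_pullback:
  assumes z: "z \<in> S"
  shows "base_coframe g (jet z) ** jet_jacobian z = base_pullback z ** base_coframe f z"
proof -
  have x: "partial 1 X z = lam z - z $ 3 * partial 2 X z"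
    using X_base[OF z] by (simp add: lam_def total_deriv_def)
  have u: "partial 1 U z = lam z * P z - z $ 3 * partial 2 U z"
    using U_base[OF z] D_jet(2)[OF z] by (simp add: total_deriv_def algebra_simps)
  have p: "partial 1 P z = lam z * Q z - z $ 3 * partial 2 P z - z $ 4 * partial 3 P z - f z * partial 4 P z"
    using D_jet(3)[OF z] by (simp add: total_deriv_def algebra_simps)
  have q: "partial 1 Q z = lam z * g (jet z) - z $ 3 * partial 2 Q z - z $ 4 * partial 3 Q z - f z * partial 4 Q z"
    using D_jet(4)[OF z] by (simp add: total_deriv_def algebra_simps)
  have U2: "partial 2 U z = mu z + P z * partial 2 X z"
    by (simp add: mu_def)
  show ?thesis
    using lam_nonzero[OF z] X_base[OF z] U_base[OF z]
    by (simp add: vec4_eq_iff matrix_matrix_mult_def sum_4 base_coframe_def jet_jacobian_def base_pullback_def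
        x u p q partial_P[OF z] partial_Q[OF z] U2 algebra_simps)
qed

text \<open>Roots J4 and J5 for f are obtained from roots K4 and K5 for g by the factors lam and \<open>mu / lam\<close>,
  whose cube and square are the weights of I4 and I5.\<close>

context
  fixes K4 K5 :: "complex^4 \<Rightarrow> complex"
  assumes K4: "holo_on K4 T" and K5: "holo_on K5 T"
    and K_nz: "\<And>w. w \<in> T \<Longrightarrow> K4 w \<noteq> 0" "\<And>w. w \<in> T \<Longrightarrow> K5 w \<noteq> 0" "\<And>w. w \<in> T \<Longrightarrow> partial 4 K4 w \<noteq> 0"
begin

definition J4 :: "complex^4 \<Rightarrow> complex" where "J4 z = lam z * K4 (jet z)"
definition J5 :: "complex^4 \<Rightarrow> complex" where "J5 z = mu z / lam z * K5 (jet z)"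

lemma jet_in_T: "z \<in> S \<Longrightarrow> jet z \<in> T" by (simp add: jet_def in_T)

lemma holo_J: "holo_on J4 S" "holo_on J5 S"
  unfolding J4_def[abs_def] J5_def[abs_def]
  by (intro holo_intros holo_lam holo_mu holo_pullback K4 K5; simp add: lam_nonzero)+

lemma J_nonzero: "z \<in> S \<Longrightarrow> J4 z \<noteq> 0" "z \<in> S \<Longrightarrow> J5 z \<noteq> 0"
  using lam_nonzero mu_nonzero K_nz jet_in_T by (auto simp: J4_def J5_def)

lemma partial_J4:
  assumes z: "z \<in> S"
  shows "partial 4 J4 z = mu z / lam z * partial 4 K4 (jet z)"
    and "partial 3 J4 z = partial 2 X z * K4 (jet z) + mu z * partial 3 K4 (jet z)
      + lam z * (nu z * (2 * dlm z - dll z) * partial 4 K4 (jet z))"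
  unfolding J4_def[abs_def] partial_mult[OF holo_lam holo_pullback[OF K4] z] partial_lam[OF z] pullback_fibre[OF K4 z]
  using lam_nonzero[OF z] by (simp_all add: nu_def field_simps power2_eq_square)

lemma partial_J4_nonzero: "z \<in> S \<Longrightarrow> partial 4 J4 z \<noteq> 0"
  using lam_nonzero mu_nonzero K_nz jet_in_T by (simp add: partial_J4)

text \<open>The inhomogeneous term dlm is exactly the one by which the pullback of \<open>\<omega>2\<close> fails to be a multiple
  of \<open>\<omega>2\<close>; for this reason \<open>J5 (\<omega>2 + r \<omega>1)\<close> is an invariant form.\<close>

lemma slope_transform:
  assumes z: "z \<in> S"
  shows "slope f J4 z = lam z * slope g K4 (jet z) + dlm z"
  using lam_nonzero[OF z] mu_nonzero[OF z] K_nz(3)[OF jet_in_T[OF z]]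
  unfolding slope_def partial_J4[OF z] I3_transform[OF z] I1_transform[OF z] J4_def
  by (simp add: nu_def field_simps power2_eq_square)

lemma invariant_coframe_pullback:
  assumes z: "z \<in> S"
  shows "invariant_coframe f J4 J5 z = invariant_coframe g K4 K5 (jet z) ** jet_jacobian z"
proof -
  note nz = lam_nonzero[OF z] mu_nonzero[OF z] K_nz[OF jet_in_T[OF z]]
  have "coframe_matrix (J4 z) (J5 z) (slope f J4 z) (I1 f z) (I2 f z) (I3 f z) =
    coframe_matrix (K4 (jet z)) (K5 (jet z)) (slope g K4 (jet z)) (I1 g (jet z)) (I2 g (jet z)) (I3 g (jet z)) **
    base_pullback z"
    unfolding slope_transform[OF z] I1_transform[OF z] I2_transform[OF z] I3_transform[OF z]
    using nz by (simp add: vec4_eq_iff matrix_matrix_mult_def sum_4 coframe_matrix_def J4_def J5_def nu_def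
      base_pullback_def field_simps power2_eq_square)
  then show ?thesis
    unfolding invariant_coframe_eq[where ?J4.0=J4 and ?J5.0=J5 and z=z, OF J_nonzero[OF z] partial_J4_nonzero[OF z]]
      invariant_coframe_eq[where ?J4.0=K4 and ?J5.0=K5 and z="jet z", OF nz(3-5)]
    by (simp add: matrix_mul_assoc[symmetric] base_coframe_pullback[OF z])
qed

lemma constant_structure_pullback:
  assumes a: "a \<in> S" and "constant_structure_functions (invariant_coframe g K4 K5) (jet a) \<tau>"
  shows "constant_structure_functions (invariant_coframe f J4 J5) a \<tau>"
proof (rule constant_structure_functions_pullback[of "\<lambda>k z. jet z $ k"])
  show "holo_on (\<lambda>z. jet z $ k) S" for k
    using exhaust_4[of k] X U holo_P holo_Q by auto
  show "holo_coframe (invariant_coframe g K4 K5) T"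
    by (intro holo_coframe_invariant g K4 K5 K_nz)
  show "(\<chi> k. jet w $ k) \<in> T" if "w \<in> S" for w
    using jet_in_T[OF that] by simp
  show "invariant_coframe f J4 J5 w = invariant_coframe g K4 K5 (\<chi> k. jet w $ k) ** (\<chi> i j. partial j (\<lambda>z. jet z $ i) w)"
    if "w \<in> S" for w
    using invariant_coframe_pullback[OF that] by (simp add: jet_jacobian_def)
qed (use assms in auto)

lemma roots_transform:
  assumes "\<And>w. w \<in> T \<Longrightarrow> K4 w ^ 3 = I4 g w" "\<And>w. w \<in> T \<Longrightarrow> - (K5 w)\<^sup>2 = I5 g w"
    "\<And>w. w \<in> T \<Longrightarrow> I6 g w = 0" and z: "z \<in> S"
  shows "J4 z ^ 3 = I4 f z" "- (J5 z)\<^sup>2 = I5 f z" "I6 f z = 0" "I4 f z \<noteq> 0" "I5 f z \<noteq> 0"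
    "partial 4 J4 z / J5 z = partial 4 K4 (jet z) / K5 (jet z)"
proof -
  show 1: "J4 z ^ 3 = I4 f z"
    using assms(1)[OF jet_in_T[OF z]] by (simp add: J4_def I4_transform[OF z] power_mult_distrib)
  show 2: "- (J5 z)\<^sup>2 = I5 f z"
  proof -
    have "- (J5 z)\<^sup>2 = (mu z / lam z)\<^sup>2 * - (K5 (jet z))\<^sup>2"
      by (simp add: J5_def power_mult_distrib power_divide)
    then show ?thesis
      using assms(2,3)[OF jet_in_T[OF z]] by (simp add: I5_transform[OF z])
  qed
  show "I6 f z = 0"
    using assms(3)[OF jet_in_T[OF z]] by (simp add: I6_transform[OF z])
  show "I4 f z \<noteq> 0" "I5 f z \<noteq> 0"
    unfolding 1[symmetric] 2[symmetric] using J_nonzero[OF z] by simp_all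
  show "partial 4 J4 z / J5 z = partial 4 K4 (jet z) / K5 (jet z)"
    using lam_nonzero[OF z] mu_nonzero[OF z] by (simp add: partial_J4[OF z] J5_def)
qed

end

end

section \<open>Point equivalence as a map of jets\<close>

lemma partial_base:
  assumes "holo_on \<phi> W" "base z \<in> W" "open S" "z \<in> S" "\<And>w. w \<in> S \<Longrightarrow> base w \<in> W"
  shows "partial 1 (\<lambda>z. \<phi> (base z)) z = partial 1 \<phi> (base z)"
    "partial 2 (\<lambda>z. \<phi> (base z)) z = partial 2 \<phi> (base z)"
    "partial 3 (\<lambda>z. \<phi> (base z)) z = 0" "partial 4 (\<lambda>z. \<phi> (base z)) z = 0"
    "holo_on (\<lambda>z. \<phi> (base z)) S"
proof -
  define c :: "2 \<Rightarrow> complex^4 \<Rightarrow> complex" where "c j z = (if j = 1 then z $ 1 else z $ 2)" for j z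
  have b: "base z = (\<chi> j. c j z)" for z
    by (simp add: base_def c_def vec_eq_iff forall_2)
  have hc: "holo_on (c j) S" for j
    unfolding c_def[abs_def] using assms(3) by (cases "j = 1") (auto intro: holo_intros)
  have pc: "partial i (c 1) z = (if i = 1 then 1 else 0)" "partial i (c 2) z = (if i = 2 then 1 else 0)" for i z
    by (simp_all add: c_def[abs_def])
  show "holo_on (\<lambda>z. \<phi> (base z)) S"
    unfolding b by (rule holo_chain[OF hc assms(1)]) (use assms(5) b in auto)
  show "partial 1 (\<lambda>z. \<phi> (base z)) z = partial 1 \<phi> (base z)"
    "partial 2 (\<lambda>z. \<phi> (base z)) z = partial 2 \<phi> (base z)"
    "partial 3 (\<lambda>z. \<phi> (base z)) z = 0" "partial 4 (\<lambda>z. \<phi> (base z)) z = 0"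
    using assms(2) unfolding b by (simp_all add: partial_chain[OF hc assms(1,4)] sum_2 pc)
qed

lemma open_base_vimage: "open W \<Longrightarrow> open {z. base z \<in> W}"
proof -
  assume W: "open W"
  have "continuous_on UNIV base"
    unfolding base_def[abs_def] vector_def
  proof (rule continuous_on_vec_lambda)
    fix i :: 2
    show "continuous_on UNIV (\<lambda>z::complex^4. foldr (\<lambda>x f n. (f (n + 1))(n := x)) [z $ 1, z $ 2] (\<lambda>n x. 0) 1 i)"
      using exhaust_2[of i] by (auto intro!: continuous_intros)
  qed
  from open_vimage[OF W this] show ?thesis by (simp add: vimage_def)
qed

text \<open>The plane is embedded as the slice on which p and q have their values at a. F is constant along
  the segment from a jet to the slice, and this segment stays in the ball, so F is determined by its
  restriction to the slice.\<close>

lemma descends_to_base: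
  assumes F: "holo_on F (ball a r)" "r > 0"
    and v: "\<And>z. z \<in> ball a r \<Longrightarrow> partial 3 F z = 0" "\<And>z. z \<in> ball a r \<Longrightarrow> partial 4 F z = 0"
  obtains \<phi> W where "holo_on \<phi> W" "base a \<in> W" "\<And>z. z \<in> ball a r \<Longrightarrow> base z \<in> W"
    "\<And>z. z \<in> ball a r \<Longrightarrow> \<phi> (base z) = F z"
proof -
  define sec where "sec w = (vector [w $ 1, w $ 2, a $ 3, a $ 4] :: complex^4)" for w :: "complex^2"
  define c where "c j w = sec w $ j" for j w
  have hc: "holo_on (c j) UNIV" for j
    unfolding c_def sec_def using exhaust_4[of j] by (auto intro!: holo_nth holo_const)
  define W where "W = {w. sec w \<in> ball a r}"
  have sec_c: "sec w = (\<chi> j. c j w)" for w by (simp add: c_def)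
  have "continuous_on UNIV sec"
    unfolding sec_c using holo_on_imp_continuous_on[OF hc] by (intro continuous_on_vec_lambda)
  from open_vimage[OF open_ball this] have W: "open W"
    by (simp add: W_def vimage_def)
  have "holo_on (\<lambda>w. F (sec w)) W"
    unfolding sec_c
    by (rule holo_chain[OF holo_on_subset[OF hc W] F(1)]) (auto simp: W_def sec_c)
  moreover have "sec (base a) = a"
    by (simp add: sec_def base_def vector4_eta)
  moreover have norm_le: "norm (s - a) \<le> norm (z - a)"
    if "\<And>j. norm (s $ j - a $ j) \<le> norm (z $ j - a $ j)" for s z
    using that unfolding norm_vec_def by (intro L2_set_mono) auto
  have seg: "vector [z $ 1, z $ 2, a $ 3 + t *\<^sub>R (z $ 3 - a $ 3), a $ 4 + t *\<^sub>R (z $ 4 - a $ 4)] \<in> ball a r" (is "?s \<in> _")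
    if "z \<in> ball a r" "t \<in> {0..1}" for z t
  proof -
    have "norm (?s - a) \<le> norm (z - a)"
    proof (rule norm_le)
      fix j :: 4
      show "norm (?s $ j - a $ j) \<le> norm (z $ j - a $ j)"
        using exhaust_4[of j] that(2) by (auto intro!: mult_left_le_one_le)
    qed
    then show ?thesis using that(1) by (simp add: dist_norm norm_minus_commute)
  qed
  moreover have "F (sec (base z)) = F z" if z: "z \<in> ball a r" for z
  proof -
    define s where "s t = (vector [z $ 1, z $ 2, a $ 3 + t *\<^sub>R (z $ 3 - a $ 3), a $ 4 + t *\<^sub>R (z $ 4 - a $ 4)] :: complex^4)" for t
    have s: "s t = s 0 + t *\<^sub>R vector [0, 0, z $ 3 - a $ 3, z $ 4 - a $ 4]" for t
      by (simp add: s_def vec4_eq_iff)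
    have ds: "(s has_derivative (\<lambda>h. h *\<^sub>R vector [0, 0, z $ 3 - a $ 3, z $ 4 - a $ 4])) (at t)" for t
      by (subst s[abs_def]) (auto intro!: derivative_eq_intros)
    have "((\<lambda>t. F (s t)) has_vector_derivative 0) (at t within {0..1})" if t: "t \<in> {0..1}" for t
    proof -
      have st: "s t \<in> ball a r" using seg[OF z t] by (simp add: s_def)
      from has_derivative_compose[OF ds holo_has_derivative[OF F(1) st]]
      show ?thesis
        by (simp add: has_vector_derivative_def sum_4 v[OF st] has_derivative_at_withinI)
    qed
    then have "F (s 0) = F (s 1)"
    proof (rule has_vector_derivative_zero_constant[OF convex_real_interval(5)])
      fix c assume h: "\<And>t. t \<in> {0..1} \<Longrightarrow> F (s t) = c"
      show "F (s 0) = F (s 1)" using h[of 0] h[of 1] by simp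
    qed
    moreover have "s 0 = sec (base z)" "s 1 = z"
      by (simp_all add: s_def sec_def base_def vector4_eta)
    ultimately show ?thesis by simp
  qed
  moreover have "sec (base z) \<in> ball a r" if "z \<in> ball a r" for z
    using seg[OF that, of 0] by (simp add: sec_def base_def)
  ultimately show thesis
    using F(2) by (intro that[of "\<lambda>w. F (sec w)" W]) (auto simp: W_def simp del: mem_ball)
qed

text \<open>A transformation may be given by functions of the jet: X and U descend to the plane because their
  fibre derivatives vanish, and P and Q are recognized by the equations that they satisfy.\<close>

lemma point_equivalentI:
  assumes r: "r > 0" and X: "holo_on X (ball a r)" and U: "holo_on U (ball a r)"
    and v: "\<And>z. z \<in> ball a r \<Longrightarrow> partial 3 X z = 0" "\<And>z. z \<in> ball a r \<Longrightarrow> partial 4 X z = 0"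
      "\<And>z. z \<in> ball a r \<Longrightarrow> partial 3 U z = 0" "\<And>z. z \<in> ball a r \<Longrightarrow> partial 4 U z = 0"
    and jac: "partial 1 X a * partial 2 U a - partial 2 X a * partial 1 U a \<noteq> 0"
    and D: "\<And>z. z \<in> ball a r \<Longrightarrow> total_deriv f X z \<noteq> 0"
      "\<And>z. z \<in> ball a r \<Longrightarrow> total_deriv f U z = P z * total_deriv f X z"
      "\<And>z. z \<in> ball a r \<Longrightarrow> total_deriv f P z = Q z * total_deriv f X z"
      "\<And>z. z \<in> ball a r \<Longrightarrow> total_deriv f Q z = g (vector [X z, U z, P z, Q z]) * total_deriv f X z"
  shows "point_equivalent f a g (vector [X a, U a, P a, Q a])"
proof -
  have a: "a \<in> ball a r" using r by simp
  obtain \<phi> W where \<phi>: "holo_on \<phi> W" "base a \<in> W" "\<And>z. z \<in> ball a r \<Longrightarrow> base z \<in> W"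
    "\<And>z. z \<in> ball a r \<Longrightarrow> \<phi> (base z) = X z"
    using descends_to_base[OF X r v(1,2)] by blast
  obtain \<psi> V where \<psi>: "holo_on \<psi> V" "base a \<in> V" "\<And>z. z \<in> ball a r \<Longrightarrow> base z \<in> V"
    "\<And>z. z \<in> ball a r \<Longrightarrow> \<psi> (base z) = U z"
    using descends_to_base[OF U r v(3,4)] by blast
  note cong = total_deriv_cong[OF open_ball, of a r]
  define X' where "X' = (\<lambda>z. \<phi> (base z))"
  define U' where "U' = (\<lambda>z. \<psi> (base z))"
  define P' where "P' = (\<lambda>z. total_deriv f U' z / total_deriv f X' z)"
  define Q' where "Q' = (\<lambda>z. total_deriv f P' z / total_deriv f X' z)"
  have X': "X' z = X z" and U': "U' z = U z" if "z \<in> ball a r" for z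
    using \<phi>(4) \<psi>(4) that by (simp_all add: X'_def U'_def del: mem_ball)
  have DX: "total_deriv f X' z = total_deriv f X z" if "z \<in> ball a r" for z
    by (rule cong) (use X' that in auto)
  have DU: "total_deriv f U' z = total_deriv f U z" if "z \<in> ball a r" for z
    by (rule cong) (use U' that in auto)
  have P: "P' z = P z" if "z \<in> ball a r" for z
    using D(1,2)[OF that] by (simp add: P'_def DX[OF that] DU[OF that])
  have Q: "Q' z = Q z" if "z \<in> ball a r" for z
    using D(1,3)[OF that] cong[OF P that] by (simp add: Q'_def DX[OF that])
  have R: "total_deriv f Q' z / total_deriv f X' z = g (vector [X z, U z, P z, Q z])" if "z \<in> ball a r" for z
    using D(1,4)[OF that] cong[OF Q that] by (simp add: DX[OF that])
  note pb = partial_base[OF \<phi>(1,2) open_ball a \<phi>(3)] partial_base[OF \<psi>(1,2) open_ball a \<psi>(3)]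
  have "partial i X a = partial i (\<lambda>z. \<phi> (base z)) a" "partial i U a = partial i (\<lambda>z. \<psi> (base z)) a" for i
    using partial_cong[OF open_ball _ a] \<phi>(4) \<psi>(4) by metis+
  then have "partial 1 \<phi> (base a) * partial 2 \<psi> (base a) - partial 2 \<phi> (base a) * partial 1 \<psi> (base a) \<noteq> 0"
    using jac pb by simp
  moreover have "holomorphic_at \<phi> (base a)" "holomorphic_at \<psi> (base a)"
    using \<phi> \<psi> holomorphic_at_iff by blast+
  moreover have "\<forall>\<^sub>F z in nhds a. z \<in> ball a r"
    using r by (intro eventually_nhds_in_open) auto
  then have "\<forall>\<^sub>F z in nhds a. total_deriv f Q' z / total_deriv f X' z = g (vector [X' z, U' z, P' z, Q' z])"
    by eventually_elim (simp only: R Q P X' U')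
  moreover have "total_deriv f X' a \<noteq> 0"
    using D(1)[OF a] by (simp add: DX[OF a])
  moreover have "vector [X' a, U' a, P' a, Q' a] = (vector [X a, U a, P a, Q a] :: complex^4)"
    by (simp only: Q[OF a] P[OF a] X'[OF a] U'[OF a])
  ultimately show ?thesis
    unfolding point_equivalent_def Let_def Q'_def P'_def X'_def U'_def
    by (intro exI[of _ \<phi>] exI[of _ \<psi>] conjI)
qed

text \<open>On a small ball all quantities that are nonzero at the base jet stay nonzero and the transformed
  jets stay in T.\<close>

lemma point_equivalentE:
  assumes f: "holomorphic_at f a" and pe: "point_equivalent f a g b"
    and g: "holo_on g T" and b: "b \<in> T"
  obtains X U P Q r where "r > 0" "point_transformation f g X U P Q (ball a r) T"
    "vector [X a, U a, P a, Q a] = b"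
proof -
  obtain S0 where S0: "a \<in> S0" "holo_on f S0"
    using f holomorphic_at_iff by blast
  obtain \<phi> \<psi> where h: "holomorphic_at \<phi> (base a)" "holomorphic_at \<psi> (base a)"
    and jac: "partial 1 \<phi> (base a) * partial 2 \<psi> (base a) - partial 2 \<phi> (base a) * partial 1 \<psi> (base a) \<noteq> 0"
    and *: "let X = (\<lambda>z. \<phi> (base z)); U = (\<lambda>z. \<psi> (base z));
             P = (\<lambda>z. total_deriv f U z / total_deriv f X z);
             Q = (\<lambda>z. total_deriv f P z / total_deriv f X z);
             R = (\<lambda>z. total_deriv f Q z / total_deriv f X z)
         in total_deriv f X a \<noteq> 0 \<and> vector [X a, U a, P a, Q a] = b \<and>
            (\<forall>\<^sub>F z in nhds a. R z = g (vector [X z, U z, P z, Q z]))"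
    using pe unfolding point_equivalent_def by blast
  define X where "X = (\<lambda>z. \<phi> (base z))"
  define U where "U = (\<lambda>z. \<psi> (base z))"
  define P where "P = (\<lambda>z. total_deriv f U z / total_deriv f X z)"
  define Q where "Q = (\<lambda>z. total_deriv f P z / total_deriv f X z)"
  have D: "total_deriv f X a \<noteq> 0" and b_eq: "vector [X a, U a, P a, Q a] = b"
    and R: "\<forall>\<^sub>F z in nhds a. total_deriv f Q z / total_deriv f X z = g (vector [X z, U z, P z, Q z])"
    using * unfolding Let_def X_def U_def P_def Q_def by blast+
  obtain W V where W: "holo_on \<phi> W" "base a \<in> W" and V: "holo_on \<psi> V" "base a \<in> V"
    using h holomorphic_at_iff by blast
  define S1 where "S1 = S0 \<inter> {z. base z \<in> W \<inter> V}"
  have S1: "open S1" "a \<in> S1"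
    using open_base_vimage[of "W \<inter> V"] W V S0 by (auto simp: S1_def holo_on_def)
  have bW: "base z \<in> W" and bV: "base z \<in> V" if "z \<in> S1" for z
    using that by (auto simp: S1_def)
  have f1: "holo_on f S1"
    by (rule holo_on_subset[OF S0(2) S1(1)]) (auto simp: S1_def)
  have X: "holo_on X S1" "\<And>z. z \<in> S1 \<Longrightarrow> partial 1 X z = partial 1 \<phi> (base z)"
    "\<And>z. z \<in> S1 \<Longrightarrow> partial 2 X z = partial 2 \<phi> (base z)"
    "\<And>z. z \<in> S1 \<Longrightarrow> partial 3 X z = 0" "\<And>z. z \<in> S1 \<Longrightarrow> partial 4 X z = 0"
    using partial_base(5)[OF W(1) bW[OF S1(2)] S1(1,2) bW] partial_base(1-4)[OF W(1) bW S1(1) _ bW]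
    by (simp_all add: X_def)
  have U: "holo_on U S1" "\<And>z. z \<in> S1 \<Longrightarrow> partial 1 U z = partial 1 \<psi> (base z)"
    "\<And>z. z \<in> S1 \<Longrightarrow> partial 2 U z = partial 2 \<psi> (base z)"
    "\<And>z. z \<in> S1 \<Longrightarrow> partial 3 U z = 0" "\<And>z. z \<in> S1 \<Longrightarrow> partial 4 U z = 0"
    using partial_base(5)[OF V(1) bV[OF S1(2)] S1(1,2) bV] partial_base(1-4)[OF V(1) bV S1(1) _ bV]
    by (simp_all add: U_def)
  have DX: "holo_on (total_deriv f X) S1" by (rule holo_total_deriv[OF f1 X(1)])
  define J where "J z = partial 1 X z * partial 2 U z - partial 2 X z * partial 1 U z" for z
  have J: "holo_on J S1" unfolding J_def[abs_def] by (intro holo_intros X U)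
  define S2 where "S2 = {z \<in> S1. total_deriv f X z \<noteq> 0 \<and> J z \<noteq> 0}"
  have nz_open: "open {z \<in> S1. F z \<noteq> 0}" if "holo_on F S1" for F :: "complex^4 \<Rightarrow> complex"
    using continuous_open_preimage[OF holo_on_imp_continuous_on[OF that] S1(1), of "- {0}"]
    by (simp add: open_Compl Int_def vimage_def)
  have "S2 = {z \<in> S1. total_deriv f X z \<noteq> 0} \<inter> {z \<in> S1. J z \<noteq> 0}"
    by (auto simp: S2_def)
  then have S2: "open S2" "a \<in> S2"
    using nz_open[OF DX] nz_open[OF J] D jac S1(2) X U by (auto simp: S2_def J_def)
  have sub2: "S2 \<subseteq> S1" by (auto simp: S2_def)
  note h2 = holo_on_subset[OF _ S2(1) sub2]
  have P: "holo_on P S2" unfolding P_def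
    by (intro holo_intros holo_total_deriv h2[OF f1] h2[OF X(1)] h2[OF U(1)]) (simp add: S2_def)
  have Q: "holo_on Q S2" unfolding Q_def
    by (intro holo_intros holo_total_deriv h2[OF f1] h2[OF X(1)] P) (simp add: S2_def)
  have "continuous_on S2 (\<lambda>z. vector [X z, U z, P z, Q z] :: complex^4)"
  proof -
    have "(\<lambda>z. vector [X z, U z, P z, Q z] :: complex^4) = (\<lambda>z. \<chi> j. if j = 1 then X z else if j = 2 then U z else if j = 3 then P z else Q z)"
      by (auto simp: vec4_eq_iff)
    moreover have "continuous_on S2 (\<lambda>z. if j = 1 then X z else if j = 2 then U z else if j = 3 then P z else Q z)" for j :: 4
      using exhaust_4[of j] h2[OF X(1), THEN holo_on_imp_continuous_on] h2[OF U(1), THEN holo_on_imp_continuous_on]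
        P[THEN holo_on_imp_continuous_on] Q[THEN holo_on_imp_continuous_on] by auto
    ultimately show ?thesis
      by (simp only:) (rule continuous_on_vec_lambda)
  qed
  then have S3: "open (S2 \<inter> (\<lambda>z. vector [X z, U z, P z, Q z]) -` T)"
    by (rule continuous_open_preimage[OF _ S2(1) holo_on_open[OF g]])
  obtain N where N: "open N" "a \<in> N"
    "\<And>z. z \<in> N \<Longrightarrow> total_deriv f Q z / total_deriv f X z = g (vector [X z, U z, P z, Q z])"
    using R unfolding eventually_nhds by blast
  have "open (N \<inter> (S2 \<inter> (\<lambda>z. vector [X z, U z, P z, Q z]) -` T))" "a \<in> N \<inter> (S2 \<inter> (\<lambda>z. vector [X z, U z, P z, Q z]) -` T)"
    using N S3 S2 b b_eq by auto
  then obtain r where r: "r > 0" "ball a r \<subseteq> N \<inter> (S2 \<inter> (\<lambda>z. vector [X z, U z, P z, Q z]) -` T)"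
    using open_contains_ball by blast
  have sub: "z \<in> N" "z \<in> S2" "z \<in> S1" "vector [X z, U z, P z, Q z] \<in> T" if "z \<in> ball a r" for z
    using r that sub2 by auto
  have "ball a r \<subseteq> S1" using sub by blast
  note h3 = holo_on_subset[OF _ open_ball this]
  have "point_transformation f g X U P Q (ball a r) T"
    by unfold_locales
       (use sub X(2-) U(2-) N(3) h3[OF f1] h3[OF X(1)] h3[OF U(1)] g in
         \<open>auto simp: S2_def J_def P_def Q_def simp del: mem_ball\<close>)
  then show thesis using that r b_eq by blast
qed

section \<open>The invariants of the canonical forms\<close>

text \<open>All relative invariants of both canonical forms are monomials in q and 1/p, so closed formulas for
  the derivatives of these monomials suffice to compute them.\<close>

definition qp :: "complex \<Rightarrow> nat \<Rightarrow> nat \<Rightarrow> complex^4 \<Rightarrow> complex" where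
  "qp c m n z = c * (z $ 4) ^ m / (z $ 3) ^ n"

lemma holo_qp:
  assumes "open S" "n = 0 \<or> (\<forall>z\<in>S. z $ 3 \<noteq> 0)"
  shows "holo_on (qp c m n) S"
proof (cases "n = 0")
  case True
  then have "qp c m n = (\<lambda>z. c * (z $ 4) ^ m)" by (auto simp: qp_def)
  then show ?thesis using assms(1) by (auto intro!: holo_mult holo_power holo_nth holo_const)
next
  case False
  then show ?thesis
    unfolding qp_def[abs_def] using assms
    by (intro holo_divide holo_mult holo_power holo_nth holo_const) auto
qed

lemma partial_qp:
  assumes "n = 0 \<or> z $ 3 \<noteq> 0"
  shows "partial 1 (qp c m n) z = 0" "partial 2 (qp c m n) z = 0"
    "partial 3 (qp c m n) z = - (c * of_nat n * (z $ 4) ^ m / (z $ 3) ^ Suc n)"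
    "partial 4 (qp c m n) z = c * of_nat m * (z $ 4) ^ (m - 1) / (z $ 3) ^ n"
proof -
  have "partial i (qp c m n) z = c * (of_nat m * (z $ 4) ^ (m - 1) * (if i = 4 then 1 else 0)) / (z $ 3) ^ n
     - c * of_nat n * (z $ 4) ^ m * (if i = 3 then 1 else 0) / (z $ 3) ^ Suc n" for i
  proof (cases "n = 0")
    case True
    have U: "open (UNIV :: (complex^4) set)" by simp
    have "qp c m n = (\<lambda>z. c * (z $ 4) ^ m)" using True by (auto simp: qp_def)
    then show ?thesis
      using True by (simp add: partial_cmult[OF holo_power[OF holo_nth[OF U]]] partial_power[OF holo_nth[OF U]])
  next
    case False
    with assms have z: "z $ 3 \<noteq> 0" by simp
    define S where "S = {z :: complex^4. z $ 3 \<noteq> 0}"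
    have S: "open S"
      unfolding S_def by (intro open_Collect_neq continuous_intros)
    have zS: "z \<in> S" using z by (simp add: S_def)
    have h: "holo_on (\<lambda>z. c * (z $ 4) ^ m) S" "holo_on (\<lambda>z. (z $ 3) ^ n) S"
      by (intro holo_mult holo_power holo_nth holo_const S)+
    have "partial i (qp c m n) z = (c * (of_nat m * (z $ 4) ^ (m - 1) * (if i = 4 then 1 else 0)) * (z $ 3) ^ n
        - c * (z $ 4) ^ m * (of_nat n * (z $ 3) ^ (n - 1) * (if i = 3 then 1 else 0))) / ((z $ 3) ^ n)\<^sup>2"
      unfolding qp_def[abs_def]
      by (subst partial_divide[OF h _ zS])
         (use zS in \<open>auto simp: S_def partial_cmult[OF holo_power[OF holo_nth[OF S]]] partial_power[OF holo_nth[OF S]]\<close>)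
    also have "(z $ 3) ^ n = z $ 3 * (z $ 3) ^ (n - 1)"
      using False by (cases n) auto
    also have "(A * (x * u) - B * (k * u * d)) / (x * u)\<^sup>2 = A / (x * u) - B * k * d / (x * (x * u))"
      if "x \<noteq> 0" "u \<noteq> 0" for A B k d x u :: complex
      using that by (simp add: field_simps power2_eq_square)
    then have "(c * (of_nat m * (z $ 4) ^ (m - 1) * (if i = 4 then 1 else 0)) * (z $ 3 * (z $ 3) ^ (n - 1))
        - c * (z $ 4) ^ m * (of_nat n * (z $ 3) ^ (n - 1) * (if i = 3 then 1 else 0))) / (z $ 3 * (z $ 3) ^ (n - 1))\<^sup>2 =
        c * (of_nat m * (z $ 4) ^ (m - 1) * (if i = 4 then 1 else 0)) / (z $ 3 * (z $ 3) ^ (n - 1))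
        - c * (z $ 4) ^ m * of_nat n * (if i = 3 then 1 else 0) / (z $ 3 * (z $ 3 * (z $ 3) ^ (n - 1)))"
      using z by simp
    also have "z $ 3 * (z $ 3) ^ (n - 1) = (z $ 3) ^ n"
      using False by (cases n) auto
    finally show ?thesis by (simp add: mult_ac)
  qed
  then show "partial 1 (qp c m n) z = 0" "partial 2 (qp c m n) z = 0"
    "partial 3 (qp c m n) z = - (c * of_nat n * (z $ 4) ^ m / (z $ 3) ^ Suc n)"
    "partial 4 (qp c m n) z = c * of_nat m * (z $ 4) ^ (m - 1) / (z $ 3) ^ n"
    by simp_all
qed

definition p_nonzero :: "(complex^4) set" where "p_nonzero = {z. z $ 3 \<noteq> 0}"

lemma open_p_nonzero: "open p_nonzero"
  unfolding p_nonzero_def by (intro open_Collect_neq continuous_intros)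

lemma total_deriv_qp:
  assumes "n = 0 \<or> z $ 3 \<noteq> 0"
  shows "total_deriv f (qp c m n) z = - (z $ 4) * (c * of_nat n * (z $ 4) ^ m / (z $ 3) ^ Suc n)
    + f z * (c * of_nat m * (z $ 4) ^ (m - 1) / (z $ 3) ^ n)"
  unfolding total_deriv_def partial_qp[OF assms] by simp

lemma canonical_i_qp: "canonical_i \<alpha> = qp \<alpha> 2 1"
  by (auto simp: canonical_i_def qp_def)

lemma canonical_ii_qp: "canonical_ii = qp 1 2 0"
  by (auto simp: canonical_ii_def qp_def)

lemma I1_canonical_i: "z \<in> p_nonzero \<Longrightarrow> I1 (canonical_i \<alpha>) z = qp (- 2 * \<alpha>) 1 1 z"
  by (simp add: I1_def canonical_i_qp p_nonzero_def partial_qp) (simp add: qp_def)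

lemma I2_canonical_i:
  assumes "z \<in> p_nonzero"
  shows "I2 (canonical_i \<alpha>) z = qp (- (\<alpha> * (2 * \<alpha> - 3) / 9)) 2 2 z"
  using assms total_deriv_cong[OF open_p_nonzero I1_canonical_i assms, where f="canonical_i \<alpha>"]
    I1_canonical_i[OF assms]
  by (simp add: I2_def canonical_i_qp p_nonzero_def partial_qp total_deriv_qp)
     (simp add: qp_def field_simps power2_eq_square)

lemma I3_canonical_i:
  assumes "z \<in> p_nonzero"
  shows "I3 (canonical_i \<alpha>) z = qp (\<alpha> / 3) 0 1 z"
  using assms partial_cong[OF open_p_nonzero I1_canonical_i assms, where i=4]
  by (simp add: I3_def p_nonzero_def partial_qp) (simp add: qp_def)

lemma I4_canonical_i:
  assumes "z \<in> p_nonzero"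
  shows "I4 (canonical_i \<alpha>) z = qp ((2 * \<alpha>^3 - 9 * \<alpha>\<^sup>2 + 9 * \<alpha>) / 27) 3 3 z"
  using assms total_deriv_cong[OF open_p_nonzero I2_canonical_i assms, where f="canonical_i \<alpha>"]
    I1_canonical_i[OF assms] I2_canonical_i[OF assms]
  by (simp add: I4_def canonical_i_qp p_nonzero_def partial_qp total_deriv_qp)
     (simp add: qp_def field_simps power2_eq_square power3_eq_cube)

lemma I5_I6_canonical_i:
  assumes "z \<in> p_nonzero"
  shows "I5 (canonical_i \<alpha>) z = qp (- ((\<alpha>\<^sup>2 - 3 * \<alpha>) / 9)) 0 2 z" "I6 (canonical_i \<alpha>) z = 0"
  using assms partial_cong[OF open_p_nonzero I3_canonical_i assms, where i=3]
    partial_cong[OF open_p_nonzero I3_canonical_i assms, where i=4] I3_canonical_i[OF assms]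
  by (simp_all add: I5_def I6_def p_nonzero_def partial_qp)
     (simp_all add: qp_def field_simps power2_eq_square)

lemmas invariants_canonical_i =
  I1_canonical_i I2_canonical_i I3_canonical_i I4_canonical_i I5_I6_canonical_i

lemma invariants_canonical_ii:
  shows "I1 canonical_ii = qp (- 2) 1 0"
    and "I2 canonical_ii = qp (- (2 / 9)) 2 0"
    and "I3 canonical_ii = qp (1 / 3) 0 0"
    and "I4 canonical_ii = qp (2 / 27) 3 0"
    and "I5 canonical_ii = qp (- (1 / 9)) 0 0"
    and "I6 canonical_ii = (\<lambda>z. 0)"
proof -
  show 1: "I1 canonical_ii = qp (- 2) 1 0"
    by (simp add: fun_eq_iff I1_def canonical_ii_qp partial_qp) (simp add: qp_def)
  show 2: "I2 canonical_ii = qp (- (2 / 9)) 2 0"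
    by (simp add: fun_eq_iff I2_def 1) (simp add: canonical_ii_qp partial_qp total_deriv_qp, simp add: qp_def field_simps power2_eq_square)
  show 3: "I3 canonical_ii = qp (1 / 3) 0 0"
    by (simp add: fun_eq_iff I3_def 1 partial_qp) (simp add: qp_def)
  show "I4 canonical_ii = qp (2 / 27) 3 0"
    by (simp add: fun_eq_iff I4_def 1 2) (simp add: canonical_ii_qp partial_qp total_deriv_qp, simp add: qp_def field_simps power2_eq_square power3_eq_cube)
  show "I5 canonical_ii = qp (- (1 / 9)) 0 0"
    by (simp add: fun_eq_iff I5_def 3 partial_qp) (simp add: qp_def power2_eq_square)
  show "I6 canonical_ii = (\<lambda>z. 0)"
    by (simp add: fun_eq_iff I6_def 3 partial_qp)
qed

text \<open>The quotient F/G has a constant power, hence vanishing derivatives, so it is a constant root of c.\<close>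

lemma root_of_power:
  assumes F: "holo_on F (ball a r)" and G: "holo_on G (ball a r)" and r: "r > 0" and n: "n > 0" and c: "c \<noteq> 0"
    and nz: "\<And>z. z \<in> ball a r \<Longrightarrow> G z \<noteq> 0" and eq: "\<And>z. z \<in> ball a r \<Longrightarrow> F z ^ n = c * G z ^ n"
  obtains k where "k ^ n = c" "\<And>z. z \<in> ball a r \<Longrightarrow> F z = k * G z"
proof -
  define H where "H = (\<lambda>z. F z / G z)"
  have H: "holo_on H (ball a r)"
    unfolding H_def by (rule holo_divide[OF F G nz])
  have Hn: "H z ^ n = c" if "z \<in> ball a r" for z
    using eq[OF that] nz[OF that] by (simp add: H_def power_divide)
  have "partial i H z = 0" if z: "z \<in> ball a r" for z i
  proof -
    have "partial i (\<lambda>z. H z ^ n) z = 0"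
      using partial_cong[OF open_ball Hn z] by simp
    moreover have "H z \<noteq> 0" using Hn[OF z] c n by auto
    ultimately show ?thesis
      using n by (simp add: partial_power[OF H z])
  qed
  then have "H z = H a" if "z \<in> ball a r" for z
    using constant_if_partials_vanish[OF H _ that] by blast
  then have "F z = H a * G z" if "z \<in> ball a r" for z
    using that nz[OF that] by (metis H_def nonzero_eq_divide_eq)
  then show thesis
    using that[of "H a"] Hn[of a] r by simp
qed

section \<open>Monomial frames of the canonical forms\<close>

definition wedge_mat :: "complex^4 \<Rightarrow> complex^4 \<Rightarrow> complex^4^4" where
  "wedge_mat v w = (\<chi> j k. v $ j * w $ k - v $ k * w $ j)"

lemma wedge_mat_antisym: "transpose (wedge_mat v w) = - wedge_mat v w"
  by (simp add: wedge_mat_def vec_eq_iff transpose_def)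

lemma transpose_zero_diff:
  "transpose (0 :: complex^4^4) = - 0" "transpose (A - B) = transpose A - transpose (B :: complex^4^4)"
  by (simp_all add: vec_eq_iff transpose_def)

lemma congruence_zero: "transpose (A :: complex^4^4) ** 0 ** A = 0"
  by (simp add: vec_eq_iff congruence_nth)

lemma congruence_diff:
  fixes A :: "complex^4^4"
  shows "(transpose A ** (B - C) ** A) $ r $ s = (transpose A ** B ** A) $ r $ s - (transpose A ** C ** A) $ r $ s"
  by (simp add: congruence_nth sum_4 algebra_simps)

lemma wedge_mat_congruence:
  fixes A :: "complex^4^4"
  shows
  "(transpose A ** wedge_mat v w ** A) $ r $ s =
    (v v* A) $ r * (w v* A) $ s - (v v* A) $ s * (w v* A) $ r"
  by (simp add: congruence_nth wedge_mat_def vector_matrix_mult_def sum_4 algebra_simps)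

text \<open>The rows \<open>(q/p^2) du\<close>, \<open>d log p\<close>, \<open>d log q\<close>, \<open>(q/p) dx\<close> are invariant under independent affine
  changes of x and u, which are the symmetries of form (i). Therefore the invariant coframe of form (i)
  is a constant combination of them.\<close>

definition frame_i :: "complex^4 \<Rightarrow> complex^4^4" where
  "frame_i z = vector [vector [0, qp 1 1 2 z, 0, 0], vector [0, 0, qp 1 0 1 z, 0],
     vector [0, 0, 0, 1 / z $ 4], vector [qp 1 1 1 z, 0, 0, 0]]"

definition structure_i :: "4 \<Rightarrow> complex^4^4" where
  "structure_i i = (if i = 1 then wedge_mat (vector [0, -2, 1, 0]) (vector [1, 0, 0, 0])
     else if i = 4 then wedge_mat (vector [0, -1, 1, 0]) (vector [0, 0, 0, 1]) else 0)"

lemma structure_i_antisym: "transpose (structure_i i) = - structure_i i"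
  by (simp add: structure_i_def wedge_mat_antisym transpose_zero_diff)

definition generic_set_i :: "(complex^4) set" where "generic_set_i = {z. z $ 3 \<noteq> 0 \<and> z $ 4 \<noteq> 0}"

lemma open_generic_set_i: "open generic_set_i"
  unfolding generic_set_i_def by (intro open_Collect_conj open_Collect_neq continuous_intros)

lemma partial_inverse_q:
  fixes z :: "complex^4"
  assumes "z $ 4 \<noteq> 0"
  shows "partial i (\<lambda>z. 1 / z $ 4) z = (if i = 4 then - 1 / (z $ 4)\<^sup>2 else 0)"
proof -
  have S: "open {z :: complex^4. z $ 4 \<noteq> 0}"
    by (intro open_Collect_neq continuous_intros)
  show ?thesis
    by (subst partial_divide[OF holo_const[OF S] holo_nth[OF S]]) (use assms in auto)
qed

lemma holo_inverse_q: "open (S :: (complex^4) set) \<Longrightarrow> (\<And>z. z \<in> S \<Longrightarrow> z $ 4 \<noteq> 0) \<Longrightarrow> holo_on (\<lambda>z. 1 / z $ 4) S"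
  by (intro holo_divide holo_const holo_nth)

lemma holo_frame_i:
  assumes "open S" "S \<subseteq> generic_set_i"
  shows "holo_coframe frame_i S"
  unfolding holo_coframe_def
proof (intro allI)
  fix i j :: 4
  have "z $ 3 \<noteq> 0" "z $ 4 \<noteq> 0" if "z \<in> S" for z using assms that by (auto simp: generic_set_i_def)
  then show "holo_on (\<lambda>z. frame_i z $ i $ j) S"
    using exhaust_4[of i] exhaust_4[of j] assms(1)
    by (auto simp: frame_i_def intro!: holo_const holo_inverse_q holo_qp)
qed

lemma frame_i_structure:
  assumes "z \<in> generic_set_i"
  shows "structure_equations frame_i structure_i z"
proof -
  have "form_d (\<lambda>w. frame_i w $ i) z $ r $ s = (transpose (frame_i z) ** structure_i i ** frame_i z) $ r $ s" for i r s
    using exhaust_4[of i] exhaust_4[of r] exhaust_4[of s] assms[unfolded generic_set_i_def]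
    by (elim disjE; simp add: congruence_zero form_d_def ext_deriv_def structure_i_def wedge_mat_congruence)
       (simp_all add: frame_i_def vector_matrix_mult_def sum_4 partial_qp partial_inverse_q,
        simp_all add: qp_def field_simps power2_eq_square power3_eq_cube)
  then show ?thesis by (simp add: structure_equations_def vec_eq_iff)
qed

lemma invertible_frame_i:
  assumes "z \<in> generic_set_i"
  shows "invertible (frame_i z)"
proof -
  have "vector [vector [0, 0, 0, z $ 3 / z $ 4], vector [(z $ 3)\<^sup>2 / z $ 4, 0, 0, 0],
      vector [0, z $ 3, 0, 0], vector [0, 0, z $ 4, 0]] ** frame_i z = mat 1"
    using assms by (simp add: vec4_eq_iff matrix_matrix_mult_def sum_4 frame_i_def mat_def qp_def generic_set_i_def
        field_simps power2_eq_square)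
  then show ?thesis
    using invertible_left_inverse by blast
qed

text \<open>The coefficients of the invariant coframe with \<open>K4 = \<beta>/3 q/p\<close> and \<open>K5 = \<gamma>/3 1/p\<close> in the frame, and
  their inverse.\<close>

definition to_coframe_i :: "complex \<Rightarrow> complex \<Rightarrow> complex \<Rightarrow> complex^4^4" where
  "to_coframe_i \<alpha> \<beta> \<gamma> = vector
     [vector [\<beta> * \<gamma> / 9, 0, 0, - (\<beta> * \<gamma> / 9)],
      vector [\<gamma> * (\<alpha> - 3) / 9, \<gamma> / 3, 0, - (\<gamma> * \<alpha> / 9)],
      vector [\<gamma> / \<beta> * ((9 - 3 * \<alpha> - \<alpha>\<^sup>2) / 18), - (\<gamma> / \<beta> * ((\<alpha> + 3) / 3)), \<gamma> / \<beta>,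
        \<gamma> / \<beta> * (- \<alpha> + (\<alpha> + 3) / 3 - (9 - 3 * \<alpha> - \<alpha>\<^sup>2) / 18)],
      vector [\<alpha> * \<beta> / 9, 0, 0, \<beta> / 3 - \<alpha> * \<beta> / 9]]"

definition from_coframe_i :: "complex \<Rightarrow> complex \<Rightarrow> complex \<Rightarrow> complex^4^4" where
  "from_coframe_i \<alpha> \<beta> \<gamma> = vector
     [vector [9 / (\<beta> * \<gamma>) * (1 - \<alpha> / 3), 0, 0, 3 / \<beta>],
      vector [9 / (\<beta> * \<gamma>) * (1 - 2 * \<alpha> / 3), 3 / \<gamma>, 0, 3 / \<beta>],
      vector [9 / (\<beta> * \<gamma>) * ((9 + 3 * \<alpha> - 7 * \<alpha>\<^sup>2) / 18), (\<alpha> + 3) / \<gamma>, \<beta> / \<gamma>, 3 * \<alpha> / \<beta>],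
      vector [- (9 / (\<beta> * \<gamma>) * (\<alpha> / 3)), 0, 0, 3 / \<beta>]]"

lemma from_to_coframe_i: "\<beta> \<noteq> 0 \<Longrightarrow> \<gamma> \<noteq> 0 \<Longrightarrow> from_coframe_i \<alpha> \<beta> \<gamma> ** to_coframe_i \<alpha> \<beta> \<gamma> = mat 1"
  by (simp add: vec4_eq_iff matrix_matrix_mult_def sum_4 mat_def from_coframe_i_def to_coframe_i_def
      field_simps power2_eq_square)

lemma invariant_coframe_canonical_i:
  assumes S: "open S" "S \<subseteq> generic_set_i" and z: "z \<in> S" and nz: "\<beta> \<noteq> 0" "\<gamma> \<noteq> 0"
    and K4: "\<And>w. w \<in> S \<Longrightarrow> K4 w = qp (\<beta> / 3) 1 1 w" and K5: "\<And>w. w \<in> S \<Longrightarrow> K5 w = qp (\<gamma> / 3) 0 1 w"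
  shows "invariant_coframe (canonical_i \<alpha>) K4 K5 z = to_coframe_i \<alpha> \<beta> \<gamma> ** frame_i z"
    and "frame_i z = from_coframe_i \<alpha> \<beta> \<gamma> ** invariant_coframe (canonical_i \<alpha>) K4 K5 z"
proof -
  have pq: "z $ 3 \<noteq> 0" "z $ 4 \<noteq> 0" using z S by (auto simp: generic_set_i_def)
  then have zp: "z \<in> p_nonzero" by (simp add: p_nonzero_def)
  have p4: "partial 4 K4 z = \<beta> / 3 / z $ 3" and p3: "partial 3 K4 z = - (\<beta> / 3 * z $ 4 / (z $ 3)\<^sup>2)"
    using partial_cong[OF S(1) K4 z, where i=4] partial_cong[OF S(1) K4 z, where i=3] pq
    by (simp_all add: partial_qp power2_eq_square)
  have "slope (canonical_i \<alpha>) K4 z = (\<alpha> - 3) / 3 * (z $ 4 / z $ 3)"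
    unfolding slope_def p4 p3 invariants_canonical_i[OF zp] K4[OF z]
    using pq nz by (simp add: qp_def field_simps power2_eq_square)
  then show *: "invariant_coframe (canonical_i \<alpha>) K4 K5 z = to_coframe_i \<alpha> \<beta> \<gamma> ** frame_i z"
    using pq nz
    by (subst invariant_coframe_eq)
       (simp_all add: K4[OF z] K5[OF z] p4 invariants_canonical_i[OF zp],
        simp_all add: vec4_eq_iff matrix_matrix_mult_def sum_4 coframe_matrix_def base_coframe_def
          to_coframe_i_def frame_i_def qp_def canonical_i_def field_simps power2_eq_square)
  show "frame_i z = from_coframe_i \<alpha> \<beta> \<gamma> ** invariant_coframe (canonical_i \<alpha>) K4 K5 z"
    by (simp add: * matrix_mul_assoc from_to_coframe_i nz)
qed

text \<open>The rows \<open>q (du - p dx)\<close>, \<open>dp\<close>, \<open>d log q\<close>, \<open>q dx\<close> are invariant under the maps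
  \<open>(a x + b, a u + c x + d)\<close>, which are the symmetries of form (ii).\<close>

definition frame_ii :: "complex^4 \<Rightarrow> complex^4^4" where
  "frame_ii z = vector [vector [- (z $ 3 * z $ 4), z $ 4, 0, 0], vector [0, 0, 1, 0],
     vector [0, 0, 0, 1 / z $ 4], vector [z $ 4, 0, 0, 0]]"

definition structure_ii :: "4 \<Rightarrow> complex^4^4" where
  "structure_ii i = (if i = 1 then wedge_mat (vector [0, 0, 1, 0]) (vector [1, 0, 0, 0])
       - wedge_mat (vector [0, 1, 0, 0]) (vector [0, 0, 0, 1])
     else if i = 4 then wedge_mat (vector [0, 0, 1, 0]) (vector [0, 0, 0, 1]) else 0)"

lemma structure_ii_antisym: "transpose (structure_ii i) = - structure_ii i"
  by (simp add: structure_ii_def wedge_mat_antisym transpose_zero_diff)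

definition generic_set_ii :: "(complex^4) set" where "generic_set_ii = {z. z $ 4 \<noteq> 0}"

lemma open_generic_set_ii: "open generic_set_ii"
  unfolding generic_set_ii_def by (intro open_Collect_neq continuous_intros)

lemma partial_minus_pq: "partial i (\<lambda>z::complex^4. - (z $ 3 * z $ 4)) z =
  - ((if i = 3 then z $ 4 else 0) + (if i = 4 then z $ 3 else 0))"
proof -
  have U: "open (UNIV :: (complex^4) set)" by simp
  show ?thesis
    by (simp add: partial_minus[OF holo_mult[OF holo_nth[OF U] holo_nth[OF U]]] partial_mult[OF holo_nth[OF U] holo_nth[OF U]])
qed

lemma holo_frame_ii:
  assumes "open S" "S \<subseteq> generic_set_ii"
  shows "holo_coframe frame_ii S"
  unfolding holo_coframe_def
proof (intro allI)
  fix i j :: 4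
  have "z $ 4 \<noteq> 0" if "z \<in> S" for z using assms that by (auto simp: generic_set_ii_def)
  then show "holo_on (\<lambda>z. frame_ii z $ i $ j) S"
    using exhaust_4[of i] exhaust_4[of j] assms(1)
    by (auto simp: frame_ii_def intro!: holo_const holo_inverse_q holo_nth holo_minus holo_mult)
qed

lemma frame_ii_structure:
  assumes "z \<in> generic_set_ii"
  shows "structure_equations frame_ii structure_ii z"
proof -
  have "form_d (\<lambda>w. frame_ii w $ i) z $ r $ s = (transpose (frame_ii z) ** structure_ii i ** frame_ii z) $ r $ s" for i r s
    using exhaust_4[of i] exhaust_4[of r] exhaust_4[of s] assms[unfolded generic_set_ii_def]
    by (elim disjE; simp add: congruence_zero congruence_diff form_d_def ext_deriv_def structure_ii_def wedge_mat_congruence)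
       (simp_all add: frame_ii_def vector_matrix_mult_def sum_4 partial_minus_pq partial_inverse_q)
  then show ?thesis by (simp add: structure_equations_def vec_eq_iff)
qed

lemma invertible_frame_ii:
  assumes "z \<in> generic_set_ii"
  shows "invertible (frame_ii z)"
proof -
  have "vector [vector [0, 0, 0, 1 / z $ 4], vector [1 / z $ 4, 0, 0, z $ 3 / z $ 4],
      vector [0, 1, 0, 0], vector [0, 0, z $ 4, 0]] ** frame_ii z = mat 1"
    using assms by (simp add: vec4_eq_iff matrix_matrix_mult_def sum_4 frame_ii_def mat_def generic_set_ii_def)
  then show ?thesis
    using invertible_left_inverse by blast
qed

text \<open>The coefficients of the invariant coframe with \<open>K4 = \<kappa> q\<close> and \<open>K5 = \<delta>\<close> in the frame, and their inverse.\<close>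

definition to_coframe_ii :: "complex \<Rightarrow> complex \<Rightarrow> complex^4^4" where
  "to_coframe_ii \<kappa> \<delta> = vector
     [vector [\<kappa> * \<delta>, 0, 0, 0],
      vector [\<delta> / 3, \<delta>, 0, - \<delta>],
      vector [- (\<delta> / (18 * \<kappa>)), - (\<delta> / (3 * \<kappa>)), \<delta> / \<kappa>, - (2 * \<delta> / (3 * \<kappa>))],
      vector [\<kappa> / 3, 0, 0, \<kappa>]]"

definition from_coframe_ii :: "complex \<Rightarrow> complex \<Rightarrow> complex^4^4" where
  "from_coframe_ii \<kappa> \<delta> = vector
     [vector [1 / (\<kappa> * \<delta>), 0, 0, 0],
      vector [- (2 / (3 * \<kappa> * \<delta>)), 1 / \<delta>, 0, 1 / \<kappa>],
      vector [- (7 / (18 * \<kappa> * \<delta>)), 1 / (3 * \<delta>), \<kappa> / \<delta>, 1 / \<kappa>],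
      vector [- (1 / (3 * \<kappa> * \<delta>)), 0, 0, 1 / \<kappa>]]"

lemma from_to_coframe_ii: "\<kappa> \<noteq> 0 \<Longrightarrow> \<delta> \<noteq> 0 \<Longrightarrow> from_coframe_ii \<kappa> \<delta> ** to_coframe_ii \<kappa> \<delta> = mat 1"
  by (simp add: vec4_eq_iff matrix_matrix_mult_def sum_4 mat_def from_coframe_ii_def to_coframe_ii_def
      field_simps power2_eq_square)

lemma invariant_coframe_canonical_ii:
  assumes S: "open S" "S \<subseteq> generic_set_ii" and z: "z \<in> S" and nz: "\<kappa> \<noteq> 0" "\<delta> \<noteq> 0"
    and K4: "\<And>w. w \<in> S \<Longrightarrow> K4 w = qp \<kappa> 1 0 w" and K5: "\<And>w. w \<in> S \<Longrightarrow> K5 w = \<delta>"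
  shows "invariant_coframe canonical_ii K4 K5 z = to_coframe_ii \<kappa> \<delta> ** frame_ii z"
    and "frame_ii z = from_coframe_ii \<kappa> \<delta> ** invariant_coframe canonical_ii K4 K5 z"
proof -
  have q: "z $ 4 \<noteq> 0" using z S by (auto simp: generic_set_ii_def)
  have p4: "partial 4 K4 z = \<kappa>" and p3: "partial 3 K4 z = 0"
    using partial_cong[OF S(1) K4 z, where i=4] partial_cong[OF S(1) K4 z, where i=3]
    by (simp_all add: partial_qp)
  have sl: "slope canonical_ii K4 z = z $ 4 / 3"
    unfolding slope_def p4 p3 invariants_canonical_ii K4[OF z]
    using q nz by (simp add: qp_def field_simps)
  show *: "invariant_coframe canonical_ii K4 K5 z = to_coframe_ii \<kappa> \<delta> ** frame_ii z"
    using q nz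
    by (subst invariant_coframe_eq)
       (simp_all add: sl K4[OF z] K5[OF z] p4 invariants_canonical_ii,
        simp_all add: vec4_eq_iff matrix_matrix_mult_def sum_4 coframe_matrix_def base_coframe_def
          to_coframe_ii_def frame_ii_def qp_def canonical_ii_def field_simps power2_eq_square)
  show "frame_ii z = from_coframe_ii \<kappa> \<delta> ** invariant_coframe canonical_ii K4 K5 z"
    by (simp add: * matrix_mul_assoc from_to_coframe_ii nz)
qed

section \<open>Integration of the structure equations\<close>

lemma holo_coframe_mult: "holo_coframe \<theta> S \<Longrightarrow> holo_coframe (\<lambda>z. M ** \<theta> z) S"
  unfolding holo_coframe_def matrix_matrix_mult_def
  by (auto intro!: holo_sum_UNIV holo_mult holo_const holo_on_open)

lemma closed_form_primitive:
  assumes "\<And>i. holo_on (\<lambda>z. \<eta> z $ i) (ball a r)" "\<And>z. z \<in> ball a r \<Longrightarrow> form_d \<eta> z = 0"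
  obtains L where "holo_on L (ball a r)" "\<And>z i. z \<in> ball a r \<Longrightarrow> partial i L z = \<eta> z $ i"
proof (rule closed_form_has_primitive[of \<eta> a r])
  fix z :: "complex^4" and i j assume "z \<in> ball a r"
  then have "form_d \<eta> z $ i $ j = 0" using assms(2) by simp
  then show "partial i (\<lambda>z. \<eta> z $ j) z = partial j (\<lambda>z. \<eta> z $ i) z"
    by (simp add: form_d_def ext_deriv_def)
qed (use assms(1) that in auto)

text \<open>The hypothesis is \<open>d \<eta> = dL \<and> \<eta>\<close>, so that \<open>exp (- L) \<eta>\<close> is closed.\<close>

lemma integrating_factor:
  assumes \<eta>: "\<And>i. holo_on (\<lambda>z. \<eta> z $ i) (ball a r)" and L: "holo_on L (ball a r)"
    and eq: "\<And>z i j. z \<in> ball a r \<Longrightarrow>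
      form_d \<eta> z $ i $ j = partial i L z * \<eta> z $ j - partial j L z * \<eta> z $ i"
  obtains X where "holo_on X (ball a r)" "\<And>z i. z \<in> ball a r \<Longrightarrow> partial i X z = exp (- L z) * \<eta> z $ i"
proof -
  define E where "E z = exp (- L z)" for z
  define \<zeta> where "\<zeta> z = (\<chi> i. E z * \<eta> z $ i)" for z
  have E: "holo_on E (ball a r)"
    unfolding E_def[abs_def] by (intro holo_exp holo_minus L)
  have pE: "partial i E z = - (E z * partial i L z)" if "z \<in> ball a r" for z i
    unfolding E_def[abs_def] partial_exp[OF holo_minus[OF L] that] partial_minus[OF L that] by simp
  have p: "partial i (\<lambda>z. \<zeta> z $ j) z = E z * (partial i (\<lambda>z. \<eta> z $ j) z - partial i L z * \<eta> z $ j)"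
    if "z \<in> ball a r" for z i j
    using that by (simp add: \<zeta>_def partial_mult[OF E \<eta>] pE right_diff_distrib)
  have h: "holo_on (\<lambda>z. \<zeta> z $ i) (ball a r)" for i
    unfolding \<zeta>_def using holo_mult[OF E \<eta>] by simp
  have "form_d \<zeta> z = 0" if z: "z \<in> ball a r" for z
  proof -
    have "form_d \<zeta> z $ i $ j = E z *
      (form_d \<eta> z $ i $ j - (partial i L z * \<eta> z $ j - partial j L z * \<eta> z $ i))" for i j
      unfolding form_d_def ext_deriv_def by (simp add: p[OF z] algebra_simps)
    then show ?thesis by (simp add: vec_eq_iff eq[OF z])
  qed
  from closed_form_primitive[OF h this]
  obtain X where "holo_on X (ball a r)" "\<And>z i. z \<in> ball a r \<Longrightarrow> partial i X z = \<zeta> z $ i"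
    by metis
  then show thesis using that by (simp add: \<zeta>_def E_def)
qed

text \<open>The total derivative annihilates \<open>\<omega>1\<close>, \<open>\<omega>2\<close>, \<open>\<omega>3\<close> and takes the value 1 on dx, so it
  only sees the coefficient of the last row of the coframe, and a combination of the first and last
  row is a combination of du and dx. The prescribed equations between the coefficients therefore say
  that X, U depend on x, u alone and that P, Q are the prolongation.\<close>

lemma point_equivalent_by_rows:
  fixes x u p q :: "complex^4 \<Rightarrow> complex^4" and f J4 J5 :: "complex^4 \<Rightarrow> complex"
  defines "\<theta> \<equiv> invariant_coframe f J4 J5"
  assumes r: "r > 0" and hol: "holo_on X (ball a r)" "holo_on U (ball a r)"
    and nz: "\<And>z. z \<in> ball a r \<Longrightarrow> J4 z \<noteq> 0 \<and> J5 z \<noteq> 0 \<and> partial 4 J4 z \<noteq> 0"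
    and X: "\<And>z i. z \<in> ball a r \<Longrightarrow> partial i X z = (x z v* \<theta> z) $ i" and U: "\<And>z i. z \<in> ball a r \<Longrightarrow> partial i U z = (u z v* \<theta> z) $ i"
    and P: "\<And>z i. z \<in> ball a r \<Longrightarrow> partial i P z = (p z v* \<theta> z) $ i" and Q: "\<And>z i. z \<in> ball a r \<Longrightarrow> partial i Q z = (q z v* \<theta> z) $ i"
    and rows: "\<And>z. x z $ 2 = 0 \<and> x z $ 3 = 0 \<and> u z $ 2 = 0 \<and> u z $ 3 = 0"
    and x: "\<And>z. x z $ 4 \<noteq> 0" and u: "\<And>z. u z $ 4 = P z * x z $ 4" "\<And>z. u z $ 1 \<noteq> P z * x z $ 1"
    and pq: "\<And>z. p z $ 4 = Q z * x z $ 4" "\<And>z. q z $ 4 = g (vector [X z, U z, P z, Q z]) * x z $ 4"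
  shows "point_equivalent f a g (vector [X a, U a, P a, Q a])"
proof -
  have \<theta>: "\<theta> z = coframe_matrix (J4 z) (J5 z) (slope f J4 z) (I1 f z) (I2 f z) (I3 f z) ** base_coframe f z"
    if "z \<in> ball a r" for z
    unfolding \<theta>_def using nz[OF that] by (simp add: invariant_coframe_eq)
  note row = vector_matrix_mult_def matrix_matrix_mult_def sum_4 coframe_matrix_def base_coframe_def
  have D: "total_deriv f F z = v $ 4 * J4 z"
    if "z \<in> ball a r" "\<And>i. partial i F z = (v v* \<theta> z) $ i" for F v z
    unfolding total_deriv_def that(2) \<theta>[OF that(1)] by (simp add: row algebra_simps add_divide_distrib diff_divide_distrib)
  have a: "a \<in> ball a r" using r by simp
  show ?thesis
  proof (rule point_equivalentI[OF r hol])
    have "partial 1 X a * partial 2 U a - partial 2 X a * partial 1 U a =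
        x a $ 4 * J4 a * (J4 a * J5 a) * (u a $ 1 - P a * x a $ 1)"
      unfolding X[OF a] U[OF a] \<theta>[OF a] using rows[of a] u(1)[of a] by (simp add: row algebra_simps)
    then show "partial 1 X a * partial 2 U a - partial 2 X a * partial 1 U a \<noteq> 0"
      using nz[OF a] x[of a] u(2)[of a] by simp
    fix z assume z: "z \<in> ball a r"
    show "partial 3 X z = 0" "partial 4 X z = 0" "partial 3 U z = 0" "partial 4 U z = 0"
      unfolding X[OF z] U[OF z] \<theta>[OF z] using rows[of z] by (simp_all add: row)
    show "total_deriv f X z \<noteq> 0" "total_deriv f U z = P z * total_deriv f X z"
      "total_deriv f P z = Q z * total_deriv f X z" "total_deriv f Q z = g (vector [X z, U z, P z, Q z]) * total_deriv f X z"
      using D[OF z X[OF z]] D[OF z U[OF z]] D[OF z P[OF z]] D[OF z Q[OF z]] nz[OF z] x[of z] u(1)[of z] pq[of z]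
      by simp_all
  qed
qed

text \<open>The combination of the coframe of f satisfies the structure equations of the frame of form (i), so
  its rows must be \<open>(Q/P^2) dU\<close>, \<open>d log P\<close>, \<open>d log Q\<close>, \<open>(Q/P) dX\<close> for suitable functions: the second and
  third row are closed and give log P and log Q, and the fourth and first row become closed when they
  are multiplied by \<open>P/Q\<close> and \<open>P^2/Q\<close>.\<close>

lemma integrate_form_i:
  assumes r: "r > 0" and \<beta>\<gamma>: "\<beta> \<noteq> 0" "\<gamma> \<noteq> 0"
    and nz: "\<And>z. z \<in> ball a r \<Longrightarrow> J4 z \<noteq> 0 \<and> J5 z \<noteq> 0 \<and> partial 4 J4 z \<noteq> 0"
    and hol: "holo_coframe (invariant_coframe f J4 J5) (ball a r)"
    and eq: "\<And>z. z \<in> ball a r \<Longrightarrow> structure_equations (\<lambda>w. from_coframe_i \<alpha> \<beta> \<gamma> ** invariant_coframe f J4 J5 w) structure_i z"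
  shows "\<exists>b. generic_i b \<and> point_equivalent f a (canonical_i \<alpha>) b"
proof -
  define M where "M = from_coframe_i \<alpha> \<beta> \<gamma>"
  define h where "h z = M ** invariant_coframe f J4 J5 z" for z
  have hh: "holo_on (\<lambda>z. h z $ i $ j) (ball a r)" for i j
    using holo_coframe_mult[OF hol] unfolding h_def holo_coframe_def by blast
  have eq': "form_d (\<lambda>w. h w $ i) z = transpose (h z) ** structure_i i ** h z" if "z \<in> ball a r" for z i
    using eq[OF that] by (simp add: structure_equations_def h_def M_def)
  have closed: "form_d (\<lambda>w. h w $ i) z = 0" if "z \<in> ball a r" "i = 2 \<or> i = 3" for z i
    unfolding eq'[OF that(1)] using that(2) by (auto simp: structure_i_def congruence_zero)
  obtain lp where lp: "holo_on lp (ball a r)" "\<And>z i. z \<in> ball a r \<Longrightarrow> partial i lp z = h z $ 2 $ i"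
    using closed_form_primitive[OF hh closed] by (metis (no_types))
  obtain lq where lq: "holo_on lq (ball a r)" "\<And>z i. z \<in> ball a r \<Longrightarrow> partial i lq z = h z $ 3 $ i"
    using closed_form_primitive[OF hh closed] by (metis (no_types))
  define n where "n z = lq z - lp z" for z
  have n: "holo_on n (ball a r)"
    unfolding n_def[abs_def] by (intro holo_diff lq lp)
  have pn: "partial i n z = h z $ 3 $ i - h z $ 2 $ i" if z: "z \<in> ball a r" for z i
    unfolding n_def[abs_def] partial_diff[OF lq(1) lp(1) z] lp(2)[OF z] lq(2)[OF z] ..
  obtain X where X: "holo_on X (ball a r)" "\<And>z i. z \<in> ball a r \<Longrightarrow> partial i X z = exp (- n z) * h z $ 4 $ i"
  proof (rule integrating_factor[OF hh n])
    fix z i j assume z: "z \<in> ball a r"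
    show "form_d (\<lambda>w. h w $ 4) z $ i $ j = partial i n z * h z $ 4 $ j - partial j n z * h z $ 4 $ i"
      by (simp add: eq'[OF z] structure_i_def wedge_mat_congruence pn[OF z] vector_matrix_mult_def sum_4 algebra_simps)
  qed (rule that)
  define m where "m z = lq z - 2 * lp z" for z
  have lp2: "holo_on (\<lambda>z. 2 * lp z) (ball a r)"
    by (intro holo_mult lp holo_const) simp
  have m: "holo_on m (ball a r)"
    unfolding m_def[abs_def] by (intro holo_diff lq lp2)
  have pm: "partial i m z = h z $ 3 $ i - 2 * h z $ 2 $ i" if z: "z \<in> ball a r" for z i
    unfolding m_def[abs_def] partial_diff[OF lq(1) lp2 z] partial_cmult[OF lp(1) z] lp(2)[OF z] lq(2)[OF z] ..
  obtain U where U: "holo_on U (ball a r)" "\<And>z i. z \<in> ball a r \<Longrightarrow> partial i U z = exp (- m z) * h z $ 1 $ i"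
  proof (rule integrating_factor[OF hh m])
    fix z i j assume z: "z \<in> ball a r"
    show "form_d (\<lambda>w. h w $ 1) z $ i $ j = partial i m z * h z $ 1 $ j - partial j m z * h z $ 1 $ i"
      by (simp add: eq'[OF z] structure_i_def wedge_mat_congruence pm[OF z] vector_matrix_mult_def sum_4 algebra_simps)
  qed (rule that)
  have row: "c * h z $ k $ i = ((\<chi> l. c * M $ k $ l) v* invariant_coframe f J4 J5 z) $ i" for c z k i
    by (simp add: h_def matrix_matrix_mult_def vector_matrix_mult_def sum_distrib_left mult_ac)
  define P where "P z = exp (lp z)" for z
  define Q where "Q z = exp (lq z)" for z
  have pP: "partial i P z = P z * h z $ 2 $ i" and pQ: "partial i Q z = Q z * h z $ 3 $ i" if "z \<in> ball a r" for z i
    unfolding P_def[abs_def] Q_def[abs_def] partial_exp[OF lp(1) that] partial_exp[OF lq(1) that] lp(2)[OF that] lq(2)[OF that]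
    by auto
  have M: "M $ 1 $ 2 = 0" "M $ 1 $ 3 = 0" "M $ 4 $ 2 = 0" "M $ 4 $ 3 = 0"
    "M $ 1 $ 4 = 3 / \<beta>" "M $ 2 $ 4 = 3 / \<beta>" "M $ 3 $ 4 = 3 * \<alpha> / \<beta>" "M $ 4 $ 4 = 3 / \<beta>"
    "M $ 1 $ 1 = M $ 4 $ 1 + 9 / (\<beta> * \<gamma>)"
    using \<beta>\<gamma> by (simp_all add: M_def from_coframe_i_def field_simps)
  have e: "exp (- n z) = P z / Q z" "exp (- m z) = P z * (P z / Q z)" for z
    by (simp_all add: P_def Q_def m_def n_def exp_diff[symmetric] exp_add[symmetric])
  have PQ: "P z \<noteq> 0" "Q z \<noteq> 0" for z by (simp_all add: P_def Q_def)
  have "point_equivalent f a (canonical_i \<alpha>) (vector [X a, U a, P a, Q a])"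
    by (rule point_equivalent_by_rows[OF r X(1) U(1) nz X(2)[unfolded row] U(2)[unfolded row] pP[unfolded row] pQ[unfolded row]])
       (use \<beta>\<gamma> PQ in \<open>simp_all add: M e canonical_i_def field_simps power2_eq_square del: mem_ball\<close>)
  moreover have "generic_i (vector [X a, U a, P a, Q a])"
    using PQ by (simp add: generic_i_def)
  ultimately show ?thesis by blast
qed

text \<open>Here the closed rows give P itself and log Q. The last row becomes closed when it is divided by Q,
  and so does the first row after P times the last row has been added.\<close>

lemma integrate_form_ii:
  assumes r: "r > 0" and \<kappa>\<delta>: "\<kappa> \<noteq> 0" "\<delta> \<noteq> 0"
    and nz: "\<And>z. z \<in> ball a r \<Longrightarrow> J4 z \<noteq> 0 \<and> J5 z \<noteq> 0 \<and> partial 4 J4 z \<noteq> 0"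
    and hol: "holo_coframe (invariant_coframe f J4 J5) (ball a r)"
    and eq: "\<And>z. z \<in> ball a r \<Longrightarrow> structure_equations (\<lambda>w. from_coframe_ii \<kappa> \<delta> ** invariant_coframe f J4 J5 w) structure_ii z"
  shows "\<exists>b. generic_ii b \<and> point_equivalent f a canonical_ii b"
proof -
  define M where "M = from_coframe_ii \<kappa> \<delta>"
  define h where "h z = M ** invariant_coframe f J4 J5 z" for z
  have hh: "holo_on (\<lambda>z. h z $ i $ j) (ball a r)" for i j
    using holo_coframe_mult[OF hol] unfolding h_def holo_coframe_def by blast
  have eq': "form_d (\<lambda>w. h w $ i) z = transpose (h z) ** structure_ii i ** h z" if "z \<in> ball a r" for z i
    using eq[OF that] by (simp add: structure_equations_def h_def M_def)
  have closed: "form_d (\<lambda>w. h w $ i) z = 0" if "z \<in> ball a r" "i = 2 \<or> i = 3" for z i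
    unfolding eq'[OF that(1)] using that(2) by (auto simp: structure_ii_def congruence_zero)
  obtain P where P: "holo_on P (ball a r)" "\<And>z i. z \<in> ball a r \<Longrightarrow> partial i P z = h z $ 2 $ i"
    using closed_form_primitive[OF hh closed] by (metis (no_types))
  obtain lq where lq: "holo_on lq (ball a r)" "\<And>z i. z \<in> ball a r \<Longrightarrow> partial i lq z = h z $ 3 $ i"
    using closed_form_primitive[OF hh closed] by (metis (no_types))
  obtain X where X: "holo_on X (ball a r)" "\<And>z i. z \<in> ball a r \<Longrightarrow> partial i X z = exp (- lq z) * h z $ 4 $ i"
  proof (rule integrating_factor[OF hh lq(1)])
    fix z i j assume z: "z \<in> ball a r"
    show "form_d (\<lambda>w. h w $ 4) z $ i $ j = partial i lq z * h z $ 4 $ j - partial j lq z * h z $ 4 $ i"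
      by (simp add: eq'[OF z] structure_ii_def wedge_mat_congruence lq(2)[OF z] vector_matrix_mult_def sum_4)
  qed (rule that)
  \<comment> \<open>\<open>q du = s + p (q dx)\<close>, where s and \<open>q dx\<close> are the first and the last row\<close>
  define \<eta> where "\<eta> z = (\<chi> i. h z $ 1 $ i + P z * h z $ 4 $ i)" for z
  have h\<eta>: "holo_on (\<lambda>z. \<eta> z $ i) (ball a r)" for i
    unfolding \<eta>_def using holo_add[OF hh holo_mult[OF P(1) hh]] by simp
  obtain U where U: "holo_on U (ball a r)" "\<And>z i. z \<in> ball a r \<Longrightarrow> partial i U z = exp (- lq z) * \<eta> z $ i"
  proof (rule integrating_factor[OF h\<eta> lq(1)])
    fix z i j assume z: "z \<in> ball a r"
    have "partial i (\<lambda>z. \<eta> z $ j) z = partial i (\<lambda>z. h z $ 1 $ j) z + (h z $ 2 $ i * h z $ 4 $ j + P z * partial i (\<lambda>z. h z $ 4 $ j) z)" for i j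
      by (simp add: \<eta>_def partial_add[OF hh holo_mult[OF P(1) hh] z] partial_mult[OF P(1) hh z] P(2)[OF z])
    then have "form_d \<eta> z $ i $ j = form_d (\<lambda>w. h w $ 1) z $ i $ j + P z * form_d (\<lambda>w. h w $ 4) z $ i $ j
        + h z $ 2 $ i * h z $ 4 $ j - h z $ 2 $ j * h z $ 4 $ i"
      by (simp add: form_d_def ext_deriv_def algebra_simps)
    then show "form_d \<eta> z $ i $ j = partial i lq z * \<eta> z $ j - partial j lq z * \<eta> z $ i"
      by (simp add: eq'[OF z] structure_ii_def wedge_mat_congruence congruence_diff lq(2)[OF z] vector_matrix_mult_def sum_4
          \<eta>_def algebra_simps)
  qed (rule that)
  have row: "c * h z $ k $ i = ((\<chi> l. c * M $ k $ l) v* invariant_coframe f J4 J5 z) $ i"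
    "c * \<eta> z $ i = ((\<chi> l. c * (M $ 1 $ l + P z * M $ 4 $ l)) v* invariant_coframe f J4 J5 z) $ i" for c z k i
    by (simp_all add: h_def \<eta>_def matrix_matrix_mult_def vector_matrix_mult_def sum_4 algebra_simps)
  define Q where "Q z = exp (lq z)" for z
  have pP: "partial i P z = 1 * h z $ 2 $ i" and pQ: "partial i Q z = Q z * h z $ 3 $ i" if "z \<in> ball a r" for z i
    unfolding Q_def[abs_def] partial_exp[OF lq(1) that] P(2)[OF that] lq(2)[OF that]
    by auto
  have M: "M $ 1 $ 2 = 0" "M $ 1 $ 3 = 0" "M $ 4 $ 2 = 0" "M $ 4 $ 3 = 0"
    "M $ 1 $ 4 = 0" "M $ 2 $ 4 = 1 / \<kappa>" "M $ 3 $ 4 = 1 / \<kappa>" "M $ 4 $ 4 = 1 / \<kappa>"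
    "M $ 1 $ 1 = 1 / (\<kappa> * \<delta>)"
    by (simp_all add: M_def from_coframe_ii_def)
  have e: "exp (- lq z) = 1 / Q z" for z
    by (simp add: Q_def exp_minus inverse_eq_divide)
  have Q: "Q z \<noteq> 0" for z by (simp add: Q_def)
  have "point_equivalent f a canonical_ii (vector [X a, U a, P a, Q a])"
    by (rule point_equivalent_by_rows[OF r X(1) U(1) nz X(2)[unfolded row] U(2)[unfolded row] pP[unfolded row] pQ[unfolded row]])
       (use \<kappa>\<delta> Q in \<open>simp_all add: M e canonical_ii_def field_simps power2_eq_square del: mem_ball\<close>)
  moreover have "generic_ii (vector [X a, U a, P a, Q a])"
    using Q by (simp add: generic_ii_def)
  ultimately show ?thesis by blast
qed

section \<open>Characterization of the canonical forms\<close>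

lemma eventually_nhds_ball: "(\<forall>\<^sub>F z in nhds a. R z) \<longleftrightarrow> (\<exists>r>0. \<forall>z\<in>ball a r. R z)"
  for a :: "'a::metric_space"
  unfolding eventually_nhds_metric by (simp add: Ball_def dist_commute)

lemma holomorphic_at_iff_ball: "holomorphic_at F a \<longleftrightarrow> (\<exists>r>0. holo_on F (ball a r))"
proof
  assume "holomorphic_at F a"
  then obtain S where S: "a \<in> S" "holo_on F S" using holomorphic_at_iff by blast
  then obtain r where "r > 0" "ball a r \<subseteq> S"
    using holo_on_open open_contains_ball by blast
  with S show "\<exists>r>0. holo_on F (ball a r)" using holo_on_subset open_ball by blast
next
  assume "\<exists>r>0. holo_on F (ball a r)"
  then show "holomorphic_at F a" using holomorphic_at_iff centre_in_ball by blast
qed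

lemma holo_on_imp_holomorphic_at: "holo_on F S \<Longrightarrow> a \<in> S \<Longrightarrow> holomorphic_at F a"
  using holomorphic_at_iff by blast

lemma holo_on_ball_mono: "holo_on F (ball a r) \<Longrightarrow> s \<le> r \<Longrightarrow> holo_on F (ball a s)"
  by (rule holo_on_subset) auto

lemma invertible_if_mult_invertible:
  fixes A B :: "complex^4^4"
  assumes "invertible (A ** B)"
  shows "invertible B"
proof -
  obtain C where "C ** (A ** B) = mat 1"
    using assms invertible_left_inverse by blast
  then show ?thesis
    using invertible_left_inverse matrix_mul_assoc by metis
qed

subsection \<open>Coframes with an integrable constant combination\<close>

text \<open>An equation g whose coframe differs from a frame H with constant structure matrices C by the
  mutually inverse constant matrices N and M. This covers both canonical forms, on any open set of
  jets on which roots K4 and K5 are given.\<close>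

locale canonical_coframe =
  fixes g K4 K5 :: "complex^4 \<Rightarrow> complex" and T and H :: "complex^4 \<Rightarrow> complex^4^4" and C and N M :: "complex^4^4"
  assumes g: "holo_on g T" and K: "holo_on K4 T" "holo_on K5 T"
    and K_nz: "w \<in> T \<Longrightarrow> K4 w \<noteq> 0" "w \<in> T \<Longrightarrow> K5 w \<noteq> 0" "w \<in> T \<Longrightarrow> partial 4 K4 w \<noteq> 0"
    and coframe: "w \<in> T \<Longrightarrow> invariant_coframe g K4 K5 w = N ** H w"
      "w \<in> T \<Longrightarrow> H w = M ** invariant_coframe g K4 K5 w"
    and H: "holo_coframe H T" "w \<in> T \<Longrightarrow> invertible (H w)" "w \<in> T \<Longrightarrow> structure_equations H C w"
    and C: "transpose (C i) = - C i"
begin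

text \<open>Equal structure functions make the same constant combination of the coframe of f integrable.\<close>

lemma integrable_combination_near:
  assumes f: "holomorphic_at f a" and roots: "invariant_roots f a J4 J5"
    and I: "\<forall>\<^sub>F z in nhds a. I4 f z \<noteq> 0 \<and> I5 f z \<noteq> 0" and J4q: "\<forall>\<^sub>F z in nhds a. partial 4 J4 z \<noteq> 0"
    and b: "b \<in> T" and same: "same_constant_structure (invariant_coframe f J4 J5) a (invariant_coframe g K4 K5) b"
  obtains r where "r > 0" "\<And>z. z \<in> ball a r \<Longrightarrow> J4 z \<noteq> 0 \<and> J5 z \<noteq> 0 \<and> partial 4 J4 z \<noteq> 0"
    "holo_coframe (invariant_coframe f J4 J5) (ball a r)"
    "\<And>z. z \<in> ball a r \<Longrightarrow> structure_equations (\<lambda>w. M ** invariant_coframe f J4 J5 w) C z"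
proof -
  obtain r1 r2 r3 where r: "r1 > 0" "r2 > 0" "r3 > 0"
    and hol: "holo_on f (ball a r1)" "holo_on J4 (ball a r2)" "holo_on J5 (ball a r3)"
    using f roots unfolding invariant_roots_def holomorphic_at_iff_ball by blast
  have "\<forall>\<^sub>F z in nhds a. J4 z \<noteq> 0 \<and> J5 z \<noteq> 0 \<and> partial 4 J4 z \<noteq> 0"
    using roots[unfolded invariant_roots_def, THEN conjunct2, THEN conjunct2] I J4q
    by eventually_elim auto
  then obtain r4 where r4: "r4 > 0" "\<And>z. z \<in> ball a r4 \<Longrightarrow> J4 z \<noteq> 0 \<and> J5 z \<noteq> 0 \<and> partial 4 J4 z \<noteq> 0"
    unfolding eventually_nhds_ball by blast
  define s where "s = min (min r1 r2) (min r3 r4)"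
  have s: "s > 0" "s \<le> r1" "s \<le> r2" "s \<le> r3" "s \<le> r4" using r r4 by (auto simp: s_def)
  have nz: "J4 z \<noteq> 0" "J5 z \<noteq> 0" "partial 4 J4 z \<noteq> 0" if "z \<in> ball a s" for z
    using r4(2)[of z] that s by auto
  have cof: "holo_coframe (invariant_coframe f J4 J5) (ball a s)"
    by (rule holo_coframe_invariant) (use hol s nz in \<open>auto intro: holo_on_ball_mono simp del: mem_ball\<close>)
  have "invertible (invariant_coframe g K4 K5 b)"
    using H(2)[OF b] unfolding coframe(2)[OF b] by (rule invertible_if_mult_invertible)
  moreover have "structure_equations (\<lambda>w. M ** invariant_coframe g K4 K5 w) C b"
    using structure_equations_cong[OF holo_on_open[OF g] coframe(2) b] H(3)[OF b] by simp
  ultimately have "\<forall>\<^sub>F z in nhds a. structure_equations (\<lambda>w. M ** invariant_coframe f J4 J5 w) C z"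
    using structure_equations_transfer[OF same cof _ holo_coframe_invariant[OF g K K_nz] b] s by simp
  then obtain r5 where r5: "r5 > 0"
    "\<And>z. z \<in> ball a r5 \<Longrightarrow> structure_equations (\<lambda>w. M ** invariant_coframe f J4 J5 w) C z"
    unfolding eventually_nhds_ball by blast
  have "holo_coframe (invariant_coframe f J4 J5) (ball a (min s r5))"
    using cof unfolding holo_coframe_def by (auto intro: holo_on_ball_mono[OF _ min.cobounded1])
  then show thesis
    by (intro that[of "min s r5"]) (use s r5 nz in auto)
qed

text \<open>The coframe of f is the pullback of the coframe of g, so the structure functions agree and are
  constant.\<close>

lemma invariants_of_equivalent:
  assumes f: "holomorphic_at f a" and b: "b \<in> T" and pe: "point_equivalent f a g b"
    and roots: "\<And>w. w \<in> T \<Longrightarrow> K4 w ^ 3 = I4 g w" "\<And>w. w \<in> T \<Longrightarrow> - (K5 w)\<^sup>2 = I5 g w" "\<And>w. w \<in> T \<Longrightarrow> I6 g w = 0"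
  obtains J4 J5 where "invariant_roots f a J4 J5" "invariant_roots g b K4 K5"
    "\<forall>\<^sub>F z in nhds a. I4 f z \<noteq> 0 \<and> I5 f z \<noteq> 0 \<and> I6 f z = 0" "\<forall>\<^sub>F z in nhds a. partial 4 J4 z \<noteq> 0"
    "\<forall>\<^sub>F z in nhds a. \<exists>w\<in>T. partial 4 J4 z / J5 z = partial 4 K4 w / K5 w"
    "same_constant_structure (invariant_coframe f J4 J5) a (invariant_coframe g K4 K5) b"
proof -
  have Kroots: "invariant_roots g b K4 K5"
    unfolding invariant_roots_def
    using K[THEN holo_on_imp_holomorphic_at, OF b] roots eventually_nhds_in_open[OF holo_on_open[OF g] b]
    by (auto elim!: eventually_mono)
  obtain \<tau> where \<tau>: "constant_structure_functions (invariant_coframe g K4 K5) b \<tau>"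
    using constant_structure_functions_exists[OF H(1) b H(3) C coframe] by blast
  obtain X U P Q r where r: "r > 0" and pt: "point_transformation f g X U P Q (ball a r) T"
    and jb: "vector [X a, U a, P a, Q a] = b"
    by (rule point_equivalentE[OF f pe g b]) (rule that)
  interpret pt: point_transformation f g X U P Q "ball a r" T by (rule pt)
  have a: "a \<in> ball a r" using r by simp
  have ev: "\<forall>\<^sub>F z in nhds a. z \<in> ball a r" using eventually_nhds_in_open[OF open_ball a] .
  have jet_a: "pt.jet a = b" using jb by (simp add: pt.jet_def)
  note rt = pt.roots_transform[OF K K_nz roots]
  show thesis
  proof (rule that[of "pt.J4 K4" "pt.J5 K5"])
    show "invariant_roots f a (pt.J4 K4) (pt.J5 K5)"
      unfolding invariant_roots_def
      using holo_on_imp_holomorphic_at[OF pt.holo_J(1)[OF K K_nz] a]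
        holo_on_imp_holomorphic_at[OF pt.holo_J(2)[OF K K_nz] a] rt(1,2) ev
      by (auto simp del: mem_ball elim!: eventually_mono)
    show "\<forall>\<^sub>F z in nhds a. I4 f z \<noteq> 0 \<and> I5 f z \<noteq> 0 \<and> I6 f z = 0"
      using ev by eventually_elim (use rt in blast)
    show "\<forall>\<^sub>F z in nhds a. partial 4 (pt.J4 K4) z \<noteq> 0"
      using ev by eventually_elim (use pt.partial_J4_nonzero[OF K K_nz] in blast)
    show "\<forall>\<^sub>F z in nhds a. \<exists>w\<in>T. partial 4 (pt.J4 K4) z / pt.J5 K5 z = partial 4 K4 w / K5 w"
      using ev by eventually_elim (use rt(6) pt.jet_in_T[OF K K_nz] in blast)
    show "same_constant_structure (invariant_coframe f (pt.J4 K4) (pt.J5 K5)) a (invariant_coframe g K4 K5) b"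
      unfolding same_constant_structure_def
      using \<tau> pt.constant_structure_pullback[OF K K_nz a] jet_a by auto
  qed (rule Kroots)
qed

end

subsection \<open>Form (i)\<close>

lemma admissible_nonzero:
  assumes "admissible \<alpha>"
  shows "2 * \<alpha>^3 - 9 * \<alpha>\<^sup>2 + 9 * \<alpha> \<noteq> 0" "\<alpha>\<^sup>2 - 3 * \<alpha> \<noteq> 0"
proof -
  have "2 * \<alpha>^3 - 9 * \<alpha>\<^sup>2 + 9 * \<alpha> = \<alpha> * (2 * \<alpha> - 3) * (\<alpha> - 3)"
    by (simp add: algebra_simps power2_eq_square power3_eq_cube)
  moreover have "2 * \<alpha> - 3 \<noteq> 0" using assms by (auto simp: admissible_def field_simps)
  ultimately show "2 * \<alpha>^3 - 9 * \<alpha>\<^sup>2 + 9 * \<alpha> \<noteq> 0" using assms by (simp add: admissible_def)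
  have "\<alpha>\<^sup>2 - 3 * \<alpha> = \<alpha> * (\<alpha> - 3)" by (simp add: algebra_simps power2_eq_square)
  then show "\<alpha>\<^sup>2 - 3 * \<alpha> \<noteq> 0" using assms by (simp add: admissible_def)
qed

lemma generic_set_i_p_nonzero: "z \<in> generic_set_i \<Longrightarrow> z \<in> p_nonzero"
  by (simp add: generic_set_i_def p_nonzero_def)

lemma generic_i_iff: "generic_i b \<longleftrightarrow> b \<in> generic_set_i"
  by (simp add: generic_i_def generic_set_i_def)

lemma holo_qp_i: "open S \<Longrightarrow> S \<subseteq> generic_set_i \<Longrightarrow> holo_on (qp c m n) S"
  by (rule holo_qp) (auto simp: generic_set_i_def)

text \<open>Any choice of the roots for form (i) agrees, near the base jet, with the monomials for which the
  coframe has been computed.\<close>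

lemma canonical_i_roots:
  assumes \<alpha>: "admissible \<alpha>" and b: "generic_i b" and roots: "invariant_roots (canonical_i \<alpha>) b K4 K5"
  obtains r \<beta> \<gamma> where "r > 0" "ball b r \<subseteq> generic_set_i" "\<beta> \<noteq> 0" "\<gamma> \<noteq> 0"
    "\<And>z. z \<in> ball b r \<Longrightarrow> K4 z = qp (\<beta> / 3) 1 1 z" "\<And>z. z \<in> ball b r \<Longrightarrow> K5 z = qp (\<gamma> / 3) 0 1 z"
proof -
  obtain r1 where r1: "r1 > 0" "ball b r1 \<subseteq> generic_set_i"
    using b open_generic_set_i unfolding generic_i_iff by (meson open_contains_ball)
  obtain r2 r3 r4 where r: "r2 > 0" "r3 > 0" "r4 > 0"
    and hol: "holo_on K4 (ball b r2)" "holo_on K5 (ball b r3)"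
    and eq: "\<And>z. z \<in> ball b r4 \<Longrightarrow> K4 z ^ 3 = I4 (canonical_i \<alpha>) z \<and> - (K5 z)\<^sup>2 = I5 (canonical_i \<alpha>) z"
    using roots unfolding invariant_roots_def holomorphic_at_iff_ball eventually_nhds_ball by blast
  define s where "s = min (min r1 r2) (min r3 r4)"
  have s: "s > 0" "s \<le> r1" "s \<le> r2" "s \<le> r3" "s \<le> r4" using r r1 by (auto simp: s_def)
  have g: "ball b s \<subseteq> generic_set_i" using r1 s by (meson order_trans subset_ball)
  have gz: "z $ 3 \<noteq> 0" "z $ 4 \<noteq> 0" "z \<in> p_nonzero" if "z \<in> ball b s" for z
    using g that by (auto simp: generic_set_i_def p_nonzero_def)
  have K: "holo_on K4 (ball b s)" "holo_on K5 (ball b s)"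
    using hol s by (auto intro: holo_on_ball_mono)
  have eqs: "K4 z ^ 3 = (2 * \<alpha>^3 - 9 * \<alpha>\<^sup>2 + 9 * \<alpha>) / 27 * qp 1 1 1 z ^ 3"
    "(K5 z)\<^sup>2 = (\<alpha>\<^sup>2 - 3 * \<alpha>) / 9 * (qp 1 0 1 z)\<^sup>2" if z: "z \<in> ball b s" for z
  proof -
    have "z \<in> ball b r4" using z s by auto
    from eq[OF this] show "K4 z ^ 3 = (2 * \<alpha>^3 - 9 * \<alpha>\<^sup>2 + 9 * \<alpha>) / 27 * qp 1 1 1 z ^ 3"
      by (simp add: invariants_canonical_i[OF gz(3)[OF z]] qp_def power_divide)
    from eq[OF \<open>z \<in> ball b r4\<close>] have "(K5 z)\<^sup>2 = - qp (- ((\<alpha>\<^sup>2 - 3 * \<alpha>) / 9)) 0 2 z"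
      unfolding invariants_canonical_i[OF gz(3)[OF z]] by (metis minus_minus)
    then show "(K5 z)\<^sup>2 = (\<alpha>\<^sup>2 - 3 * \<alpha>) / 9 * (qp 1 0 1 z)\<^sup>2"
      by (simp add: qp_def power_divide)
  qed
  obtain k4 where k4: "k4 ^ 3 = (2 * \<alpha>^3 - 9 * \<alpha>\<^sup>2 + 9 * \<alpha>) / 27" "\<And>z. z \<in> ball b s \<Longrightarrow> K4 z = k4 * qp 1 1 1 z"
    using root_of_power[OF K(1) holo_qp_i[OF open_ball g] s(1) _ _ _ eqs(1)] admissible_nonzero[OF \<alpha>] gz
    by (metis divide_eq_0_iff mult_1 power_one_right qp_def zero_less_numeral zero_neq_numeral)
  obtain k5 where k5: "k5\<^sup>2 = (\<alpha>\<^sup>2 - 3 * \<alpha>) / 9" "\<And>z. z \<in> ball b s \<Longrightarrow> K5 z = k5 * qp 1 0 1 z"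
    using root_of_power[OF K(2) holo_qp_i[OF open_ball g] s(1) _ _ _ eqs(2)] admissible_nonzero[OF \<alpha>] gz
    by (metis divide_eq_0_iff mult_1 power_0 power_one_right qp_def zero_less_numeral zero_neq_numeral zero_neq_one)
  show thesis
  proof (rule that[OF s(1) g, of "3 * k4" "3 * k5"])
    show "3 * k4 \<noteq> 0" "3 * k5 \<noteq> 0"
      using k4(1) k5(1) admissible_nonzero[OF \<alpha>] by auto
  qed (use k4(2) k5(2) in \<open>auto simp: qp_def simp del: mem_ball\<close>)
qed

lemma canonical_coframe_i:
  assumes T: "open T" "T \<subseteq> generic_set_i" and nz: "\<beta> \<noteq> 0" "\<gamma> \<noteq> 0"
    and K4: "\<And>z. z \<in> T \<Longrightarrow> K4 z = qp (\<beta> / 3) 1 1 z" and K5: "\<And>z. z \<in> T \<Longrightarrow> K5 z = qp (\<gamma> / 3) 0 1 z"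
  shows "canonical_coframe (canonical_i \<alpha>) K4 K5 T frame_i structure_i (to_coframe_i \<alpha> \<beta> \<gamma>) (from_coframe_i \<alpha> \<beta> \<gamma>)"
proof
  show "holo_on (canonical_i \<alpha>) T"
    unfolding canonical_i_qp by (rule holo_qp_i[OF T])
  show "holo_on K4 T" "holo_on K5 T"
    using K4 K5 by (auto intro: holo_on_cong[OF holo_qp_i[OF T]])
  fix z assume z: "z \<in> T"
  then have pq: "z $ 3 \<noteq> 0" "z $ 4 \<noteq> 0" "z \<in> generic_set_i" using T(2) by (auto simp: generic_set_i_def)
  show "K4 z \<noteq> 0" "K5 z \<noteq> 0" using pq nz by (simp_all add: K4[OF z] K5[OF z] qp_def)
  show "partial 4 K4 z \<noteq> 0"
    using partial_cong[OF T(1) K4 z, where i=4] pq nz by (simp add: partial_qp)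
  show "invariant_coframe (canonical_i \<alpha>) K4 K5 z = to_coframe_i \<alpha> \<beta> \<gamma> ** frame_i z"
    "frame_i z = from_coframe_i \<alpha> \<beta> \<gamma> ** invariant_coframe (canonical_i \<alpha>) K4 K5 z"
    by (rule invariant_coframe_canonical_i[OF T z nz K4 K5]; assumption)+
  show "invertible (frame_i z)" "structure_equations frame_i structure_i z"
    using invertible_frame_i frame_i_structure pq by blast+
qed (use holo_frame_i[OF T] structure_i_antisym in blast)+

lemma equivalent_to_form_i:
  assumes f: "holomorphic_at f a" and roots: "invariant_roots f a J4 J5"
    and I: "\<forall>\<^sub>F z in nhds a. I4 f z \<noteq> 0 \<and> I5 f z \<noteq> 0" and J4q: "\<forall>\<^sub>F z in nhds a. partial 4 J4 z \<noteq> 0"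
    and \<alpha>: "admissible \<alpha>" and b: "generic_i b" and K: "invariant_roots (canonical_i \<alpha>) b K4 K5"
    and same: "same_constant_structure (invariant_coframe f J4 J5) a (invariant_coframe (canonical_i \<alpha>) K4 K5) b"
  shows "\<exists>b. generic_i b \<and> point_equivalent f a (canonical_i \<alpha>) b"
proof -
  obtain r \<beta> \<gamma> where r: "r > 0" "ball b r \<subseteq> generic_set_i" and nz: "\<beta> \<noteq> 0" "\<gamma> \<noteq> 0"
    and K: "\<And>z. z \<in> ball b r \<Longrightarrow> K4 z = qp (\<beta> / 3) 1 1 z" "\<And>z. z \<in> ball b r \<Longrightarrow> K5 z = qp (\<gamma> / 3) 0 1 z"
    by (rule canonical_i_roots[OF \<alpha> b K]) (rule that)
  interpret canonical_coframe "canonical_i \<alpha>" K4 K5 "ball b r" frame_i structure_i "to_coframe_i \<alpha> \<beta> \<gamma>" "from_coframe_i \<alpha> \<beta> \<gamma>"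
    by (rule canonical_coframe_i[OF open_ball r(2) nz K])
  have "b \<in> ball b r" using r by simp
  from integrable_combination_near[OF f roots I J4q this same] integrate_form_i[OF _ nz, of _ a J4 J5 f \<alpha>]
  show ?thesis by metis
qed

lemma form_i_invariants:
  assumes f: "holomorphic_at f a" and \<alpha>: "admissible \<alpha>" and b: "generic_i b"
    and pe: "point_equivalent f a (canonical_i \<alpha>) b"
    and \<beta>: "\<beta>^3 = 2 * \<alpha>^3 - 9 * \<alpha>\<^sup>2 + 9 * \<alpha>" and \<gamma>: "\<gamma>\<^sup>2 = \<alpha>\<^sup>2 - 3 * \<alpha>"
  obtains J4 J5 K4 K5 where "invariant_roots f a J4 J5" "invariant_roots (canonical_i \<alpha>) b K4 K5"
    "\<forall>\<^sub>F z in nhds a. I4 f z \<noteq> 0 \<and> I5 f z \<noteq> 0 \<and> I6 f z = 0" "\<forall>\<^sub>F z in nhds a. partial 4 J4 z \<noteq> 0"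
    "\<forall>\<^sub>F z in nhds a. partial 4 J4 z / J5 z = \<beta> / \<gamma>"
    "same_constant_structure (invariant_coframe f J4 J5) a (invariant_coframe (canonical_i \<alpha>) K4 K5) b"
proof -
  let ?K4 = "qp (\<beta> / 3) 1 1" and ?K5 = "qp (\<gamma> / 3) 0 1"
  have nz: "\<beta> \<noteq> 0" "\<gamma> \<noteq> 0" using \<beta> \<gamma> admissible_nonzero[OF \<alpha>] by auto
  interpret canonical_coframe "canonical_i \<alpha>" ?K4 ?K5 generic_set_i frame_i structure_i "to_coframe_i \<alpha> \<beta> \<gamma>" "from_coframe_i \<alpha> \<beta> \<gamma>"
    by (rule canonical_coframe_i[OF open_generic_set_i order_refl nz]) simp_all
  have roots: "?K4 w ^ 3 = I4 (canonical_i \<alpha>) w" "- (?K5 w)\<^sup>2 = I5 (canonical_i \<alpha>) w" "I6 (canonical_i \<alpha>) w = 0"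
    if "w \<in> generic_set_i" for w
    unfolding invariants_canonical_i[OF generic_set_i_p_nonzero[OF that]]
    by (simp_all add: qp_def power_mult_distrib power_divide \<beta> \<gamma>)
  have ratio: "c = \<beta> / \<gamma>" if "\<exists>w\<in>generic_set_i. c = partial 4 ?K4 w / ?K5 w" for c
    using that nz by (auto simp: partial_qp qp_def[of "\<gamma> / 3"] generic_set_i_def)
  show thesis
    by (rule invariants_of_equivalent[OF f b[unfolded generic_i_iff] pe], erule roots, erule roots, erule roots)
       (rule that, assumption+, erule eventually_mono[OF _ ratio])
qed

subsection \<open>Form (ii)\<close>

lemma generic_ii_iff: "generic_ii b \<longleftrightarrow> b \<in> generic_set_ii"
  by (simp add: generic_ii_def generic_set_ii_def)

lemma holo_qp_ii: "open S \<Longrightarrow> holo_on (qp c m 0) S"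
  by (rule holo_qp) auto

lemma canonical_ii_roots:
  assumes b: "generic_ii b" and roots: "invariant_roots canonical_ii b K4 K5"
  obtains r \<kappa> \<delta> where "r > 0" "ball b r \<subseteq> generic_set_ii" "\<kappa> \<noteq> 0" "\<delta> \<noteq> 0"
    "\<And>z. z \<in> ball b r \<Longrightarrow> K4 z = qp \<kappa> 1 0 z" "\<And>z. z \<in> ball b r \<Longrightarrow> K5 z = \<delta>"
proof -
  obtain r1 where r1: "r1 > 0" "ball b r1 \<subseteq> generic_set_ii"
    using b open_generic_set_ii unfolding generic_ii_iff by (meson open_contains_ball)
  obtain r2 r3 r4 where r: "r2 > 0" "r3 > 0" "r4 > 0"
    and hol: "holo_on K4 (ball b r2)" "holo_on K5 (ball b r3)"
    and eq: "\<And>z. z \<in> ball b r4 \<Longrightarrow> K4 z ^ 3 = I4 canonical_ii z \<and> - (K5 z)\<^sup>2 = I5 canonical_ii z"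
    using roots unfolding invariant_roots_def holomorphic_at_iff_ball eventually_nhds_ball by blast
  define s where "s = min (min r1 r2) (min r3 r4)"
  have s: "s > 0" "s \<le> r1" "s \<le> r2" "s \<le> r3" "s \<le> r4" using r r1 by (auto simp: s_def)
  have g: "ball b s \<subseteq> generic_set_ii" using r1 s by (meson order_trans subset_ball)
  have gz: "z $ 4 \<noteq> 0" if "z \<in> ball b s" for z
    using g that by (auto simp: generic_set_ii_def)
  have K: "holo_on K4 (ball b s)" "holo_on K5 (ball b s)"
    using hol s by (auto intro: holo_on_ball_mono)
  have eqs: "K4 z ^ 3 = 2 / 27 * qp 1 1 0 z ^ 3" "(K5 z)\<^sup>2 = 1 / 9 * (1::complex)\<^sup>2" if z: "z \<in> ball b s" for z
  proof -
    have z4: "z \<in> ball b r4" using z s by auto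
    from eq[OF z4] show "K4 z ^ 3 = 2 / 27 * qp 1 1 0 z ^ 3"
      by (simp add: invariants_canonical_ii qp_def)
    from eq[OF z4] have "(K5 z)\<^sup>2 = - qp (- (1 / 9)) 0 0 z"
      unfolding invariants_canonical_ii by (metis minus_minus)
    then show "(K5 z)\<^sup>2 = 1 / 9 * 1\<^sup>2" by (simp add: qp_def)
  qed
  obtain \<kappa> where \<kappa>: "\<kappa> ^ 3 = 2 / 27" "\<And>z. z \<in> ball b s \<Longrightarrow> K4 z = \<kappa> * qp 1 1 0 z"
    by (rule root_of_power[OF K(1) holo_qp_ii[OF open_ball] s(1) _ _ _ eqs(1)])
       (use gz that in \<open>auto simp: qp_def simp del: mem_ball\<close>)
  obtain \<delta> where \<delta>: "\<delta>\<^sup>2 = 1 / 9" "\<And>z. z \<in> ball b s \<Longrightarrow> K5 z = \<delta> * 1"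
    by (rule root_of_power[OF K(2) holo_const[OF open_ball] s(1) _ _ _ eqs(2)])
       (use that in \<open>auto simp del: mem_ball\<close>)
  show thesis
  proof (rule that[OF s(1) g, of \<kappa> \<delta>])
    show "\<kappa> \<noteq> 0" "\<delta> \<noteq> 0"
      using \<kappa>(1) \<delta>(1) by auto
  qed (use \<kappa>(2) \<delta>(2) in \<open>auto simp: qp_def simp del: mem_ball\<close>)
qed

lemma canonical_coframe_ii:
  assumes T: "open T" "T \<subseteq> generic_set_ii" and nz: "\<kappa> \<noteq> 0" "\<delta> \<noteq> 0"
    and K4: "\<And>z. z \<in> T \<Longrightarrow> K4 z = qp \<kappa> 1 0 z" and K5: "\<And>z. z \<in> T \<Longrightarrow> K5 z = \<delta>"
  shows "canonical_coframe canonical_ii K4 K5 T frame_ii structure_ii (to_coframe_ii \<kappa> \<delta>) (from_coframe_ii \<kappa> \<delta>)"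
proof
  show "holo_on canonical_ii T"
    unfolding canonical_ii_qp by (rule holo_qp_ii[OF T(1)])
  show "holo_on K4 T" "holo_on K5 T"
    using K4 K5 by (auto intro: holo_on_cong[OF holo_qp_ii[OF T(1)]] holo_on_cong[OF holo_const[OF T(1)]])
  fix z assume z: "z \<in> T"
  then have q: "z $ 4 \<noteq> 0" "z \<in> generic_set_ii" using T(2) by (auto simp: generic_set_ii_def)
  show "K4 z \<noteq> 0" "K5 z \<noteq> 0" using q nz by (simp_all add: K4[OF z] K5[OF z] qp_def)
  show "partial 4 K4 z \<noteq> 0"
    using partial_cong[OF T(1) K4 z, where i=4] nz by (simp add: partial_qp)
  show "invariant_coframe canonical_ii K4 K5 z = to_coframe_ii \<kappa> \<delta> ** frame_ii z"
    "frame_ii z = from_coframe_ii \<kappa> \<delta> ** invariant_coframe canonical_ii K4 K5 z"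
    by (rule invariant_coframe_canonical_ii[OF T z nz K4 K5]; assumption)+
  show "invertible (frame_ii z)" "structure_equations frame_ii structure_ii z"
    using invertible_frame_ii frame_ii_structure q by blast+
qed (use holo_frame_ii[OF T] structure_ii_antisym in blast)+

lemma equivalent_to_form_ii:
  assumes f: "holomorphic_at f a" and roots: "invariant_roots f a J4 J5"
    and I: "\<forall>\<^sub>F z in nhds a. I4 f z \<noteq> 0 \<and> I5 f z \<noteq> 0" and J4q: "\<forall>\<^sub>F z in nhds a. partial 4 J4 z \<noteq> 0"
    and b: "generic_ii b" and K: "invariant_roots canonical_ii b K4 K5"
    and same: "same_constant_structure (invariant_coframe f J4 J5) a (invariant_coframe canonical_ii K4 K5) b"
  shows "\<exists>b. generic_ii b \<and> point_equivalent f a canonical_ii b"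
proof -
  obtain r \<kappa> \<delta> where r: "r > 0" "ball b r \<subseteq> generic_set_ii" and nz: "\<kappa> \<noteq> 0" "\<delta> \<noteq> 0"
    and K: "\<And>z. z \<in> ball b r \<Longrightarrow> K4 z = qp \<kappa> 1 0 z" "\<And>z. z \<in> ball b r \<Longrightarrow> K5 z = \<delta>"
    by (rule canonical_ii_roots[OF b K]) (rule that)
  interpret canonical_coframe canonical_ii K4 K5 "ball b r" frame_ii structure_ii "to_coframe_ii \<kappa> \<delta>" "from_coframe_ii \<kappa> \<delta>"
    by (rule canonical_coframe_ii[OF open_ball r(2) nz K])
  have "b \<in> ball b r" using r by simp
  from integrable_combination_near[OF f roots I J4q this same] integrate_form_ii[OF _ nz, of _ a J4 J5 f]
  show ?thesis by metis
qed

lemma form_ii_invariants: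
  fixes \<kappa> \<delta> :: complex
  assumes f: "holomorphic_at f a" and b: "generic_ii b" and pe: "point_equivalent f a canonical_ii b"
    and \<kappa>: "\<kappa>^3 = 2 / 27" and \<delta>: "\<delta>\<^sup>2 = 1 / 9"
  obtains J4 J5 K4 K5 where "invariant_roots f a J4 J5" "invariant_roots canonical_ii b K4 K5"
    "\<forall>\<^sub>F z in nhds a. I4 f z \<noteq> 0 \<and> I5 f z \<noteq> 0 \<and> I6 f z = 0" "\<forall>\<^sub>F z in nhds a. partial 4 J4 z \<noteq> 0"
    "same_constant_structure (invariant_coframe f J4 J5) a (invariant_coframe canonical_ii K4 K5) b"
proof -
  let ?K4 = "qp \<kappa> 1 0" and ?K5 = "\<lambda>z :: complex^4. \<delta>"
  have nz: "\<kappa> \<noteq> 0" "\<delta> \<noteq> 0" using \<kappa> \<delta> by auto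
  interpret canonical_coframe canonical_ii ?K4 ?K5 generic_set_ii frame_ii structure_ii "to_coframe_ii \<kappa> \<delta>" "from_coframe_ii \<kappa> \<delta>"
    by (rule canonical_coframe_ii[OF open_generic_set_ii order_refl nz]) simp_all
  have roots: "?K4 w ^ 3 = I4 canonical_ii w" "- (?K5 w)\<^sup>2 = I5 canonical_ii w" "I6 canonical_ii w = 0" for w
    unfolding invariants_canonical_ii by (simp_all add: qp_def power_mult_distrib \<kappa> \<delta>)
  show thesis
    by (rule invariants_of_equivalent[OF f b[unfolded generic_ii_iff] pe roots]) (rule that)
qed

subsection \<open>The parameter of form (i)\<close>

text \<open>Exchanging x and u maps form (i) with parameter \<open>\<alpha>\<close> to form (i) with parameter \<open>3 - \<alpha>\<close>.\<close>

lemma form_i_swap: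
  assumes f: "holomorphic_at f a" and b: "generic_i b" and pe: "point_equivalent f a (canonical_i \<alpha>) b"
  shows "\<exists>b. generic_i b \<and> point_equivalent f a (canonical_i (3 - \<alpha>)) b"
proof -
  have g: "holo_on (canonical_i \<alpha>) generic_set_i"
    unfolding canonical_i_qp by (rule holo_qp_i[OF open_generic_set_i order_refl])
  obtain X U P Q r where r: "r > 0" and pt: "point_transformation f (canonical_i \<alpha>) X U P Q (ball a r) generic_set_i"
    by (rule point_equivalentE[OF f pe g b[unfolded generic_i_iff]]) (rule that)
  interpret point_transformation f "canonical_i \<alpha>" X U P Q "ball a r" generic_set_i by (rule pt)
  have PQ: "P z \<noteq> 0" "Q z \<noteq> 0" if "z \<in> ball a r" for z
    using in_T[OF that] by (simp_all add: generic_set_i_def)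
  have a: "a \<in> ball a r" using r by simp
  define P' where "P' z = 1 / P z" for z
  define Q' where "Q' z = - Q z / P z ^ 3" for z
  have DP': "D P' z = - (lam z * Q z) / (P z)\<^sup>2" if z: "z \<in> ball a r" for z
    unfolding P'_def[abs_def]
    by (subst total_deriv_divide[OF holo_const[OF openS] holo_P PQ(1) z]) (use D_jet[OF z] in simp_all)
  have DQ': "D Q' z = (- (lam z * (\<alpha> * (Q z)\<^sup>2 / P z)) * P z ^ 3 + Q z * (3 * (P z)\<^sup>2 * (lam z * Q z))) / (P z ^ 3)\<^sup>2"
    if z: "z \<in> ball a r" for z
  proof -
    have cube: "D (\<lambda>z. P z ^ 3) z = 3 * (P z)\<^sup>2 * (lam z * Q z)"
      unfolding power3_eq_cube
      by (simp add: total_deriv_mult[where S="ball a r"] holo_mult holo_P z D_jet[OF z] power2_eq_square del: mem_ball)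
    have min: "D (\<lambda>z. - Q z) z = - (lam z * (\<alpha> * (Q z)\<^sup>2 / P z))"
      using total_deriv_cmult[OF holo_Q z, of f "-1"] D_jet(4)[OF z] by (simp add: canonical_i_def)
    show ?thesis
      unfolding Q'_def[abs_def]
      by (subst total_deriv_divide[OF holo_minus[OF holo_Q] holo_power[OF holo_P] _ z])
         (use PQ in \<open>simp_all add: cube min del: mem_ball\<close>)
  qed
  have "point_equivalent f a (canonical_i (3 - \<alpha>)) (vector [U a, X a, P' a, Q' a])"
  proof (rule point_equivalentI[OF r U X])
    show "partial 1 U a * partial 2 X a - partial 2 U a * partial 1 X a \<noteq> 0"
      using jacobian[OF a] by (simp add: algebra_simps)
    fix z assume z: "z \<in> ball a r"
    note nz = lam_nonzero[OF z] PQ[OF z]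
    show "D U z \<noteq> 0" using nz by (simp add: D_jet[OF z])
    show "D X z = P' z * D U z" using nz by (simp add: D_jet[OF z] P'_def)
    show "D P' z = Q' z * D U z" using nz by (simp add: D_jet[OF z] DP'[OF z] Q'_def field_simps power2_eq_square power3_eq_cube)
    show "D Q' z = canonical_i (3 - \<alpha>) (vector [U z, X z, P' z, Q' z]) * D U z"
      using nz by (simp add: D_jet[OF z] DQ'[OF z] canonical_i_def P'_def Q'_def field_simps power2_eq_square power3_eq_cube)
  qed (use X_base U_base in auto)
  moreover have "generic_i (vector [U a, X a, P' a, Q' a])"
    using PQ[OF a] by (simp add: generic_i_def P'_def Q'_def)
  ultimately show ?thesis by blast
qed

text \<open>The sixth power of \<open>J4_q / J5\<close> is the same for all choices of the roots, because
  \<open>3 J4^2 J4_q = I4_q\<close>.\<close>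

lemma ratio_unique:
  assumes roots: "invariant_roots f a J4 J5" "invariant_roots f a L4 L5"
    and I: "\<forall>\<^sub>F z in nhds a. I4 f z \<noteq> 0 \<and> I5 f z \<noteq> 0 \<and> I6 f z = 0"
  shows "(partial 4 J4 a / J5 a) ^ 6 = (partial 4 L4 a / L5 a) ^ 6"
proof -
  have cube: "(partial 4 J a) ^ 3 * (27 * I4 f a ^ 2) = (partial 4 (I4 f) a) ^ 3"
    if inv: "invariant_roots f a J J'" for J J'
  proof -
    obtain r1 where r1: "r1 > 0" "holo_on J (ball a r1)"
      using inv unfolding invariant_roots_def holomorphic_at_iff_ball by blast
    have "\<exists>r>0. \<forall>z\<in>ball a r. J z ^ 3 = I4 f z \<and> - (J' z)\<^sup>2 = I5 f z"
      using inv unfolding invariant_roots_def eventually_nhds_ball by blast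
    then obtain r2 where r2: "r2 > 0" "\<And>z. z \<in> ball a r2 \<Longrightarrow> J z ^ 3 = I4 f z"
      by blast
    have "partial 4 (I4 f) a = partial 4 (\<lambda>z. J z ^ 3) a"
      by (rule partial_cong[OF open_ball[of a r2]]) (use r2 in auto)
    also have "\<dots> = 3 * (J a)\<^sup>2 * partial 4 J a"
      using partial_power[OF r1(2), of a 4 3] r1(1) by simp
    finally show ?thesis
      using r2(2)[of a, symmetric] r2(1) by (simp add: power_mult_distrib flip: power_mult)
  qed
  have nz: "I4 f a \<noteq> 0" "I5 f a \<noteq> 0"
    using eventually_nhds_x_imp_x[OF I] by auto
  have sq: "(J' a)\<^sup>2 = - I5 f a" if "invariant_roots f a J J'" for J J'
    using that eventually_nhds_x_imp_x unfolding invariant_roots_def by (metis (mono_tags, lifting) minus_minus)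
  have "(partial 4 J4 a) ^ 3 = (partial 4 L4 a) ^ 3"
    using cube[OF roots(1)] cube[OF roots(2)] nz by (metis mult_cancel_right mult_eq_0_iff power_not_zero zero_neq_numeral)
  moreover have "(x / y) ^ 6 = (x ^ 3)\<^sup>2 / (y\<^sup>2) ^ 3" for x y :: complex
    by (simp add: power_divide flip: power_mult)
  ultimately show ?thesis by (simp only: sq[OF roots(1)] sq[OF roots(2)])
qed

text \<open>The sixth power of \<open>\<beta> / \<gamma>\<close> is \<open>4 + 9 / (\<alpha>^2 - 3 \<alpha>)\<close>, and \<open>\<alpha>^2 - 3 \<alpha>\<close> determines \<open>\<alpha>\<close> up to the exchange
  of \<open>\<alpha>\<close> and \<open>3 - \<alpha>\<close>.\<close>

lemma ratio_determines_parameter: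
  assumes \<alpha>: "admissible \<alpha>" "admissible \<alpha>'"
    and \<beta>: "\<beta> ^ 3 = 2 * \<alpha> ^ 3 - 9 * \<alpha>\<^sup>2 + 9 * \<alpha>" "\<gamma>\<^sup>2 = \<alpha>\<^sup>2 - 3 * \<alpha>"
    and \<beta>': "\<beta>' ^ 3 = 2 * \<alpha>' ^ 3 - 9 * \<alpha>'\<^sup>2 + 9 * \<alpha>'" "\<gamma>'\<^sup>2 = \<alpha>'\<^sup>2 - 3 * \<alpha>'"
    and eq: "(\<beta> / \<gamma>) ^ 6 = (\<beta>' / \<gamma>') ^ 6"
  shows "\<alpha>' = \<alpha> \<or> \<alpha>' = 3 - \<alpha>"
proof -
  have r: "(\<beta> / \<gamma>) ^ 6 = 4 + 9 / (\<alpha>\<^sup>2 - 3 * \<alpha>)"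
    if "admissible \<alpha>" "\<beta> ^ 3 = 2 * \<alpha> ^ 3 - 9 * \<alpha>\<^sup>2 + 9 * \<alpha>" "\<gamma>\<^sup>2 = \<alpha>\<^sup>2 - 3 * \<alpha>" for \<alpha> \<beta> \<gamma>
  proof -
    have d: "\<alpha>\<^sup>2 - 3 * \<alpha> \<noteq> 0" by (rule admissible_nonzero[OF that(1)])
    have "(\<beta> / \<gamma>) ^ 6 = (\<beta> ^ 3)\<^sup>2 / (\<gamma>\<^sup>2) ^ 3"
      by (simp add: power_divide flip: power_mult)
    also have "(\<beta> ^ 3)\<^sup>2 = (\<alpha>\<^sup>2 - 3 * \<alpha>)\<^sup>2 * (4 * (\<alpha>\<^sup>2 - 3 * \<alpha>) + 9)"
      unfolding that(2) by (simp add: algebra_simps power2_eq_square power3_eq_cube)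
    also have "\<dots> / (\<gamma>\<^sup>2) ^ 3 = 4 + 9 / (\<alpha>\<^sup>2 - 3 * \<alpha>)"
      unfolding that(3) using d by (simp add: divide_simps power2_eq_square power3_eq_cube)
    finally show ?thesis .
  qed
  have "4 + 9 / (\<alpha>\<^sup>2 - 3 * \<alpha>) = 4 + 9 / (\<alpha>'\<^sup>2 - 3 * \<alpha>')"
    using eq r[OF \<alpha>(1) \<beta>] r[OF \<alpha>(2) \<beta>'] by simp
  then have "\<alpha>\<^sup>2 - 3 * \<alpha> = \<alpha>'\<^sup>2 - 3 * \<alpha>'"
    using admissible_nonzero(2)[OF \<alpha>(1)] admissible_nonzero(2)[OF \<alpha>(2)] by (simp add: frac_eq_eq)
  then have "(\<alpha>' - \<alpha>) * (\<alpha>' - (3 - \<alpha>)) = 0"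
    by (simp add: algebra_simps power2_eq_square)
  then show ?thesis by auto
qed

lemma complex_root_exists:
  assumes "n > 0"
  shows "\<exists>x :: complex. x ^ n = c"
  using assms by (metis exists_complex_root not_gr_zero)

section \<open>Point symmetries of the canonical forms\<close>

lemma poly_eventually_zero:
  fixes p :: "complex poly"
  assumes "\<forall>\<^sub>F x in nhds c. poly p x = 0"
  shows "p = 0"
proof (rule ccontr)
  assume "p \<noteq> 0"
  then have "finite {x. poly p x = 0}" by (rule poly_roots_finite)
  moreover obtain N where N: "open N" "c \<in> N" "\<And>x. x \<in> N \<Longrightarrow> poly p x = 0"
    using assms unfolding eventually_nhds by blast
  ultimately have "finite N" using finite_subset[of N "{x. poly p x = 0}"] by auto
  with N show False using finite_imp_not_open by blast
qed

lemma norm_vec4_le: "norm (z :: complex^4) \<le> norm (z $ 1) + norm (z $ 2) + norm (z $ 3) + norm (z $ 4)"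
  using L2_set_le_sum[of UNIV "\<lambda>i. norm (z $ i)"] by (simp add: norm_vec_def sum_4)

lemma norm_vec2_le: "norm (z :: complex^2) \<le> norm (z $ 1) + norm (z $ 2)"
  using L2_set_le_sum[of UNIV "\<lambda>i. norm (z $ i)"] by (simp add: norm_vec_def sum_2)

lemma base_nth [simp]: "base z $ 1 = z $ 1" "base z $ 2 = z $ 2"
  by (simp_all add: base_def)

text \<open>With (x, u) fixed first, then p, the determining equation is a polynomial in q whose coefficients
  are polynomials in p, and the coefficients can be compared one variable at a time.\<close>

lemma eventually_jets:
  assumes "\<forall>\<^sub>F z in nhds (a :: complex^4). R z"
  shows "\<forall>\<^sub>F w in nhds (base a). \<forall>\<^sub>F p in nhds (a $ 3). \<forall>\<^sub>F q in nhds (a $ 4). R (vector [w $ 1, w $ 2, p, q])"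
proof -
  obtain r where r: "r > 0" "\<And>z. z \<in> ball a r \<Longrightarrow> R z"
    using assms unfolding eventually_nhds_ball by blast
  have "R (vector [w $ 1, w $ 2, p, q])"
    if w: "w \<in> ball (base a) (r / 4)" and p: "p \<in> ball (a $ 3) (r / 4)" and q: "q \<in> ball (a $ 4) (r / 4)" for w p q
  proof (rule r(2))
    have "norm ((w - base a) $ i) < r / 4" for i
    proof -
      have "norm ((w - base a) $ i) \<le> norm (w - base a)" by (rule Finite_Cartesian_Product.norm_nth_le)
      then show ?thesis using w by (simp add: dist_norm norm_minus_commute)
    qed
    from this[of 1] this[of 2] have "norm (w $ 1 - a $ 1) < r / 4" "norm (w $ 2 - a $ 2) < r / 4"
      by simp_all
    then have "norm (vector [w $ 1, w $ 2, p, q] - a) < r"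
      using norm_vec4_le[of "vector [w $ 1, w $ 2, p, q] - a"] p q by (simp add: dist_norm norm_minus_commute)
    then show "vector [w $ 1, w $ 2, p, q] \<in> ball a r"
      by (simp add: dist_norm norm_minus_commute)
  qed
  moreover have r4: "r / 4 > 0" using r by simp
  ultimately show ?thesis
    unfolding eventually_nhds_ball by blast
qed

lemma eventually_on_axes:
  assumes "\<forall>\<^sub>F w in nhds (b :: complex^2). R w"
  shows "\<forall>\<^sub>F x in nhds (b $ 1). R (vector [x, b $ 2])" "\<forall>\<^sub>F u in nhds (b $ 2). R (vector [b $ 1, u])"
proof -
  obtain r where r: "r > 0" "\<And>w. w \<in> ball b r \<Longrightarrow> R w"
    using assms unfolding eventually_nhds_ball by blast
  have "vector [x, b $ 2] \<in> ball b r" if "x \<in> ball (b $ 1) r" for x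
    using norm_vec2_le[of "b - vector [x, b $ 2]"] that by (simp add: dist_norm)
  moreover have "vector [b $ 1, u] \<in> ball b r" if "u \<in> ball (b $ 2) r" for u
    using norm_vec2_le[of "b - vector [b $ 1, u]"] that by (simp add: dist_norm)
  ultimately show "\<forall>\<^sub>F x in nhds (b $ 1). R (vector [x, b $ 2])" "\<forall>\<^sub>F u in nhds (b $ 2). R (vector [b $ 1, u])"
    using r unfolding eventually_nhds_ball by blast+
qed

lemma total_deriv_base:
  assumes "holo_on F W" "base z \<in> W"
  shows "total_deriv f (\<lambda>z. F (base z)) z = partial 1 F (base z) + z $ 3 * partial 2 F (base z)"
proof -
  have "open {z. base z \<in> W}" using open_base_vimage[OF holo_on_open[OF assms(1)]] .
  then obtain S where S: "open S" "z \<in> S" and W: "\<And>w. w \<in> S \<Longrightarrow> base w \<in> W"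
    using assms(2) by blast
  note p = partial_base[OF assms S W]
  show ?thesis
    unfolding total_deriv_def by (simp only: p mult_zero_right add_0_right)
qed

text \<open>The prolongation coefficients of \<open>\<xi> \<partial>\<^sub>x + \<eta> \<partial>\<^sub>u\<close>, with the last one split by powers of q and f. The terms
  free of q and f are the third derivative of \<open>\<eta> - p \<xi>\<close> along lines of slope p, with p held constant.\<close>

definition prol1 :: "(complex^2 \<Rightarrow> complex) \<Rightarrow> (complex^2 \<Rightarrow> complex) \<Rightarrow> complex^4 \<Rightarrow> complex" where
  "prol1 \<xi> \<eta> z = (let w = base z; p = z $ 3 in
     partial 1 \<eta> w + p * (partial 2 \<eta> w - partial 1 \<xi> w) - p\<^sup>2 * partial 2 \<xi> w)"

definition prol2 :: "(complex^2 \<Rightarrow> complex) \<Rightarrow> (complex^2 \<Rightarrow> complex) \<Rightarrow> complex^4 \<Rightarrow> complex" where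
  "prol2 \<xi> \<eta> z = (let w = base z; p = z $ 3; q = z $ 4 in
     partial 1 (partial 1 \<eta>) w + p * (2 * partial 1 (partial 2 \<eta>) w - partial 1 (partial 1 \<xi>) w)
     + p\<^sup>2 * (partial 2 (partial 2 \<eta>) w - 2 * partial 1 (partial 2 \<xi>) w) - p^3 * partial 2 (partial 2 \<xi>) w
     + q * (partial 2 \<eta> w - 2 * partial 1 \<xi> w - 3 * p * partial 2 \<xi> w))"

definition prol3_0 :: "(complex^2 \<Rightarrow> complex) \<Rightarrow> (complex^2 \<Rightarrow> complex) \<Rightarrow> complex^2 \<Rightarrow> complex \<Rightarrow> complex" where
  "prol3_0 \<xi> \<eta> w p = partial 1 (partial 1 (partial 1 \<eta>)) w
     + p * (3 * partial 1 (partial 1 (partial 2 \<eta>)) w - partial 1 (partial 1 (partial 1 \<xi>)) w)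
     + p\<^sup>2 * (3 * partial 1 (partial 2 (partial 2 \<eta>)) w - 3 * partial 1 (partial 1 (partial 2 \<xi>)) w)
     + p^3 * (partial 2 (partial 2 (partial 2 \<eta>)) w - 3 * partial 1 (partial 2 (partial 2 \<xi>)) w)
     - p^4 * partial 2 (partial 2 (partial 2 \<xi>)) w"

definition prol3 :: "(complex^4 \<Rightarrow> complex) \<Rightarrow> (complex^2 \<Rightarrow> complex) \<Rightarrow> (complex^2 \<Rightarrow> complex) \<Rightarrow> complex^4 \<Rightarrow> complex" where
  "prol3 f \<xi> \<eta> z = (let w = base z; p = z $ 3; q = z $ 4 in
     prol3_0 \<xi> \<eta> w p
     + q * (3 * (partial 1 (partial 2 \<eta>) w - partial 1 (partial 1 \<xi>) w)
         + p * (3 * partial 2 (partial 2 \<eta>) w - 9 * partial 1 (partial 2 \<xi>) w) - 6 * p\<^sup>2 * partial 2 (partial 2 \<xi>) w)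
     - 3 * q\<^sup>2 * partial 2 \<xi> w
     + f z * (partial 2 \<eta> w - 3 * partial 1 \<xi> w - 4 * p * partial 2 \<xi> w))"

text \<open>The determining equation of point symmetries with the prolongation coefficients expanded.\<close>

definition symmetry_equation :: "(complex^4 \<Rightarrow> complex) \<Rightarrow> (complex^2 \<Rightarrow> complex) \<Rightarrow> (complex^2 \<Rightarrow> complex) \<Rightarrow> complex^4 \<Rightarrow> bool" where
  "symmetry_equation f \<xi> \<eta> z \<longleftrightarrow> prol3 f \<xi> \<eta> z = \<xi> (base z) * partial 1 f z + \<eta> (base z) * partial 2 f z
     + prol1 \<xi> \<eta> z * partial 3 f z + prol2 \<xi> \<eta> z * partial 4 f z"

lemma prolongation:
  fixes f :: "complex^4 \<Rightarrow> complex"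
  assumes \<xi>: "holo_on \<xi> W" and \<eta>: "holo_on \<eta> W" and z: "base z \<in> W"
  defines "\<eta>1 \<equiv> \<lambda>z. total_deriv f (\<lambda>z. \<eta> (base z)) z - z $ 3 * total_deriv f (\<lambda>z. \<xi> (base z)) z"
  defines "\<eta>2 \<equiv> \<lambda>z. total_deriv f \<eta>1 z - z $ 4 * total_deriv f (\<lambda>z. \<xi> (base z)) z"
  shows "\<eta>1 z = prol1 \<xi> \<eta> z" "\<eta>2 z = prol2 \<xi> \<eta> z"
    "total_deriv f \<eta>2 z - f z * total_deriv f (\<lambda>z. \<xi> (base z)) z = prol3 f \<xi> \<eta> z"
proof -
  define S where "S = {z. base z \<in> W}"
  have S: "open S" unfolding S_def by (rule open_base_vimage[OF holo_on_open[OF \<xi>]])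
  have zS: "z \<in> S" using z by (simp add: S_def)
  have hb: "holo_on (\<lambda>z. F (base z)) S" if "holo_on F W" for F
    using partial_base(5)[OF that z S zS] by (simp add: S_def)
  have Db: "total_deriv f (\<lambda>z. F (base z)) w = partial 1 F (base w) + w $ 3 * partial 2 F (base w)"
    if "holo_on F W" "w \<in> S" for F w
    using total_deriv_base[OF that(1)] that(2) by (simp add: S_def)
  have D34: "total_deriv f (\<lambda>z. z $ 3) w = w $ 4" "total_deriv f (\<lambda>z. z $ 4) w = f w" for w
    by (simp_all add: total_deriv_def)
  have W: "base w \<in> W" if "w \<in> S" for w using that by (simp add: S_def)
  have c2: "partial 2 (partial 1 F) w = partial 1 (partial 2 F) w" if "holo_on F W" "w \<in> W" for F w
    by (rule partial_commute[OF that])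
  have c3: "partial 2 (partial 1 (partial 2 F)) w = partial 1 (partial 2 (partial 2 F)) w"
    "partial 2 (partial 1 (partial 1 F)) w = partial 1 (partial 1 (partial 2 F)) w" if F: "holo_on F W" and w: "w \<in> W" for F w
  proof -
    show "partial 2 (partial 1 (partial 2 F)) w = partial 1 (partial 2 (partial 2 F)) w"
      by (rule c2[OF holo_partial[OF F] w])
    have "partial 2 (partial 1 (partial 1 F)) w = partial 1 (partial 2 (partial 1 F)) w"
      by (rule c2[OF holo_partial[OF F] w])
    also have "\<dots> = partial 1 (partial 1 (partial 2 F)) w"
      by (rule partial_cong[OF holo_on_open[OF F] c2[OF F] w])
    finally show "partial 2 (partial 1 (partial 1 F)) w = partial 1 (partial 1 (partial 2 F)) w" .
  qed
  note h = holo_add holo_diff holo_mult hb holo_partial \<xi> \<eta> holo_nth[OF S] holo_const[OF S]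
  note d = total_deriv_add[where S=S] total_deriv_diff[where S=S] total_deriv_mult[where S=S]
  have 1: "\<eta>1 w = prol1 \<xi> \<eta> w" if w: "w \<in> S" for w
    unfolding \<eta>1_def Db[OF \<xi> w] Db[OF \<eta> w] prol1_def Let_def by (simp add: algebra_simps power2_eq_square)
  then show "\<eta>1 z = prol1 \<xi> \<eta> z"
    using zS by blast
  have 2: "\<eta>2 w = prol2 \<xi> \<eta> w" if w: "w \<in> S" for w
  proof -
    have "total_deriv f \<eta>1 w = total_deriv f (prol1 \<xi> \<eta>) w"
      by (rule total_deriv_cong[OF S _ w]) (rule 1)
    then show ?thesis
      unfolding \<eta>2_def prol1_def[abs_def] prol2_def Let_def power2_eq_square power3_eq_cube Db[OF \<xi> w]
      by (simp add: d h w Db[OF _ w] D34 c2[OF \<xi> W[OF w]] c2[OF \<eta> W[OF w]]) (simp add: algebra_simps)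
  qed
  then show "\<eta>2 z = prol2 \<xi> \<eta> z"
    using zS by blast
  have "total_deriv f \<eta>2 z = total_deriv f (prol2 \<xi> \<eta>) z"
    by (rule total_deriv_cong[OF S _ zS]) (rule 2)
  then show "total_deriv f \<eta>2 z - f z * total_deriv f (\<lambda>z. \<xi> (base z)) z = prol3 f \<xi> \<eta> z"
    unfolding prol2_def[abs_def] prol3_def prol3_0_def Let_def power2_eq_square power3_eq_cube power4_eq_xxxx Db[OF \<xi> zS]
    by (simp add: d h zS Db[OF _ zS] D34 c2[OF \<xi> W[OF zS]] c2[OF \<eta> W[OF zS]] c3[OF \<xi> W[OF zS]] c3[OF \<eta> W[OF zS]])
       (simp add: algebra_simps)
qed

lemma point_symmetry_iff:
  assumes \<xi>: "holo_on (\<lambda>w. V w $ 1) W" and \<eta>: "holo_on (\<lambda>w. V w $ 2) W" and a: "base a \<in> W"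
  shows "point_symmetry f a V \<longleftrightarrow> (\<forall>\<^sub>F z in nhds a. symmetry_equation f (\<lambda>w. V w $ 1) (\<lambda>w. V w $ 2) z)"
proof -
  have "\<forall>\<^sub>F z in nhds a. base z \<in> W"
    using eventually_nhds_in_open[OF open_base_vimage[OF holo_on_open[OF \<xi>]]] a by simp
  then show ?thesis
    unfolding point_symmetry_def Let_def
    using holo_on_imp_holomorphic_at[OF \<xi> a] holo_on_imp_holomorphic_at[OF \<eta> a]
    by (auto simp: symmetry_equation_def prolongation[OF \<xi> \<eta>] elim: eventually_elim2)
qed

lemma partial_affine [simp]:
  "partial 1 (\<lambda>w::complex^2. k + c1 * w $ 1 + c2 * w $ 2) = (\<lambda>w. c1)"
  "partial 2 (\<lambda>w::complex^2. k + c1 * w $ 1 + c2 * w $ 2) = (\<lambda>w. c2)"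
  and holo_affine: "holo_on (\<lambda>w::complex^2. k + c1 * w $ 1 + c2 * w $ 2) UNIV"
proof -
  have U: "open (UNIV :: (complex^2) set)" by simp
  note h = holo_add holo_mult holo_nth[OF U] holo_const[OF U]
  show "holo_on (\<lambda>w::complex^2. k + c1 * w $ 1 + c2 * w $ 2) UNIV"
    by (intro h)
  have "partial i (\<lambda>w::complex^2. k + c1 * w $ 1 + c2 * w $ 2) w = c1 * (if i = 1 then 1 else 0) + c2 * (if i = 2 then 1 else 0)" for i w
    by (simp add: partial_add[where S=UNIV] partial_mult[where S=UNIV] h)
  then show "partial 1 (\<lambda>w::complex^2. k + c1 * w $ 1 + c2 * w $ 2) = (\<lambda>w. c1)"
    "partial 2 (\<lambda>w::complex^2. k + c1 * w $ 1 + c2 * w $ 2) = (\<lambda>w. c2)"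
    by (auto simp: fun_eq_iff)
qed

lemma affine_if_constant_partials:
  fixes F :: "complex^2 \<Rightarrow> complex"
  assumes F: "holo_on F (ball b r)"
    and c: "\<And>w. w \<in> ball b r \<Longrightarrow> partial 1 F w = c1" "\<And>w. w \<in> ball b r \<Longrightarrow> partial 2 F w = c2"
  obtains k where "\<And>w. w \<in> ball b r \<Longrightarrow> F w = k + c1 * w $ 1 + c2 * w $ 2"
proof -
  define G where "G w = F w - (F b + c1 * w $ 1 + c2 * w $ 2)" for w
  note h = holo_on_subset[OF holo_affine[of "F b" c1 c2] open_ball subset_UNIV, of b r]
  have "holo_on G (ball b r)"
    unfolding G_def[abs_def] by (intro holo_diff F h)
  moreover have "partial i G w = 0" if w: "w \<in> ball b r" for w i
    using exhaust_2[of i] c[OF w] unfolding G_def[abs_def] partial_diff[OF F h w] by auto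
  ultimately have "G w = G b" if "w \<in> ball b r" for w
    using constant_if_partials_vanish that by blast
  then show thesis
    by (intro that[of "G b + F b"]) (simp add: G_def algebra_simps)
qed

lemma second_partials_zero:
  assumes F: "holo_on F (ball b r)" and c: "\<And>w. w \<in> ball b r \<Longrightarrow> partial j F w = c" and w: "w \<in> ball b r"
  shows "partial i (partial j F) w = 0" "partial j (partial i F) w = 0"
  using partial_cong[OF open_ball c w, where i=i] partial_commute[OF F w, of j i] by simp_all

lemma symmetry_on_fibres:
  assumes V: "point_symmetry f a V" and \<xi>_def: "\<xi> = (\<lambda>w. V w $ 1)" and \<eta>_def: "\<eta> = (\<lambda>w. V w $ 2)"
  obtains t where "t > 0" "holo_on \<xi> (ball (base a) t)" "holo_on \<eta> (ball (base a) t)"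
    "\<And>w. w \<in> ball (base a) t \<Longrightarrow>
      \<forall>\<^sub>F p in nhds (a $ 3). \<forall>\<^sub>F q in nhds (a $ 4). symmetry_equation f \<xi> \<eta> (vector [w $ 1, w $ 2, p, q])"
proof -
  obtain r1 r2 where r12: "r1 > 0" "holo_on \<xi> (ball (base a) r1)" "r2 > 0" "holo_on \<eta> (ball (base a) r2)"
    using V unfolding point_symmetry_def holomorphic_at_iff_ball \<xi>_def \<eta>_def by blast
  define s where "s = min r1 r2"
  have s: "s > 0" "holo_on \<xi> (ball (base a) s)" "holo_on \<eta> (ball (base a) s)"
    using r12 by (auto simp: s_def intro: holo_on_ball_mono)
  have "base a \<in> ball (base a) s" using s by simp
  from V[unfolded point_symmetry_iff[OF s(2,3)[unfolded \<xi>_def \<eta>_def] this]]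
  have "\<forall>\<^sub>F z in nhds a. symmetry_equation f \<xi> \<eta> z"
    unfolding \<xi>_def \<eta>_def .
  from eventually_jets[OF this] obtain t0 where t0: "t0 > 0"
    "\<And>w. w \<in> ball (base a) t0 \<Longrightarrow>
      \<forall>\<^sub>F p in nhds (a $ 3). \<forall>\<^sub>F q in nhds (a $ 4). symmetry_equation f \<xi> \<eta> (vector [w $ 1, w $ 2, p, q])"
    unfolding eventually_nhds_ball[of _ "base a"] by blast
  show thesis
    by (rule that[of "min t0 s"]) (use s t0 in \<open>auto intro: holo_on_ball_mono\<close>)
qed

text \<open>The coefficient of \<open>q^2\<close> in the determining equation gives \<open>\<eta>_x = 0\<close> and \<open>\<xi>_u = 0\<close>, because \<open>\<alpha>\<close> is neither 0
  nor 3. The coefficient of q then gives \<open>\<xi>_xx = 0\<close> and \<open>\<eta>_uu = 0\<close>, because \<open>\<alpha>\<close> is not \<open>3/2\<close>.\<close>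

lemma symmetry_i_components:
  assumes \<alpha>: "admissible \<alpha>" and a: "a $ 3 \<noteq> 0" and V: "point_symmetry (canonical_i \<alpha>) a V"
  obtains r k1 c1 k2 c2 where "r > 0" "\<And>w. w \<in> ball (base a) r \<Longrightarrow> V w $ 1 = k1 + c1 * w $ 1 + 0 * w $ 2"
    "\<And>w. w \<in> ball (base a) r \<Longrightarrow> V w $ 2 = k2 + 0 * w $ 1 + c2 * w $ 2"
proof -
  define \<xi> where "\<xi> = (\<lambda>w. V w $ 1)"
  define \<eta> where "\<eta> = (\<lambda>w. V w $ 2)"
  obtain t where t: "t > 0" and hol: "holo_on \<xi> (ball (base a) t)" "holo_on \<eta> (ball (base a) t)"
    and E: "\<And>w. w \<in> ball (base a) t \<Longrightarrow>
      \<forall>\<^sub>F p in nhds (a $ 3). \<forall>\<^sub>F q in nhds (a $ 4). symmetry_equation (canonical_i \<alpha>) \<xi> \<eta> (vector [w $ 1, w $ 2, p, q])"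
    by (rule symmetry_on_fibres[OF V \<xi>_def \<eta>_def]) (rule that)
  have "\<forall>\<^sub>F p in nhds (a $ 3). p \<noteq> 0"
    using eventually_nhds_in_open[of "- {0}" "a $ 3"] a by (simp add: open_Compl)
  have eqs: "[:\<alpha> * partial 1 \<eta> w, 0, (\<alpha> - 3) * partial 2 \<xi> w:] = 0" (is "?C2 = 0")
    "[:0, - (2 * \<alpha> * partial 1 (partial 1 \<eta>) w),
      3 * (partial 1 (partial 2 \<eta>) w - partial 1 (partial 1 \<xi>) w) - 2 * \<alpha> * (2 * partial 1 (partial 2 \<eta>) w - partial 1 (partial 1 \<xi>) w),
      3 * partial 2 (partial 2 \<eta>) w - 9 * partial 1 (partial 2 \<xi>) w - 2 * \<alpha> * (partial 2 (partial 2 \<eta>) w - 2 * partial 1 (partial 2 \<xi>) w),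
      (2 * \<alpha> - 6) * partial 2 (partial 2 \<xi>) w:] = 0" (is "?C1 = 0")
    if w: "w \<in> ball (base a) t" for w
  proof -
    have "\<forall>\<^sub>F p in nhds (a $ 3). [:p\<^sup>2 * prol3_0 \<xi> \<eta> w p, poly ?C1 p, poly ?C2 p:] = 0"
      using E[OF w] \<open>\<forall>\<^sub>F p in nhds (a $ 3). p \<noteq> 0\<close>
    proof eventually_elim
      case (elim p)
      from elim(1) have "\<forall>\<^sub>F q in nhds (a $ 4). poly [:p\<^sup>2 * prol3_0 \<xi> \<eta> w p, poly ?C1 p, poly ?C2 p:] q = 0"
      proof eventually_elim
        case (elim q)
        have b: "base (vector [w $ 1, w $ 2, p, q]) = w"
          by (simp add: vec_eq_iff forall_2)
        let ?z = "vector [w $ 1, w $ 2, p, q] :: complex^4"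
        have "poly [:p\<^sup>2 * prol3_0 \<xi> \<eta> w p, poly ?C1 p, poly ?C2 p:] q =
          p\<^sup>2 * (prol3 (canonical_i \<alpha>) \<xi> \<eta> ?z
            - (\<xi> w * partial 1 (canonical_i \<alpha>) ?z + \<eta> w * partial 2 (canonical_i \<alpha>) ?z
              + prol1 \<xi> \<eta> ?z * partial 3 (canonical_i \<alpha>) ?z + prol2 \<xi> \<eta> ?z * partial 4 (canonical_i \<alpha>) ?z))"
          using \<open>p \<noteq> 0\<close>
          by (simp add: Let_def b prol3_def prol1_def prol2_def canonical_i_qp partial_qp)
             (simp add: qp_def field_simps power2_eq_square power3_eq_cube power4_eq_xxxx)
        then show ?case using elim by (simp only: symmetry_equation_def b) simp
      qed
      then show ?case by (rule poly_eventually_zero)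
    qed
    then have "\<forall>\<^sub>F p in nhds (a $ 3). poly ?C1 p = 0" "\<forall>\<^sub>F p in nhds (a $ 3). poly ?C2 p = 0"
      by (auto elim!: eventually_mono simp del: poly_pCons)
    then show "?C1 = 0" "?C2 = 0"
      by (blast intro: poly_eventually_zero)+
  qed
  have \<alpha>': "\<alpha> \<noteq> 0" "\<alpha> - 3 \<noteq> 0" "2 * \<alpha> - 3 \<noteq> 0"
    using \<alpha> by (auto simp: admissible_def field_simps)
  have \<eta>1: "partial 1 \<eta> w = 0" and \<xi>2: "partial 2 \<xi> w = 0" if "w \<in> ball (base a) t" for w
    using eqs(1)[OF that] \<alpha>' by auto
  have z: "partial i (partial 1 \<eta>) w = 0" "partial 1 (partial i \<eta>) w = 0"
    "partial i (partial 2 \<xi>) w = 0" "partial 2 (partial i \<xi>) w = 0" if "w \<in> ball (base a) t" for w i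
    using second_partials_zero[OF hol(2) \<eta>1 that] second_partials_zero[OF hol(1) \<xi>2 that] by auto
  have \<xi>11: "partial 1 (partial 1 \<xi>) w = 0" and \<eta>22: "partial 2 (partial 2 \<eta>) w = 0" if w: "w \<in> ball (base a) t" for w
  proof -
    have "(2 * \<alpha> - 3) * partial 1 (partial 1 \<xi>) w = 0" "(2 * \<alpha> - 3) * partial 2 (partial 2 \<eta>) w = 0"
      using eqs(2)[OF w] z[OF w] by (auto simp: algebra_simps)
    then show "partial 1 (partial 1 \<xi>) w = 0" "partial 2 (partial 2 \<eta>) w = 0"
      using \<alpha>' by auto
  qed
  have "partial i (partial 1 \<xi>) w = 0" "partial i (partial 2 \<eta>) w = 0" if "w \<in> ball (base a) t" for w i
    using exhaust_2[of i] z[OF that] \<xi>11[OF that] \<eta>22[OF that] by auto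
  then have c: "partial 1 \<xi> w = partial 1 \<xi> (base a)" "partial 2 \<eta> w = partial 2 \<eta> (base a)" if "w \<in> ball (base a) t" for w
    using constant_if_partials_vanish[OF holo_partial[OF hol(1)] _ that] constant_if_partials_vanish[OF holo_partial[OF hol(2)] _ that]
    by blast+
  obtain k1 where k1: "\<And>w. w \<in> ball (base a) t \<Longrightarrow> \<xi> w = k1 + partial 1 \<xi> (base a) * w $ 1 + 0 * w $ 2"
    by (rule affine_if_constant_partials[OF hol(1)], erule c(1), erule \<xi>2, rule that)
  obtain k2 where k2: "\<And>w. w \<in> ball (base a) t \<Longrightarrow> \<eta> w = k2 + 0 * w $ 1 + partial 2 \<eta> (base a) * w $ 2"
    by (rule affine_if_constant_partials[OF hol(2)], erule \<eta>1, erule c(2), rule that)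
  have V_nth: "V w $ 1 = \<xi> w" "V w $ 2 = \<eta> w" for w
    by (simp_all add: \<xi>_def \<eta>_def)
  show thesis
    by (rule that[OF t k1[folded V_nth(1)] k2[folded V_nth(2)]])
qed

text \<open>The coefficient of \<open>q^2\<close> in the determining equation gives \<open>\<xi>_u = 0\<close> and \<open>\<xi>_x = \<eta>_u\<close>, and then the
  coefficient of q makes all second derivatives of \<open>\<eta>\<close> vanish.\<close>

lemma symmetry_ii_components:
  assumes V: "point_symmetry canonical_ii a V"
  obtains r k1 k2 c d where "r > 0" "\<And>w. w \<in> ball (base a) r \<Longrightarrow> V w $ 1 = k1 + c * w $ 1 + 0 * w $ 2"
    "\<And>w. w \<in> ball (base a) r \<Longrightarrow> V w $ 2 = k2 + d * w $ 1 + c * w $ 2"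
proof -
  define \<xi> where "\<xi> = (\<lambda>w. V w $ 1)"
  define \<eta> where "\<eta> = (\<lambda>w. V w $ 2)"
  obtain t where t: "t > 0" and hol: "holo_on \<xi> (ball (base a) t)" "holo_on \<eta> (ball (base a) t)"
    and E: "\<And>w. w \<in> ball (base a) t \<Longrightarrow>
      \<forall>\<^sub>F p in nhds (a $ 3). \<forall>\<^sub>F q in nhds (a $ 4). symmetry_equation canonical_ii \<xi> \<eta> (vector [w $ 1, w $ 2, p, q])"
    by (rule symmetry_on_fibres[OF V \<xi>_def \<eta>_def]) (rule that)
  have eqs: "[:partial 1 \<xi> w - partial 2 \<eta> w - 3 * partial 2 \<xi> w, 2 * partial 2 \<xi> w:] = 0" (is "?C2 = 0")
    "[:3 * (partial 1 (partial 2 \<eta>) w - partial 1 (partial 1 \<xi>) w) - 2 * partial 1 (partial 1 \<eta>) w,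
      3 * partial 2 (partial 2 \<eta>) w - 9 * partial 1 (partial 2 \<xi>) w - 2 * (2 * partial 1 (partial 2 \<eta>) w - partial 1 (partial 1 \<xi>) w),
      - (6 * partial 2 (partial 2 \<xi>) w) - 2 * (partial 2 (partial 2 \<eta>) w - 2 * partial 1 (partial 2 \<xi>) w),
      2 * partial 2 (partial 2 \<xi>) w:] = 0" (is "?C1 = 0")
    if w: "w \<in> ball (base a) t" for w
  proof -
    have "\<forall>\<^sub>F p in nhds (a $ 3). [:prol3_0 \<xi> \<eta> w p, poly ?C1 p, poly ?C2 p:] = 0"
      using E[OF w]
    proof eventually_elim
      case (elim p)
      then have "\<forall>\<^sub>F q in nhds (a $ 4). poly [:prol3_0 \<xi> \<eta> w p, poly ?C1 p, poly ?C2 p:] q = 0"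
      proof eventually_elim
        case (elim q)
        have b: "base (vector [w $ 1, w $ 2, p, q]) = w"
          by (simp add: vec_eq_iff forall_2)
        let ?z = "vector [w $ 1, w $ 2, p, q] :: complex^4"
        have "poly [:prol3_0 \<xi> \<eta> w p, poly ?C1 p, poly ?C2 p:] q =
          prol3 canonical_ii \<xi> \<eta> ?z
            - (\<xi> w * partial 1 canonical_ii ?z + \<eta> w * partial 2 canonical_ii ?z
              + prol1 \<xi> \<eta> ?z * partial 3 canonical_ii ?z + prol2 \<xi> \<eta> ?z * partial 4 canonical_ii ?z)"
          by (simp add: Let_def b prol3_def prol1_def prol2_def canonical_ii_qp partial_qp)
             (simp add: qp_def algebra_simps power2_eq_square power3_eq_cube)
        then show ?case using elim by (simp only: symmetry_equation_def b) simp
      qed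
      then show ?case by (rule poly_eventually_zero)
    qed
    then have "\<forall>\<^sub>F p in nhds (a $ 3). poly ?C1 p = 0" "\<forall>\<^sub>F p in nhds (a $ 3). poly ?C2 p = 0"
      by (auto elim!: eventually_mono simp del: poly_pCons)
    then show "?C1 = 0" "?C2 = 0"
      by (blast intro: poly_eventually_zero)+
  qed
  have \<xi>2: "partial 2 \<xi> w = 0" and \<xi>1: "partial 1 \<xi> w = partial 2 \<eta> w" if "w \<in> ball (base a) t" for w
    using eqs(1)[OF that] by auto
  have z: "partial i (partial 2 \<xi>) w = 0" "partial 2 (partial i \<xi>) w = 0" if "w \<in> ball (base a) t" for w i
    using second_partials_zero[OF hol(1) \<xi>2 that] by auto
  have e: "partial i (partial 1 \<xi>) w = partial i (partial 2 \<eta>) w" if "w \<in> ball (base a) t" for w i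
    by (rule partial_cong[OF open_ball \<xi>1 that])
  have \<eta>: "partial 2 (partial 2 \<eta>) w = 0" "partial 1 (partial 2 \<eta>) w = 0" "partial 1 (partial 1 \<eta>) w = 0"
    if w: "w \<in> ball (base a) t" for w
  proof -
    show 22: "partial 2 (partial 2 \<eta>) w = 0"
      using eqs(2)[OF w] z[OF w] by auto
    show 12: "partial 1 (partial 2 \<eta>) w = 0"
      using eqs(2)[OF w] z[OF w] e[OF w, of 1] 22 by (auto simp: algebra_simps)
    show "partial 1 (partial 1 \<eta>) w = 0"
      using eqs(2)[OF w] z[OF w] e[OF w, of 1] 12 by auto
  qed
  have "partial i (partial 1 \<eta>) w = 0" "partial i (partial 2 \<eta>) w = 0" if "w \<in> ball (base a) t" for w i
    using exhaust_2[of i] \<eta>[OF that] partial_commute[OF hol(2) that, of 2 1] by auto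
  then have c: "partial 1 \<eta> w = partial 1 \<eta> (base a)" "partial 2 \<eta> w = partial 2 \<eta> (base a)" if "w \<in> ball (base a) t" for w
    using constant_if_partials_vanish[OF holo_partial[OF hol(2)] _ that] by blast+
  have c1: "partial 1 \<xi> w = partial 2 \<eta> (base a)" if "w \<in> ball (base a) t" for w
    using \<xi>1[OF that] c(2)[OF that] by simp
  obtain k1 where k1: "\<And>w. w \<in> ball (base a) t \<Longrightarrow> \<xi> w = k1 + partial 2 \<eta> (base a) * w $ 1 + 0 * w $ 2"
    by (rule affine_if_constant_partials[OF hol(1)], erule c1, erule \<xi>2, rule that)
  obtain k2 where k2: "\<And>w. w \<in> ball (base a) t \<Longrightarrow> \<eta> w = k2 + partial 1 \<eta> (base a) * w $ 1 + partial 2 \<eta> (base a) * w $ 2"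
    by (rule affine_if_constant_partials[OF hol(2)], erule c(1), erule c(2), rule that)
  have V_nth: "V w $ 1 = \<xi> w" "V w $ 2 = \<eta> w" for w
    by (simp_all add: \<xi>_def \<eta>_def)
  show thesis
    by (rule that[OF t k1[folded V_nth(1)] k2[folded V_nth(2)]])
qed

lemma partial_const_fun: "partial i (\<lambda>z. c) = (\<lambda>z. 0)"
  by (rule ext) simp

lemma affine_prolongation:
  fixes k1 c1 c2 k2 d1 d2 :: complex
  defines "\<xi> \<equiv> \<lambda>w::complex^2. k1 + c1 * w $ 1 + c2 * w $ 2" and "\<eta> \<equiv> \<lambda>w::complex^2. k2 + d1 * w $ 1 + d2 * w $ 2"
  shows "prol1 \<xi> \<eta> z = d1 + z $ 3 * (d2 - c1) - (z $ 3)\<^sup>2 * c2"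
    "prol2 \<xi> \<eta> z = z $ 4 * (d2 - 2 * c1 - 3 * z $ 3 * c2)"
    "prol3 f \<xi> \<eta> z = - (3 * (z $ 4)\<^sup>2 * c2) + f z * (d2 - 3 * c1 - 4 * z $ 3 * c2)"
  unfolding prol1_def prol2_def prol3_def prol3_0_def Let_def \<xi>_def \<eta>_def partial_affine partial_const_fun
  by simp_all

lemma affine_symmetry:
  assumes V: "\<And>w. V w = vector [k1 + c1 * w $ 1 + c2 * w $ 2, k2 + d1 * w $ 1 + d2 * w $ 2]"
    and E: "\<forall>\<^sub>F z in nhds a. - (3 * (z $ 4)\<^sup>2 * c2) + f z * (d2 - 3 * c1 - 4 * z $ 3 * c2) =
      V (base z) $ 1 * partial 1 f z + V (base z) $ 2 * partial 2 f z
      + (d1 + z $ 3 * (d2 - c1) - (z $ 3)\<^sup>2 * c2) * partial 3 f z + z $ 4 * (d2 - 2 * c1 - 3 * z $ 3 * c2) * partial 4 f z"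
  shows "point_symmetry f a V"
  by (subst point_symmetry_iff[where W=UNIV])
     (use E in \<open>simp_all only: symmetry_equation_def[abs_def] V vector_2 holo_affine affine_prolongation UNIV_I\<close>)

lemma linear_eventually_zero:
  assumes "\<forall>\<^sub>F x in nhds (y :: complex). c + d * x = 0"
  shows "c = 0" "d = 0"
  using poly_eventually_zero[of "[:c, d:]" y] assms by (simp_all add: mult.commute)

lemma four_point_symmetries_i:
  assumes \<alpha>: "admissible \<alpha>" and a: "a $ 3 \<noteq> 0"
  shows "four_point_symmetries (canonical_i \<alpha>) a"
proof -
  define B :: "4 \<Rightarrow> complex^2 \<Rightarrow> complex^2" where
    "B i w = (if i = 1 then vector [1, 0] else if i = 2 then vector [0, 1]
      else if i = 3 then vector [w $ 1, 0] else vector [0, w $ 2])" for i w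
  have comb: "(\<Sum>i\<in>UNIV. c $ i *s B i w) = vector [c $ 1 + c $ 3 * w $ 1, c $ 2 + c $ 4 * w $ 2]" for c w
    by (simp add: sum_4 B_def vec_eq_iff forall_2)
  have p: "\<forall>\<^sub>F z in nhds a. z $ 3 \<noteq> 0"
    using eventually_nhds_in_open[OF open_p_nonzero, of a] a by (simp add: p_nonzero_def)
  have sym: "point_symmetry (canonical_i \<alpha>) a V"
    if "\<And>w. V w = vector [k1 + c1 * w $ 1 + 0 * w $ 2, k2 + 0 * w $ 1 + d2 * w $ 2]" for V k1 k2 c1 d2
  proof (rule affine_symmetry[OF that])
    show "\<forall>\<^sub>F z in nhds a. - (3 * (z $ 4)\<^sup>2 * 0) + canonical_i \<alpha> z * (d2 - 3 * c1 - 4 * z $ 3 * 0) =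
      V (base z) $ 1 * partial 1 (canonical_i \<alpha>) z + V (base z) $ 2 * partial 2 (canonical_i \<alpha>) z
      + (0 + z $ 3 * (d2 - c1) - (z $ 3)\<^sup>2 * 0) * partial 3 (canonical_i \<alpha>) z
      + z $ 4 * (d2 - 2 * c1 - 3 * z $ 3 * 0) * partial 4 (canonical_i \<alpha>) z"
      using p
      by eventually_elim
         (simp add: canonical_i_qp partial_qp, simp add: qp_def field_simps power2_eq_square)
  qed
  have "point_symmetry (canonical_i \<alpha>) a (B i)" for i
  proof -
    have "i = 1 \<or> i = 2 \<or> i = 3 \<or> i = 4" by (rule exhaust_4)
    then show ?thesis
      by (elim disjE; intro sym[of _ "if i = 1 then 1 else 0" "if i = 3 then 1 else 0" "if i = 2 then 1 else 0" "if i = 4 then 1 else 0"];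
          simp add: B_def)
  qed
  moreover have "\<exists>!c::complex^4. \<forall>\<^sub>F w in nhds (base a). V w = (\<Sum>i\<in>UNIV. c $ i *s B i w)"
    if S: "point_symmetry (canonical_i \<alpha>) a V" for V
  proof -
    obtain r k1 c1 k2 c2 where r: "r > 0" "\<And>w. w \<in> ball (base a) r \<Longrightarrow> V w $ 1 = k1 + c1 * w $ 1 + 0 * w $ 2"
      "\<And>w. w \<in> ball (base a) r \<Longrightarrow> V w $ 2 = k2 + 0 * w $ 1 + c2 * w $ 2"
      by (rule symmetry_i_components[OF \<alpha> a S]) (rule that)
    have V: "\<forall>\<^sub>F w in nhds (base a). V w = vector [k1 + c1 * w $ 1, k2 + c2 * w $ 2]"
      unfolding eventually_nhds_ball using r by (intro exI[of _ r]) (simp add: vec_eq_iff forall_2)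
    show ?thesis
    proof (rule ex1I[of _ "vector [k1, k2, c1, c2]"])
      show "\<forall>\<^sub>F w in nhds (base a). V w = (\<Sum>i\<in>UNIV. vector [k1, k2, c1, c2] $ i *s B i w)"
        unfolding comb using V by simp
      fix c :: "complex^4" assume "\<forall>\<^sub>F w in nhds (base a). V w = (\<Sum>i\<in>UNIV. c $ i *s B i w)"
      with V have *: "\<forall>\<^sub>F w in nhds (base a). (c $ 1 - k1) + (c $ 3 - c1) * w $ 1 = 0 \<and> (c $ 2 - k2) + (c $ 4 - c2) * w $ 2 = 0"
        unfolding comb by eventually_elim (simp add: vec_eq_iff forall_2 algebra_simps)
      have "\<forall>\<^sub>F x in nhds (base a $ 1). (c $ 1 - k1) + (c $ 3 - c1) * x = 0"
        "\<forall>\<^sub>F x in nhds (base a $ 2). (c $ 2 - k2) + (c $ 4 - c2) * x = 0"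
        using eventually_on_axes[OF *] by (auto elim!: eventually_mono)
      from linear_eventually_zero[OF this(1)] linear_eventually_zero[OF this(2)]
      show "c = vector [k1, k2, c1, c2]"
        by (simp add: vec4_eq_iff)
    qed
  qed
  ultimately show ?thesis
    unfolding four_point_symmetries_def by blast
qed

lemma four_point_symmetries_ii: "four_point_symmetries canonical_ii a"
proof -
  define B :: "4 \<Rightarrow> complex^2 \<Rightarrow> complex^2" where
    "B i w = (if i = 1 then vector [1, 0] else if i = 2 then vector [0, 1]
      else if i = 3 then vector [w $ 1, w $ 2] else vector [0, w $ 1])" for i w
  have comb: "(\<Sum>i\<in>UNIV. c $ i *s B i w) = vector [c $ 1 + c $ 3 * w $ 1, c $ 2 + c $ 3 * w $ 2 + c $ 4 * w $ 1]" for c w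
    by (simp add: sum_4 B_def vec_eq_iff forall_2)
  have sym: "point_symmetry canonical_ii a V"
    if "\<And>w. V w = vector [k1 + c * w $ 1 + 0 * w $ 2, k2 + d * w $ 1 + c * w $ 2]" for V k1 k2 c d
  proof (rule affine_symmetry[OF that])
    show "\<forall>\<^sub>F z in nhds a. - (3 * (z $ 4)\<^sup>2 * 0) + canonical_ii z * (c - 3 * c - 4 * z $ 3 * 0) =
      V (base z) $ 1 * partial 1 canonical_ii z + V (base z) $ 2 * partial 2 canonical_ii z
      + (d + z $ 3 * (c - c) - (z $ 3)\<^sup>2 * 0) * partial 3 canonical_ii z
      + z $ 4 * (c - 2 * c - 3 * z $ 3 * 0) * partial 4 canonical_ii z"
      by (rule always_eventually)
         (simp add: canonical_ii_qp partial_qp, simp add: qp_def algebra_simps power2_eq_square)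
  qed
  have "point_symmetry canonical_ii a (B i)" for i
  proof -
    have "i = 1 \<or> i = 2 \<or> i = 3 \<or> i = 4" by (rule exhaust_4)
    then show ?thesis
      by (elim disjE; intro sym[of _ "if i = 1 then 1 else 0" "if i = 3 then 1 else 0" "if i = 2 then 1 else 0" "if i = 4 then 1 else 0"];
          simp add: B_def)
  qed
  moreover have "\<exists>!c::complex^4. \<forall>\<^sub>F w in nhds (base a). V w = (\<Sum>i\<in>UNIV. c $ i *s B i w)"
    if S: "point_symmetry canonical_ii a V" for V
  proof -
    obtain r k1 k2 m d where r: "r > 0" "\<And>w. w \<in> ball (base a) r \<Longrightarrow> V w $ 1 = k1 + m * w $ 1 + 0 * w $ 2"
      "\<And>w. w \<in> ball (base a) r \<Longrightarrow> V w $ 2 = k2 + d * w $ 1 + m * w $ 2"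
      by (rule symmetry_ii_components[OF S]) (rule that)
    have V: "\<forall>\<^sub>F w in nhds (base a). V w = vector [k1 + m * w $ 1, k2 + m * w $ 2 + d * w $ 1]"
      unfolding eventually_nhds_ball using r by (intro exI[of _ r]) (simp add: vec_eq_iff forall_2)
    show ?thesis
    proof (rule ex1I[of _ "vector [k1, k2, m, d]"])
      show "\<forall>\<^sub>F w in nhds (base a). V w = (\<Sum>i\<in>UNIV. vector [k1, k2, m, d] $ i *s B i w)"
        unfolding comb using V by simp
      fix c :: "complex^4" assume "\<forall>\<^sub>F w in nhds (base a). V w = (\<Sum>i\<in>UNIV. c $ i *s B i w)"
      with V have *: "\<forall>\<^sub>F w in nhds (base a). (c $ 1 - k1) + (c $ 3 - m) * w $ 1 = 0 \<and>
          (c $ 2 - k2) + (c $ 3 - m) * w $ 2 + (c $ 4 - d) * w $ 1 = 0"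
        unfolding comb by eventually_elim (simp add: vec_eq_iff forall_2 algebra_simps)
      have 1: "\<forall>\<^sub>F x in nhds (base a $ 1). (c $ 1 - k1) + (c $ 3 - m) * x = 0"
        and 2: "\<forall>\<^sub>F x in nhds (base a $ 1). ((c $ 2 - k2) + (c $ 3 - m) * base a $ 2) + (c $ 4 - d) * x = 0"
        using eventually_on_axes(1)[OF *] by (auto elim!: eventually_mono)
      show "c = vector [k1, k2, m, d]"
        using linear_eventually_zero[OF 1] linear_eventually_zero[OF 2] by (simp add: vec4_eq_iff)
    qed
  qed
  ultimately show ?thesis
    unfolding four_point_symmetries_def by blast
qed

theorem theorem3p2:
  fixes f :: "complex^4 \<Rightarrow> complex" and a :: "complex^4"
  assumes "holomorphic_at f a"
  shows
    "(\<forall>\<alpha> b. admissible \<alpha> \<and> b $ 3 \<noteq> 0 \<longrightarrow> four_point_symmetries (canonical_i \<alpha>) b) \<and>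
     (\<forall>b. four_point_symmetries canonical_ii b) \<and>
     ((\<exists>\<alpha> b. admissible \<alpha> \<and> generic_i b \<and> point_equivalent f a (canonical_i \<alpha>) b) \<longleftrightarrow>
       (\<forall>\<^sub>F z in nhds a. I4 f z \<noteq> 0 \<and> I5 f z \<noteq> 0 \<and> I6 f z = 0) \<and>
       (\<exists>J4 J5. invariant_roots f a J4 J5 \<and> (\<forall>\<^sub>F z in nhds a. partial 4 J4 z \<noteq> 0) \<and>
          (\<exists>\<alpha> b K4 K5. admissible \<alpha> \<and> generic_i b \<and> invariant_roots (canonical_i \<alpha>) b K4 K5 \<and>
             same_constant_structure (invariant_coframe f J4 J5) a
               (invariant_coframe (canonical_i \<alpha>) K4 K5) b))) \<and>
     ((\<exists>b. generic_ii b \<and> point_equivalent f a canonical_ii b) \<longleftrightarrow>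
       (\<forall>\<^sub>F z in nhds a. I4 f z \<noteq> 0 \<and> I5 f z \<noteq> 0 \<and> I6 f z = 0) \<and>
       (\<exists>J4 J5. invariant_roots f a J4 J5 \<and> (\<forall>\<^sub>F z in nhds a. partial 4 J4 z \<noteq> 0) \<and>
          (\<exists>b K4 K5. generic_ii b \<and> invariant_roots canonical_ii b K4 K5 \<and>
             same_constant_structure (invariant_coframe f J4 J5) a
               (invariant_coframe canonical_ii K4 K5) b))) \<and>
     ((\<exists>\<alpha> b. admissible \<alpha> \<and> generic_i b \<and> point_equivalent f a (canonical_i \<alpha>) b) \<longrightarrow>
       (\<forall>\<alpha>. admissible \<alpha> \<longrightarrow>
          ((\<exists>b. generic_i b \<and> point_equivalent f a (canonical_i \<alpha>) b) \<longleftrightarrow>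
           (\<exists>J4 J5 \<beta> \<gamma>. invariant_roots f a J4 J5 \<and>
              \<beta> ^ 3 = 2 * \<alpha> ^ 3 - 9 * \<alpha>\<^sup>2 + 9 * \<alpha> \<and> \<gamma>\<^sup>2 = \<alpha>\<^sup>2 - 3 * \<alpha> \<and>
              (\<forall>\<^sub>F z in nhds a. partial 4 J4 z / J5 z = \<beta> / \<gamma>)))))"
proof (intro conjI)
  show "\<forall>\<alpha> b. admissible \<alpha> \<and> b $ 3 \<noteq> 0 \<longrightarrow> four_point_symmetries (canonical_i \<alpha>) b"
    using four_point_symmetries_i by blast
  show "\<forall>b. four_point_symmetries canonical_ii b"
    using four_point_symmetries_ii by blast
  have roots_i: "\<exists>\<beta> \<gamma>. \<beta> ^ 3 = 2 * \<alpha> ^ 3 - 9 * \<alpha>\<^sup>2 + 9 * \<alpha> \<and> \<gamma>\<^sup>2 = \<alpha>\<^sup>2 - 3 * \<alpha>" for \<alpha> :: complex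
    using complex_root_exists[of 3] complex_root_exists[of 2] by simp
  show "(\<exists>\<alpha> b. admissible \<alpha> \<and> generic_i b \<and> point_equivalent f a (canonical_i \<alpha>) b) \<longleftrightarrow>
       (\<forall>\<^sub>F z in nhds a. I4 f z \<noteq> 0 \<and> I5 f z \<noteq> 0 \<and> I6 f z = 0) \<and>
       (\<exists>J4 J5. invariant_roots f a J4 J5 \<and> (\<forall>\<^sub>F z in nhds a. partial 4 J4 z \<noteq> 0) \<and>
          (\<exists>\<alpha> b K4 K5. admissible \<alpha> \<and> generic_i b \<and> invariant_roots (canonical_i \<alpha>) b K4 K5 \<and>
             same_constant_structure (invariant_coframe f J4 J5) a
               (invariant_coframe (canonical_i \<alpha>) K4 K5) b))" (is "?L \<longleftrightarrow> ?R")
  proof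
    assume ?L
    then obtain \<alpha> b where \<alpha>: "admissible \<alpha>" and b: "generic_i b" and pe: "point_equivalent f a (canonical_i \<alpha>) b"
      by blast
    obtain \<beta> \<gamma> where \<beta>\<gamma>: "\<beta> ^ 3 = 2 * \<alpha> ^ 3 - 9 * \<alpha>\<^sup>2 + 9 * \<alpha>" "\<gamma>\<^sup>2 = \<alpha>\<^sup>2 - 3 * \<alpha>"
      using roots_i by blast
    obtain J4 J5 K4 K5 where J: "invariant_roots f a J4 J5" and K: "invariant_roots (canonical_i \<alpha>) b K4 K5"
      and I: "\<forall>\<^sub>F z in nhds a. I4 f z \<noteq> 0 \<and> I5 f z \<noteq> 0 \<and> I6 f z = 0" and q: "\<forall>\<^sub>F z in nhds a. partial 4 J4 z \<noteq> 0"
      and same: "same_constant_structure (invariant_coframe f J4 J5) a (invariant_coframe (canonical_i \<alpha>) K4 K5) b"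
      by (rule form_i_invariants[OF assms \<alpha> b pe \<beta>\<gamma>]) (rule that)
    show ?R
      by (intro conjI exI[of _ J4] exI[of _ J5] exI[of _ \<alpha>] exI[of _ b] exI[of _ K4] exI[of _ K5] I J q \<alpha> b K same)
  next
    assume R: ?R
    then have I: "\<forall>\<^sub>F z in nhds a. I4 f z \<noteq> 0 \<and> I5 f z \<noteq> 0"
      by (auto elim: eventually_mono)
    from R obtain J4 J5 \<alpha> b K4 K5 where J: "invariant_roots f a J4 J5" "\<forall>\<^sub>F z in nhds a. partial 4 J4 z \<noteq> 0"
      and K: "admissible \<alpha>" "generic_i b" "invariant_roots (canonical_i \<alpha>) b K4 K5"
        "same_constant_structure (invariant_coframe f J4 J5) a (invariant_coframe (canonical_i \<alpha>) K4 K5) b"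
      by blast
    show ?L
      using equivalent_to_form_i[OF assms J(1) I J(2) K] K(1) by blast
  qed
  show "(\<exists>b. generic_ii b \<and> point_equivalent f a canonical_ii b) \<longleftrightarrow>
       (\<forall>\<^sub>F z in nhds a. I4 f z \<noteq> 0 \<and> I5 f z \<noteq> 0 \<and> I6 f z = 0) \<and>
       (\<exists>J4 J5. invariant_roots f a J4 J5 \<and> (\<forall>\<^sub>F z in nhds a. partial 4 J4 z \<noteq> 0) \<and>
          (\<exists>b K4 K5. generic_ii b \<and> invariant_roots canonical_ii b K4 K5 \<and>
             same_constant_structure (invariant_coframe f J4 J5) a
               (invariant_coframe canonical_ii K4 K5) b))" (is "?L \<longleftrightarrow> ?R")
  proof
    assume ?L
    then obtain b where b: "generic_ii b" and pe: "point_equivalent f a canonical_ii b"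
      by blast
    obtain \<kappa> \<delta> :: complex where \<kappa>\<delta>: "\<kappa> ^ 3 = 2 / 27" "\<delta>\<^sup>2 = 1 / 9"
      using complex_root_exists[of 3 "2 / 27"] complex_root_exists[of 2 "1 / 9"] by auto
    obtain J4 J5 K4 K5 where J: "invariant_roots f a J4 J5" and K: "invariant_roots canonical_ii b K4 K5"
      and I: "\<forall>\<^sub>F z in nhds a. I4 f z \<noteq> 0 \<and> I5 f z \<noteq> 0 \<and> I6 f z = 0" and q: "\<forall>\<^sub>F z in nhds a. partial 4 J4 z \<noteq> 0"
      and same: "same_constant_structure (invariant_coframe f J4 J5) a (invariant_coframe canonical_ii K4 K5) b"
      by (rule form_ii_invariants[OF assms b pe \<kappa>\<delta>]) (rule that)
    show ?R
      by (intro conjI exI[of _ J4] exI[of _ J5] exI[of _ b] exI[of _ K4] exI[of _ K5] I J q b K same)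
  next
    assume R: ?R
    then have I: "\<forall>\<^sub>F z in nhds a. I4 f z \<noteq> 0 \<and> I5 f z \<noteq> 0"
      by (auto elim: eventually_mono)
    from R obtain J4 J5 b K4 K5 where J: "invariant_roots f a J4 J5" "\<forall>\<^sub>F z in nhds a. partial 4 J4 z \<noteq> 0"
      and K: "generic_ii b" "invariant_roots canonical_ii b K4 K5"
        "same_constant_structure (invariant_coframe f J4 J5) a (invariant_coframe canonical_ii K4 K5) b"
      by blast
    show ?L
      using equivalent_to_form_ii[OF assms J(1) I J(2) K] by blast
  qed
  show "(\<exists>\<alpha> b. admissible \<alpha> \<and> generic_i b \<and> point_equivalent f a (canonical_i \<alpha>) b) \<longrightarrow>
       (\<forall>\<alpha>. admissible \<alpha> \<longrightarrow>
          ((\<exists>b. generic_i b \<and> point_equivalent f a (canonical_i \<alpha>) b) \<longleftrightarrow>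
           (\<exists>J4 J5 \<beta> \<gamma>. invariant_roots f a J4 J5 \<and>
              \<beta> ^ 3 = 2 * \<alpha> ^ 3 - 9 * \<alpha>\<^sup>2 + 9 * \<alpha> \<and> \<gamma>\<^sup>2 = \<alpha>\<^sup>2 - 3 * \<alpha> \<and>
              (\<forall>\<^sub>F z in nhds a. partial 4 J4 z / J5 z = \<beta> / \<gamma>))))"
  proof (intro impI allI)
    assume "\<exists>\<alpha> b. admissible \<alpha> \<and> generic_i b \<and> point_equivalent f a (canonical_i \<alpha>) b"
    then obtain \<alpha>0 b0 where \<alpha>0: "admissible \<alpha>0" "generic_i b0" "point_equivalent f a (canonical_i \<alpha>0) b0"
      by blast
    fix \<alpha> assume \<alpha>: "admissible \<alpha>"
    show "(\<exists>b. generic_i b \<and> point_equivalent f a (canonical_i \<alpha>) b) \<longleftrightarrow>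
           (\<exists>J4 J5 \<beta> \<gamma>. invariant_roots f a J4 J5 \<and>
              \<beta> ^ 3 = 2 * \<alpha> ^ 3 - 9 * \<alpha>\<^sup>2 + 9 * \<alpha> \<and> \<gamma>\<^sup>2 = \<alpha>\<^sup>2 - 3 * \<alpha> \<and>
              (\<forall>\<^sub>F z in nhds a. partial 4 J4 z / J5 z = \<beta> / \<gamma>))" (is "?L \<longleftrightarrow> ?R")
    proof
      assume ?L
      then obtain b where b: "generic_i b" and pe: "point_equivalent f a (canonical_i \<alpha>) b"
        by blast
      obtain \<beta> \<gamma> where \<beta>\<gamma>: "\<beta> ^ 3 = 2 * \<alpha> ^ 3 - 9 * \<alpha>\<^sup>2 + 9 * \<alpha>" "\<gamma>\<^sup>2 = \<alpha>\<^sup>2 - 3 * \<alpha>"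
        using roots_i by blast
      obtain J4 J5 where J: "invariant_roots f a J4 J5" and r: "\<forall>\<^sub>F z in nhds a. partial 4 J4 z / J5 z = \<beta> / \<gamma>"
        by (rule form_i_invariants[OF assms \<alpha> b pe \<beta>\<gamma>]) (rule that)
      show ?R
        by (intro exI[of _ J4] exI[of _ J5] exI[of _ \<beta>] exI[of _ \<gamma>] conjI J \<beta>\<gamma> r)
    next
      assume ?R
      then obtain J4 J5 \<beta> \<gamma> where J: "invariant_roots f a J4 J5"
        and \<beta>\<gamma>: "\<beta> ^ 3 = 2 * \<alpha> ^ 3 - 9 * \<alpha>\<^sup>2 + 9 * \<alpha>" "\<gamma>\<^sup>2 = \<alpha>\<^sup>2 - 3 * \<alpha>"
        and r: "\<forall>\<^sub>F z in nhds a. partial 4 J4 z / J5 z = \<beta> / \<gamma>"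
        by blast
      obtain \<beta>0 \<gamma>0 where \<beta>\<gamma>0: "\<beta>0 ^ 3 = 2 * \<alpha>0 ^ 3 - 9 * \<alpha>0\<^sup>2 + 9 * \<alpha>0" "\<gamma>0\<^sup>2 = \<alpha>0\<^sup>2 - 3 * \<alpha>0"
        using roots_i by blast
      obtain L4 L5 where L: "invariant_roots f a L4 L5"
        and I: "\<forall>\<^sub>F z in nhds a. I4 f z \<noteq> 0 \<and> I5 f z \<noteq> 0 \<and> I6 f z = 0"
        and r0: "\<forall>\<^sub>F z in nhds a. partial 4 L4 z / L5 z = \<beta>0 / \<gamma>0"
        by (rule form_i_invariants[OF assms \<alpha>0 \<beta>\<gamma>0]) (rule that)
      have "(\<beta> / \<gamma>) ^ 6 = (\<beta>0 / \<gamma>0) ^ 6"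
        using ratio_unique[OF J L I] eventually_nhds_x_imp_x[OF r] eventually_nhds_x_imp_x[OF r0] by simp
      from ratio_determines_parameter[OF \<alpha> \<alpha>0(1) \<beta>\<gamma> \<beta>\<gamma>0 this]
      show ?L
      proof
        assume "\<alpha>0 = \<alpha>"
        then show ?L using \<alpha>0 by blast
      next
        assume "\<alpha>0 = 3 - \<alpha>"
        then have "3 - \<alpha>0 = \<alpha>" by simp
        then show ?L using form_i_swap[OF assms \<alpha>0(2,3)] by simp
      qed
    qed
  qed
qed

end
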